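(* Let $B$ be a standard Brownian motion started at $0$, on the interval $[0,t]$ with $t>0$. The local $\zeta$-function of $B$ at the level $x>0$ admits a meromorphic continuation to the entire complex plane given by $$\zeta_B^x(p)=2^{-\frac{3p}2}(2^p-1)\,t^{\frac p2}\,\zeta(p)\,\Gamma(p+1)\left(\frac{{}_1F_1\!\left(\frac{-p}2;\frac12;\frac{-x^2}{2t}\right)}{\Gamma\!\left(\frac p2+1\right)}-\sqrt{\frac{2x^2}t}\;\frac{{}_1F_1\!\left(\frac{1-p}2;\frac32;\frac{-x^2}{2t}\right)}{\Gamma\!\left(\frac{p+1}2\right)}\right).$$
   Context: $\zeta$ is the Riemann zeta function and ${}_1F_1$ the confluent hypergeometric function. $N_t^{x,x+\varepsilon}$ is the number of points of the ($H_0$, superlevel set) persistence diagram of $B|_{[0,t]}$ in $]-\infty,x]\times[x+\varepsilon,\infty[$, i.e. the number of connected components of $\{u\in[0,t]:B_u>x\}$ on which $B$ reaches $x+\varepsilon$; for $x>0$ it is the number of upcrossings from $x$ to $x+\varepsilon$ completed by time $t$. The local $\zeta$-function at $x$ is $\zeta_B^x(p)=p\int_0^\infty\varepsilon^{p-1}\,\mathbb{E}[N_t^{x,x+\varepsilon}]\,d\varepsilon$ where this integral converges (here $\mathrm{Re}(p)>1$). *)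

theory Defs
  imports "HOL-Probability.Probability" "HOL-Complex_Analysis.Complex_Analysis"
begin

subsection \<open>Special functions\<close>

text \<open>
  The Riemann zeta function: the unique analytic continuation of the Dirichlet series to the plane
  without the point 1. The value at the pole 1 is fixed to 0 so that the description is unique.
\<close>
definition riemann_zeta :: "complex \<Rightarrow> complex" where
  "riemann_zeta =
     (THE f. f holomorphic_on (- {1}) \<and>
             (\<forall>s. Re s > 1 \<longrightarrow> (\<lambda>n. 1 / of_nat (Suc n) powr s) sums f s) \<and>
             f 1 = 0)"

definition hypergeo_1F1 :: "complex \<Rightarrow> complex \<Rightarrow> complex \<Rightarrow> complex" where
  "hypergeo_1F1 a b z = (\<Sum>n. pochhammer a n / pochhammer b n * z ^ n / fact n)"

subsection \<open>Brownian motion on a compact interval\<close>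

locale standard_brownian_motion_on = prob_space M
  for M :: "'a measure" and B :: "real \<Rightarrow> 'a \<Rightarrow> real" and T :: real +
  assumes measurable_marginals: "u \<in> {0..T} \<Longrightarrow> random_variable borel (B u)"
    and starts_at_0: "AE \<omega> in M. B 0 \<omega> = 0"
    and independent_increments:
      "\<lbrakk>0 \<le> s 0; \<forall>i<n. s i \<le> s (Suc i); s n \<le> T\<rbrakk> \<Longrightarrow>
        indep_vars (\<lambda>_. borel) (\<lambda>i \<omega>. B (s (Suc i)) \<omega> - B (s i) \<omega>) {..<(n::nat)}"
    and gaussian_increments:
      "\<lbrakk>0 \<le> u; u < v; v \<le> T\<rbrakk> \<Longrightarrow>
        distributed M lborel (\<lambda>\<omega>. B v \<omega> - B u \<omega>)
          (\<lambda>y. ennreal (normal_density 0 (sqrt (v - u)) y))"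
    and continuous_paths: "AE \<omega> in M. continuous_on {0..T} (\<lambda>u. B u \<omega>)"

subsection \<open>The local zeta function\<close>

text \<open>
  Counting measure is used instead of \<^const>\<open>card\<close>, so that infinitely many components count
  as infinity rather than 0.
\<close>
definition num_bars :: "(real \<Rightarrow> real) \<Rightarrow> real \<Rightarrow> real \<Rightarrow> real \<Rightarrow> ennreal" where
  "num_bars f T x \<epsilon> =
     emeasure (count_space UNIV)
       {C \<in> components {u \<in> {0..T}. f u > x}. \<exists>u\<in>C. f u \<ge> x + \<epsilon>}"

definition expected_num_bars ::
  "'a measure \<Rightarrow> (real \<Rightarrow> 'a \<Rightarrow> real) \<Rightarrow> real \<Rightarrow> real \<Rightarrow> real \<Rightarrow> ennreal" where
  "expected_num_bars M B T x \<epsilon> = (\<integral>\<^sup>+ \<omega>. num_bars (\<lambda>u. B u \<omega>) T x \<epsilon> \<partial>M)"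

definition local_zeta_integrand ::
  "'a measure \<Rightarrow> (real \<Rightarrow> 'a \<Rightarrow> real) \<Rightarrow> real \<Rightarrow> real \<Rightarrow> complex \<Rightarrow> real \<Rightarrow> complex" where
  "local_zeta_integrand M B T x p \<epsilon> =
     of_real \<epsilon> powr (p - 1) * of_real (enn2real (expected_num_bars M B T x \<epsilon>))"

text \<open>
  The domain of the integral. The first condition is needed because \<^const>\<open>enn2real\<close> maps
  infinity to 0.
\<close>
definition local_zeta_domain ::
  "'a measure \<Rightarrow> (real \<Rightarrow> 'a \<Rightarrow> real) \<Rightarrow> real \<Rightarrow> real \<Rightarrow> complex set" where
  "local_zeta_domain M B T x =
     {p. (\<forall>\<epsilon>>0. expected_num_bars M B T x \<epsilon> < \<infinity>) \<and>
         set_integrable lborel {0<..} (local_zeta_integrand M B T x p)}"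

definition local_zeta ::
  "'a measure \<Rightarrow> (real \<Rightarrow> 'a \<Rightarrow> real) \<Rightarrow> real \<Rightarrow> real \<Rightarrow> complex \<Rightarrow> complex" where
  "local_zeta M B T x p = p * (LINT \<epsilon>:{0<..}|lborel. local_zeta_integrand M B T x p \<epsilon>)"

subsection \<open>Meromorphic continuation\<close>

text \<open>
  The values of \<open>g\<close> at isolated singularities, removable ones included, are irrelevant for
  \<open>g meromorphic_on UNIV\<close>. For instance, a product formula involving \<^const>\<open>Gamma\<close> (which is 0
  at its poles by convention) may be used for \<open>g\<close>.
\<close>
definition meromorphic_continuation ::
  "(complex \<Rightarrow> complex) \<Rightarrow> complex set \<Rightarrow> (complex \<Rightarrow> complex) \<Rightarrow> bool" where
  "meromorphic_continuation f D g \<longleftrightarrow> g meromorphic_on UNIV \<and> (\<forall>p\<in>D. g p = f p)"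

end

theory Submission
  imports Defs "HOL-Real_Asymp.Real_Asymp"
begin

text \<open>
  For a path below \<open>x\<close> at time 0, there are at least \<open>k + 1\<close> bars if and only if the path
  successively reaches \<open>x + \<epsilon>\<close>, \<open>x\<close>, \<open>x + \<epsilon>\<close>, \<dots>, \<open>x + \<epsilon>\<close> (\<open>2 k + 1\<close> alternating hits). Reflecting
  at the successive hitting times, from the last one to the first, turns this event into the single
  hit of the level \<open>x + (2 k + 1) \<epsilon>\<close>, so that
  \<open>E N = (\<Sum>k. 2 P (B t \<ge> x + (2 k + 1) \<epsilon>))\<close>. The reflections are carried out for the random walk of
  the increments on a dyadic grid, where an overshoot costs at most the largest increment, and are
  transferred to the path by continuity. Scaling then gives
  \<open>\<zeta>\<^sub>B p = (1 - 2 powr (- p)) * \<zeta> p * 2 E ((B t - x)\<^sub>+ powr p)\<close>, and the truncated moment is evaluated by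
  expanding \<open>exp (- x y / t)\<close> and applying Kummer's transformation.
\<close>

text \<open>The last hit is reflected first because the flip is made when the hits before it have
  just been completed: nothing up to that time changes, and the return to the other level becomes a
  further excursion, so that two levels merge into one. In the upper estimate an overshoot only
  helps. In the lower one the reflection doubles it, so every reflection costs
  \<open>2 * \<delta>\<close> on walks with steps of size at most \<delta>. The mesh therefore
  shrinks at fixed \<delta>, which makes large steps improbable, and only then does \<delta> tend to
  0. Positivity of \<open>x\<close> places the start strictly below the first level, so that even
  the first hit has a step before it. The hits of the whole path are never shown to be measurable:
  almost surely they are enclosed between two grid events of equal probability. The integral exists
  only for \<open>Re p > 1\<close>, since otherwise the series over the odd numbers diverges and its
  cofactor is not 0. As \<open>riemann_zeta\<close> is a definite description, its continuation has
  to be constructed before anything is known about it.\<close>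

subsection \<open>Bars and alternating hits\<close>

text \<open>
  The hits of even index \<open>m\<close> are upward, to at least \<open>c m\<close>; those of odd index are downward.
\<close>

fun alternating_hits ::
  "'t::linorder set \<Rightarrow> (nat \<Rightarrow> real) \<Rightarrow> ('t \<Rightarrow> real) \<Rightarrow> nat \<Rightarrow> 't \<Rightarrow> bool" where
  "alternating_hits I c w 0 k \<longleftrightarrow> True"
| "alternating_hits I c w (Suc m) k \<longleftrightarrow>
     (\<exists>i\<in>I. i \<le> k \<and> alternating_hits I c w m i \<and> (-1) ^ m * (w i - c m) \<ge> 0)"

definition bar_levels :: "real \<Rightarrow> real \<Rightarrow> nat \<Rightarrow> real" where
  "bar_levels x \<epsilon> m = (if even m then x + \<epsilon> else x)"

lemma alternating_hits_mono_time:
  "alternating_hits I c w m i \<Longrightarrow> i \<le> j \<Longrightarrow> alternating_hits I c w m j"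
  by (cases m) (auto intro: order_trans)

lemma alternating_hits_mono_set:
  "alternating_hits I c w m i \<Longrightarrow> I \<subseteq> J \<Longrightarrow> alternating_hits J c w m i"
  by (induction m arbitrary: i) auto

lemma alternating_hits_cong:
  assumes "\<And>j. j \<in> I \<Longrightarrow> j \<le> i \<Longrightarrow> w j = w' j" "\<And>l. l < m \<Longrightarrow> c l = c' l"
  shows "alternating_hits I c w m i \<longleftrightarrow> alternating_hits I c' w' m i"
  using assms
proof (induction m arbitrary: i)
  case (Suc m)
  have "alternating_hits I c w m j = alternating_hits I c' w' m j" if "j \<in> I" "j \<le> i" for j
    using that Suc.prems by (intro Suc.IH) auto
  then show ?case using Suc.prems by (auto intro!: bex_cong)
qed simp

definition bars :: "(real \<Rightarrow> real) \<Rightarrow> real \<Rightarrow> real \<Rightarrow> real \<Rightarrow> real set set" where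
  "bars f T x \<epsilon> = {C \<in> components {u \<in> {0..T}. f u > x}. \<exists>u\<in>C. f u \<ge> x + \<epsilon>}"

lemma num_bars_eq: "num_bars f T x \<epsilon> = emeasure (count_space UNIV) (bars f T x \<epsilon>)"
  by (simp add: num_bars_def bars_def)

lemma component_ivl:
  fixes C :: "real set"
  assumes "C \<in> components S" "p \<in> C" "q \<in> C" "p \<le> r" "r \<le> q"
  shows "r \<in> C"
proof -
  have "connected C" using assms(1) in_components_connected by blast
  then show ?thesis using assms(2-5) connectedD_interval by blast
qed

lemma mem_componentE:
  assumes "u \<in> S"
  obtains C where "C \<in> components S" "u \<in> C"
  using assms Union_components[of S] by blast

text \<open>The clause that every bar of \<open>F\<close> has a point no later than \<open>u\<close>
  carries the induction. The new bar contains a point \<open>i\<close> that follows the downward hit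
  \<open>j\<close>, while each bar of \<open>F\<close> has a point up to \<open>j\<close>. If the
  new bar were one of them, it would contain \<open>j\<close>, where \<open>f\<close> is at most
  \<open>x\<close>.\<close>

lemma bars_if_alternating_hits:
  assumes "\<epsilon> > 0" "alternating_hits {0..T} (bar_levels x \<epsilon>) f (2 * k + 1) u"
  shows "\<exists>F\<subseteq>bars f T x \<epsilon>. finite F \<and> card F = Suc k \<and> (\<forall>C\<in>F. \<exists>p\<in>C. p \<le> u)"
  using assms(2)
proof (induction k arbitrary: u)
  case 0
  then obtain i where i: "i \<in> {0..T}" "i \<le> u" "f i \<ge> x + \<epsilon>"
    by (auto simp: bar_levels_def)
  then have "i \<in> {u \<in> {0..T}. f u > x}" using assms(1) by auto
  then obtain C where "C \<in> components {u \<in> {0..T}. f u > x}" "i \<in> C"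
    by (rule mem_componentE)
  then show ?case using i by (intro exI[of _ "{C}"]) (auto simp: bars_def)
next
  case (Suc k)
  have "2 * Suc k + 1 = Suc (Suc (2 * k + 1))" by simp
  with Suc.prems have "alternating_hits {0..T} (bar_levels x \<epsilon>) f (Suc (Suc (2 * k + 1))) u"
    by (simp only:)
  then obtain i j where i: "i \<in> {0..T}" "i \<le> u" "f i \<ge> x + \<epsilon>"
    and j: "j \<in> {0..T}" "j \<le> i" "f j \<le> x"
    and h: "alternating_hits {0..T} (bar_levels x \<epsilon>) f (2 * k + 1) j"
    unfolding alternating_hits.simps(2)[of _ _ _ "Suc (2*k+1)"]
      alternating_hits.simps(2)[of _ _ _ "2*k+1"]
    by (auto simp: bar_levels_def simp del: alternating_hits.simps)
  from Suc.IH[OF h] obtain F where F: "F \<subseteq> bars f T x \<epsilon>" "finite F" "card F = Suc k"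
    "\<forall>C\<in>F. \<exists>p\<in>C. p \<le> j" by blast
  have "i \<in> {u \<in> {0..T}. f u > x}" using assms(1) i by auto
  then obtain C where C: "C \<in> components {u \<in> {0..T}. f u > x}" "i \<in> C"
    by (rule mem_componentE)
  have "C \<notin> F"
  proof
    assume "C \<in> F"
    then obtain p where "p \<in> C" "p \<le> j" using F(4) by blast
    then have "j \<in> C" using component_ivl[OF C(1)] C(2) j by blast
    then have "f j > x" using C(1) in_components_subset by blast
    then show False using j by simp
  qed
  moreover have "\<exists>p\<in>D. p \<le> u" if "D \<in> F" for D
    using F(4) that i j by (meson order_trans)
  ultimately show ?case using F(1-3) C i
    by (intro exI[of _ "insert C F"]) (auto simp: bars_def)
qed

text \<open>Induction removes the latest point: the separating point between the two latest ones
  supplies the downward hit, and the latest point the final upward hit.\<close>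

lemma alternating_hits_if_separated:
  assumes "finite P" "card P = Suc k" "P \<subseteq> {u \<in> {0..T}. f u \<ge> x + \<epsilon>}"
    and "\<And>p q. p \<in> P \<Longrightarrow> q \<in> P \<Longrightarrow> p < q \<Longrightarrow> \<exists>r. p \<le> r \<and> r \<le> q \<and> f r \<le> x"
  shows "alternating_hits {0..T} (bar_levels x \<epsilon>) f (2 * k + 1) (Max P)"
  using assms
proof (induction k arbitrary: P)
  case 0
  then have "Max P \<in> P" by (intro Max_in) auto
  with 0 show ?case by (auto simp: bar_levels_def intro!: bexI[of _ "Max P"])
next
  case (Suc k)
  have M: "Max P \<in> P" using Suc.prems by (intro Max_in) auto
  let ?Q = "P - {Max P}"
  have Q: "finite ?Q" "card ?Q = Suc k" using Suc.prems M by auto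
  have IH: "alternating_hits {0..T} (bar_levels x \<epsilon>) f (2 * k + 1) (Max ?Q)"
    using Suc.prems by (intro Suc.IH Q) auto
  have "?Q \<noteq> {}" using Q(2) by (metis card.empty nat.distinct(1))
  then have MQ: "Max ?Q \<in> ?Q" using Max_in[OF Q(1)] by blast
  then have "Max ?Q < Max P" using Suc.prems(1) by (metis DiffE Max_ge insertI1 order_less_le)
  then obtain r where r: "Max ?Q \<le> r" "r \<le> Max P" "f r \<le> x"
    using Suc.prems(4)[of "Max ?Q" "Max P"] M MQ by auto
  have rT: "r \<in> {0..T}" using r M MQ Suc.prems(3) by fastforce
  have "alternating_hits {0..T} (bar_levels x \<epsilon>) f (2 * k + 1) r"
    using IH r(1) by (rule alternating_hits_mono_time)
  then have "alternating_hits {0..T} (bar_levels x \<epsilon>) f (Suc (2 * k + 1)) r"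
    unfolding alternating_hits.simps(2)[of _ _ _ "2*k+1"]
    using r rT by (intro bexI[of _ r]) (auto simp: bar_levels_def simp del: alternating_hits.simps)
  then have "alternating_hits {0..T} (bar_levels x \<epsilon>) f (Suc (Suc (2 * k + 1))) (Max P)"
    unfolding alternating_hits.simps(2)[of _ _ _ "Suc (2*k+1)"]
    using r M Suc.prems(3) by (intro bexI[of _ "Max P"])
       (auto simp: bar_levels_def dest: alternating_hits_mono_time simp del: alternating_hits.simps)
  then show ?case by (simp del: alternating_hits.simps)
qed

lemma alternating_hits_iff_bars:
  assumes "\<epsilon> > 0"
  shows "alternating_hits {0..T} (bar_levels x \<epsilon>) f (2 * k + 1) T \<longleftrightarrow>
    (\<exists>F\<subseteq>bars f T x \<epsilon>. finite F \<and> card F = Suc k)"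
proof
  assume "\<exists>F\<subseteq>bars f T x \<epsilon>. finite F \<and> card F = Suc k"
  then obtain F where F: "F \<subseteq> bars f T x \<epsilon>" "finite F" "card F = Suc k" by blast
  then have "\<forall>C\<in>F. \<exists>u. u \<in> C \<and> f u \<ge> x + \<epsilon>" by (auto simp: bars_def)
  then obtain p where p: "\<And>C. C \<in> F \<Longrightarrow> p C \<in> C" "\<And>C. C \<in> F \<Longrightarrow> f (p C) \<ge> x + \<epsilon>" by metis
  have comp: "C \<in> components {u \<in> {0..T}. f u > x}" if "C \<in> F" for C
    using that F(1) by (auto simp: bars_def)
  have pS: "p C \<in> {u \<in> {0..T}. f u > x}" if "C \<in> F" for C
    using p(1)[OF that] comp[OF that] in_components_subset by blast
  have eq: "C = D" if "C \<in> F" "D \<in> F" "p C \<in> D" for C D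
    using that p(1) comp components_nonoverlap by blast
  have "inj_on p F" using eq p(1) by (metis inj_onI)
  then have card: "card (p ` F) = Suc k" using F by (simp add: card_image)
  \<comment> \<open>Without a point at or below \<open>x\<close> between them, the whole interval
    would lie above \<open>x\<close> and join two distinct components.\<close>
  have sep: "\<exists>r. a \<le> r \<and> r \<le> b \<and> f r \<le> x" if ab: "a \<in> p ` F" "b \<in> p ` F" "a < b" for a b
  proof (rule ccontr)
    assume "\<nexists>r. a \<le> r \<and> r \<le> b \<and> f r \<le> x"
    then have *: "f r > x" if "a \<le> r" "r \<le> b" for r using that by force
    obtain C D where CD: "C \<in> F" "D \<in> F" "a = p C" "b = p D" using ab by blast
    have "{a..b} \<subseteq> {u \<in> {0..T}. f u > x}" using pS[OF CD(1)] pS[OF CD(2)] CD * by auto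
    moreover have "p C \<in> C \<inter> {a..b}" using CD p(1)[OF CD(1)] ab(3) by simp
    then have "C \<inter> {a..b} \<noteq> {}" by blast
    ultimately have "{a..b} \<subseteq> C"
      using components_maximal[OF comp[OF CD(1)], of "{a..b}"] by auto
    then have "p D \<in> C" using CD ab by auto
    then have "C = D" using eq CD by blast
    then show False using CD ab by simp
  qed
  have "alternating_hits {0..T} (bar_levels x \<epsilon>) f (2 * k + 1) (Max (p ` F))"
    using F pS p sep by (intro alternating_hits_if_separated card) auto
  moreover have "Max (p ` F) \<in> p ` F" using F card by (intro Max_in) auto
  then have "Max (p ` F) \<le> T" using pS by auto
  ultimately show "alternating_hits {0..T} (bar_levels x \<epsilon>) f (2 * k + 1) T"
    by (rule alternating_hits_mono_time)
next
  assume "alternating_hits {0..T} (bar_levels x \<epsilon>) f (2 * k + 1) T"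
  from bars_if_alternating_hits[OF assms this]
  show "\<exists>F\<subseteq>bars f T x \<epsilon>. finite F \<and> card F = Suc k" by blast
qed

text \<open>A cardinality is the sum over \<open>k\<close> of the truth values of "more than
  \<open>k\<close> elements", infinity included. This turns the expected number of bars into a sum
  of probabilities.\<close>

lemma emeasure_count_space_eq_suminf:
  "emeasure (count_space UNIV) A =
    (\<Sum>k. of_bool (\<exists>F\<subseteq>A. finite F \<and> card F = Suc k) :: ennreal)"
proof (cases "finite A")
  case True
  have "(\<exists>F\<subseteq>A. finite F \<and> card F = Suc k) \<longleftrightarrow> k < card A" for k
  proof
    assume "k < card A"
    then show "\<exists>F\<subseteq>A. finite F \<and> card F = Suc k"
      using obtain_subset_with_card_n[of "Suc k" A] True by (metis Suc_leI)
  qed (metis True card_mono Suc_le_lessD)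
  then have "(\<Sum>k. of_bool (\<exists>F\<subseteq>A. finite F \<and> card F = Suc k) :: ennreal) =
      (\<Sum>k. of_bool (k < card A))" by simp
  also have "\<dots> = (\<Sum>k<card A. of_bool (k < card A))"
    by (intro suminf_finite) auto
  finally show ?thesis using True by simp
next
  case False
  then have "\<exists>F\<subseteq>A. finite F \<and> card F = Suc k" for k
    using infinite_arbitrarily_large by blast
  then have "(\<Sum>k. of_bool (\<exists>F\<subseteq>A. finite F \<and> card F = Suc k) :: ennreal) = (\<Sum>k. 1)"
    by (simp only: of_bool_eq)
  also have "\<dots> = top"
    unfolding suminf_eq_SUP using ennreal_SUP_of_nat_eq_top by simp
  finally show ?thesis using False by simp
qed

lemma num_bars_eq_suminf:
  assumes "\<epsilon> > 0"
  shows "num_bars f T x \<epsilon> =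
    (\<Sum>k. of_bool (alternating_hits {0..T} (bar_levels x \<epsilon>) f (2 * k + 1) T))"
  unfolding num_bars_eq alternating_hits_iff_bars[OF assms] by (rule emeasure_count_space_eq_suminf)

text \<open>From here on the recursion is unfolded by hand, one hit at a time, so that automation
  does not expand counts such as \<open>Suc (Suc m)\<close> completely.\<close>

lemmas alternating_hits_Suc = alternating_hits.simps(2)
declare alternating_hits_Suc [simp del]

subsection \<open>Reflection of symmetric random walks\<close>

definition walk :: "(nat \<Rightarrow> real) \<Rightarrow> nat \<Rightarrow> real" where
  "walk v k = (\<Sum>j<k. v j)"

text \<open>The restriction keeps the result extensional, that is, in the space of the product
  measure on \<open>n\<close> coordinates.\<close>

definition flip :: "nat \<Rightarrow> nat \<Rightarrow> (nat \<Rightarrow> real) \<Rightarrow> nat \<Rightarrow> real" where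
  "flip n k v = (\<lambda>j\<in>{..<n}. if j < k then v j else - v j)"

lemma walk_0 [simp]: "walk v 0 = 0" and walk_Suc: "walk v (Suc k) = walk v k + v k"
  by (simp_all add: walk_def)

lemma walk_flip_before: "j \<le> k \<Longrightarrow> k \<le> n \<Longrightarrow> walk (flip n k v) j = walk v j"
  by (auto simp: walk_def flip_def intro!: sum.cong)

lemma walk_flip_after: "k \<le> j \<Longrightarrow> j \<le> n \<Longrightarrow> walk (flip n k v) j = 2 * walk v k - walk v j"
proof (induction j rule: dec_induct)
  case base
  then show ?case by (simp add: walk_flip_before)
next
  case (step j)
  then show ?case by (simp add: walk_Suc) (simp add: flip_def)
qed

abbreviation walk_hits :: "(nat \<Rightarrow> real) \<Rightarrow> (nat \<Rightarrow> real) \<Rightarrow> nat \<Rightarrow> nat \<Rightarrow> bool" where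
  "walk_hits c v \<equiv> alternating_hits UNIV c (walk v)"

lemma walk_hits_flip:
  assumes "i \<le> k" "k \<le> n"
  shows "walk_hits c (flip n k v) m i \<longleftrightarrow> walk_hits c v m i"
  by (rule alternating_hits_cong) (use assms in \<open>auto simp: walk_flip_before\<close>)

text \<open>The time argument of \<open>walk_hits\<close> only bounds the time of the last hit;
  minimality of \<open>k\<close> forces that hit to take place at \<open>k\<close> itself.\<close>

lemma first_hit:
  assumes "walk_hits c v (Suc m) k" "\<And>j. j < k \<Longrightarrow> \<not> walk_hits c v (Suc m) j"
  shows "walk_hits c v m k" "(-1) ^ m * (walk v k - c m) \<ge> 0"
proof -
  from assms(1) obtain i where i: "i \<le> k" "walk_hits c v m i" "(-1) ^ m * (walk v i - c m) \<ge> 0"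
    unfolding alternating_hits_Suc by blast
  then have "walk_hits c v (Suc m) i" by (auto simp: alternating_hits_Suc)
  then have "i = k" using assms(2)[of i] i(1) by linarith
  then show "walk_hits c v m k" "(-1) ^ m * (walk v k - c m) \<ge> 0" using i by auto
qed

text \<open>One step before \<open>k\<close> the first \<open>m\<close> hits are already complete:
  by \<open>sep\<close> one position cannot serve both of the last two hits, and for
  \<open>m = 0\<close> the start is below \<open>c 0\<close>. By minimality of \<open>k\<close> the
  walk is then still on the near side of \<open>c m\<close>, so it overshoots by no more than one
  step.\<close>

lemma first_hit_overshoot:
  assumes hit: "walk_hits c v (Suc m) k" "\<And>j. j < k \<Longrightarrow> \<not> walk_hits c v (Suc m) j"
    and c0: "c 0 > 0" and sep: "\<And>j. j < m \<Longrightarrow> (-1) ^ Suc j * (c (Suc j) - c j) > 0"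
    and small: "\<And>j. j < k \<Longrightarrow> \<bar>v j\<bar> \<le> \<delta>"
  shows "(-1) ^ m * (walk v k - c m) \<le> \<delta>"
proof -
  note first = first_hit[OF hit]
  have ks: "k > 0 \<and> walk_hits c v m (k - 1)"
  proof (cases m)
    case 0
    then show ?thesis using first(2) c0 by (cases k) auto
  next
    case (Suc m')
    from first(1)[unfolded Suc] obtain i where i: "i \<le> k" "walk_hits c v m' i"
      "(-1) ^ m' * (walk v i - c m') \<ge> 0"
      unfolding alternating_hits_Suc by blast
    have "i \<noteq> k"
    proof
      assume "i = k"
      then have "(-1) ^ m' * (walk v k - c m') \<ge> 0" "(-1) ^ m' * (walk v k - c m) \<le> 0"
        "(-1) ^ m' * (c m - c m') < 0"
        using i first(2) sep[of m'] Suc by auto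
      then show False by (simp add: algebra_simps)
    qed
    then have "i < k" using i by simp
    then have "k > 0" "i \<le> k - 1" by auto
    then show ?thesis unfolding Suc using i by (auto simp: alternating_hits_Suc)
  qed
  then obtain l where l: "k = Suc l" "walk_hits c v m l" by (cases k) auto
  have "\<not> walk_hits c v (Suc m) l" using hit(2) l by simp
  then have "(-1) ^ m * (walk v l - c m) < 0"
    using l(2) by (force simp: alternating_hits_Suc)
  moreover have "(-1) ^ m * v l \<le> \<delta>"
    using small[of l] l by (cases "even m") auto
  ultimately show ?thesis unfolding l(1) walk_Suc by (simp add: algebra_simps)
qed

text \<open>Invariance under changing the signs of all steps from \<open>k\<close> on is everything
  that the reflection arguments use; independence and the Gaussian law enter only when the locale is
  interpreted.\<close>

locale symmetric_walk = prob_space D for D :: "(nat \<Rightarrow> real) measure" and n :: nat +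
  assumes sets_D: "sets D = sets (PiM {..<n} (\<lambda>_. borel))"
    and flip_invariant: "k \<le> n \<Longrightarrow> A \<in> sets D \<Longrightarrow> prob (flip n k -` A \<inter> space D) = prob A"
begin

lemma space_D: "space D = space (PiM {..<n} (\<lambda>_. borel))"
  using sets_D by (rule sets_eq_imp_space_eq)

lemma flip_measurable [measurable]: "flip n k \<in> measurable D D"
proof -
  have "flip n k \<in> measurable (PiM {..<n} (\<lambda>_. borel)) (PiM {..<n} (\<lambda>_. borel))"
    unfolding flip_def by (intro measurable_restrict) measurable
  then show ?thesis by (simp add: measurable_def space_D sets_D)
qed

lemma coordinate_measurable [measurable]: "j < n \<Longrightarrow> (\<lambda>v. v j) \<in> borel_measurable D"
  using measurable_component_singleton[of j "{..<n}" "\<lambda>_. borel :: real measure"]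
  by (simp add: measurable_def space_D sets_D)

lemma walk_measurable [measurable]: "k \<le> n \<Longrightarrow> (\<lambda>v. walk v k) \<in> borel_measurable D"
  unfolding walk_def by (intro borel_measurable_sum coordinate_measurable) auto

lemma walk_hits_measurable:
  "k \<le> n \<Longrightarrow> Measurable.pred D (\<lambda>v. walk_hits c v m k)"
proof (induction m arbitrary: k)
  case (Suc m)
  have "(\<lambda>v. walk_hits c v (Suc m) k) =
      (\<lambda>v. \<exists>i\<in>{..k}. walk_hits c v m i \<and> (-1) ^ m * (walk v i - c m) \<ge> 0)"
    by (intro ext) (auto simp: alternating_hits_Suc)
  moreover have "Measurable.pred D (\<lambda>v. \<exists>i\<in>{..k}. walk_hits c v m i \<and> (-1) ^ m * (walk v i - c m) \<ge> 0)"
  proof (rule pred_intros_finite)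
    fix i assume "i \<in> {..k}"
    then have [measurable]: "Measurable.pred D (\<lambda>v. walk_hits c v m i)"
      "(\<lambda>v. walk v i) \<in> borel_measurable D"
      using Suc by (auto intro: walk_measurable)
    show "Measurable.pred D (\<lambda>v. walk_hits c v m i \<and> (-1) ^ m * (walk v i - c m) \<ge> 0)"
      by measurable
  qed simp
  ultimately show ?case by simp
qed simp

text \<open>\<open>S\<close> is a stopping rule; the reflection starts at the first time at which it holds.\<close>

lemma reflection_le:
  assumes S: "\<And>k. k \<le> n \<Longrightarrow> Measurable.pred D (S k)"
    and adapted: "\<And>i k v. i \<le> k \<Longrightarrow> k \<le> n \<Longrightarrow> S i (flip n k v) \<longleftrightarrow> S i v"
    and A: "Measurable.pred D P" and A': "Measurable.pred D P'"
    and PS: "\<And>v. v \<in> space D \<Longrightarrow> P v \<Longrightarrow> \<exists>k\<le>n. S k v"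
    and step: "\<And>k v. k \<le> n \<Longrightarrow> P v \<Longrightarrow> S k v \<Longrightarrow> (\<And>j. j < k \<Longrightarrow> \<not> S j v) \<Longrightarrow> P' (flip n k v)"
  shows "\<P>(v in D. P v) \<le> \<P>(v in D. P' v)"
proof -
  \<comment> \<open>\<open>T k\<close> collects the sequences for which the rule first holds at
    \<open>k\<close>. On each of these disjoint cells the random reflection is one fixed
    flip.\<close>
  define T where "T k = {v \<in> space D. S k v \<and> (\<forall>j<k. \<not> S j v)}" for k
  have T: "T k \<in> sets D" if "k \<le> n" for k
  proof -
    have "Measurable.pred D (\<lambda>v. \<forall>j\<in>{..<k}. \<not> S j v)"
    proof (rule pred_intros_finite)
      fix j assume "j \<in> {..<k}"
      then have "Measurable.pred D (S j)" using S that by simp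
      then show "Measurable.pred D (\<lambda>v. \<not> S j v)" by (rule pred_intros_logic)
    qed simp
    then have "Measurable.pred D (\<lambda>v. S k v \<and> (\<forall>j\<in>{..<k}. \<not> S j v))"
      using S[OF that] by (intro pred_intros_logic)
    then show ?thesis unfolding T_def pred_def by (simp only: lessThan_iff Ball_def)
  qed
  have disj: "disjoint_family_on T {..n}"
    unfolding disjoint_family_on_def
  proof (intro ballI impI)
    fix i j :: nat assume "i \<noteq> j"
    then consider "i < j" | "j < i" by linarith
    then show "T i \<inter> T j = {}" by cases (auto simp: T_def)
  qed
  define A where "A = {v \<in> space D. P v}"
  define A' where "A' = {v \<in> space D. P' v}"
  have sets: "A \<in> sets D" "A' \<in> sets D" unfolding A_def A'_def using A A' by simp_all
  have "A = (\<Union>k\<in>{..n}. A \<inter> T k)"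
  proof (intro equalityI subsetI)
    fix v assume v: "v \<in> A"
    then have "v \<in> space D" "P v" by (simp_all add: A_def)
    from PS[OF this] obtain k where k: "k \<le> n" "S k v" by blast
    define l where "l = (LEAST k. S k v)"
    have "S l v" "l \<le> k" unfolding l_def using k(2) by (auto intro: LeastI Least_le)
    moreover have "\<not> S j v" if "j < l" for j using that not_less_Least unfolding l_def by blast
    ultimately have "v \<in> T l" "l \<le> n" using v k by (auto simp: T_def A_def)
    then show "v \<in> (\<Union>k\<in>{..n}. A \<inter> T k)" using v by blast
  qed auto
  then have "prob A = prob (\<Union>k\<in>{..n}. A \<inter> T k)" by (rule arg_cong)
  also have "\<dots> = (\<Sum>k\<in>{..n}. prob (A \<inter> T k))"
    by (rule finite_measure_finite_Union) (use sets T disj in \<open>simp_all add: image_subset_iff disjoint_family_on_def, blast\<close>)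
  also have "\<dots> \<le> (\<Sum>k\<in>{..n}. prob (A' \<inter> T k))"
  proof (rule sum_mono)
    fix k assume "k \<in> {..n}"
    then have k: "k \<le> n" by simp
    \<comment> \<open>By \<open>adapted\<close>, the flip at \<open>k\<close> does not affect the
      rule up to time \<open>k\<close>, so it maps the cell \<open>T k\<close> into itself.\<close>
    have "A \<inter> T k \<subseteq> flip n k -` (A' \<inter> T k) \<inter> space D"
    proof
      fix v assume v: "v \<in> A \<inter> T k"
      then have "flip n k v \<in> space D"
        using measurable_space[OF flip_measurable] by (auto simp: A_def)
      moreover have "P v" "S k v" and first: "\<And>j. j < k \<Longrightarrow> \<not> S j v"
        using v by (simp_all add: A_def T_def)
      then have "P' (flip n k v)" by (rule step[OF k])
      moreover have "S k (flip n k v)" using adapted[of k k v] k \<open>S k v\<close> by simp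
      moreover have "\<not> S j (flip n k v)" if "j < k" for j
        using adapted[of j k v] k first[OF that] that by simp
      ultimately show "v \<in> flip n k -` (A' \<inter> T k) \<inter> space D"
        using v by (auto simp: A'_def T_def)
    qed
    moreover have "flip n k -` (A' \<inter> T k) \<inter> space D \<in> sets D"
      using sets T[OF k] by (intro measurable_sets[OF flip_measurable]) auto
    ultimately have "prob (A \<inter> T k) \<le> prob (flip n k -` (A' \<inter> T k) \<inter> space D)"
      by (intro finite_measure_mono)
    also have "\<dots> = prob (A' \<inter> T k)" using sets T k by (intro flip_invariant) auto
    finally show "prob (A \<inter> T k) \<le> prob (A' \<inter> T k)" .
  qed
  also have "\<dots> = prob (\<Union>k\<in>{..n}. A' \<inter> T k)"
    by (rule finite_measure_finite_Union[symmetric]) (use sets T disj in \<open>simp_all add: image_subset_iff disjoint_family_on_def, blast\<close>)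
  also have "\<dots> \<le> prob A'" using sets by (intro finite_measure_mono) auto
  finally show ?thesis by (simp add: A_def A'_def)
qed

text \<open>The flip takes place at the first completion of the hits up to \<open>c m\<close>. There
  the walk is at or beyond \<open>c m\<close>, so the mirror image of a later position that has come
  back to \<open>y\<close> is at or beyond \<open>2 * c m - y\<close>. Hitting this level replaces
  the last two hits.\<close>

lemma reflect_last_level_le:
  assumes y: "(-1) ^ m * (c m - y) \<ge> 0"
  shows "\<P>(v in D. walk_hits (c(Suc m := y)) v (Suc (Suc m)) n) \<le>
    \<P>(v in D. walk_hits (c(m := 2 * c m - y)) v (Suc m) n)"
proof (rule reflection_le[where S = "\<lambda>k v. walk_hits c v (Suc m) k"])
  have c1: "walk_hits (c(Suc m := y)) v (Suc m) i = walk_hits c v (Suc m) i" for v i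
    by (rule alternating_hits_cong) auto
  have c2: "walk_hits (c(m := z)) v m i = walk_hits c v m i" for v i z
    by (rule alternating_hits_cong) auto
  have E: "\<exists>i\<le>n. walk_hits c v (Suc m) i \<and> (-1) ^ m * (walk v i - y) \<le> 0"
    if "walk_hits (c(Suc m := y)) v (Suc (Suc m)) n" for v
    using that unfolding alternating_hits_Suc[of _ _ _ "Suc m"] c1 by auto
  show "\<exists>k\<le>n. walk_hits c v (Suc m) k" if "walk_hits (c(Suc m := y)) v (Suc (Suc m)) n" for v
    using E[OF that] by blast
  show "walk_hits (c(m := 2 * c m - y)) (flip n k v) (Suc m) n"
    if k: "k \<le> n" and P: "walk_hits (c(Suc m := y)) v (Suc (Suc m)) n"
      and hit: "walk_hits c v (Suc m) k" "\<And>j. j < k \<Longrightarrow> \<not> walk_hits c v (Suc m) j" for k v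
  proof -
    obtain i where i: "i \<le> n" "walk_hits c v (Suc m) i" "(-1) ^ m * (walk v i - y) \<le> 0"
      using E[OF P] by blast
    have ki: "k \<le> i" using hit(2) i(2) not_le by blast
    note f = first_hit[OF hit]
    have "walk_hits c (flip n k v) m k" using f(1) k by (simp only: walk_hits_flip)
    then have "walk_hits c (flip n k v) m i" using ki by (rule alternating_hits_mono_time)
    moreover have "(-1) ^ m * (walk (flip n k v) i - (2 * c m - y)) \<ge> 0"
      using f(2) i(3) unfolding walk_flip_after[OF ki i(1)] by (simp add: algebra_simps)
    ultimately show ?thesis using i(1)
      unfolding alternating_hits_Suc c2 by auto
  qed
qed (simp_all add: walk_hits_measurable walk_hits_flip)

text \<open>The event on which overshoots are controlled. It is invariant under flips and therefore
  survives every reflection.\<close>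

definition small_steps :: "real \<Rightarrow> (nat \<Rightarrow> real) \<Rightarrow> bool" where
  "small_steps \<delta> v \<longleftrightarrow> (\<forall>j<n. \<bar>v j\<bar> \<le> \<delta>)"

lemma small_steps_measurable [measurable]: "Measurable.pred D (small_steps \<delta>)"
proof -
  have "Measurable.pred D (\<lambda>v. \<forall>j\<in>{..<n}. \<bar>v j\<bar> \<le> \<delta>)"
  proof (rule pred_intros_finite)
    fix j assume "j \<in> {..<n}"
    then have [measurable]: "(\<lambda>v. v j) \<in> borel_measurable D" by simp
    show "Measurable.pred D (\<lambda>v. \<bar>v j\<bar> \<le> \<delta>)" by measurable
  qed simp
  then show ?thesis by (simp add: small_steps_def[abs_def] lessThan_def)
qed

lemma small_steps_flip: "small_steps \<delta> (flip n k v) \<longleftrightarrow> small_steps \<delta> v"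
  by (auto simp: small_steps_def flip_def)

text \<open>A walk that reaches the level on the left has hit \<open>c m\<close> by then, and the
  flip is made at the first such time. The mirror point exceeds \<open>c m\<close> by up to
  \<delta>, and the reflection doubles this error; the extra \<open>2 * \<delta>\<close> in the
  level compensates for it.\<close>

lemma reflect_last_level_ge:
  assumes y: "(-1) ^ m * (c m - y) \<ge> 0" and \<delta>: "\<delta> \<ge> 0"
    and c0: "c 0 > 0" and sep: "\<And>j. j < m \<Longrightarrow> (-1) ^ Suc j * (c (Suc j) - c j) > 0"
  shows "\<P>(v in D. walk_hits (c(m := 2 * c m - y + (-1) ^ m * (2 * \<delta>))) v (Suc m) n \<and> small_steps \<delta> v)
    \<le> \<P>(v in D. walk_hits (c(Suc m := y)) v (Suc (Suc m)) n \<and> small_steps \<delta> v)"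
proof (rule reflection_le[where S = "\<lambda>k v. walk_hits c v (Suc m) k"])
  define z where "z = 2 * c m - y + (-1) ^ m * (2 * \<delta>)"
  have zsg: "(-1) ^ m * (c m - z) \<le> 0" "(-1) ^ m * z = 2 * ((-1) ^ m * c m) - (-1) ^ m * y + 2 * \<delta>"
    using y \<delta> by (auto simp: z_def algebra_simps)
  have c1: "walk_hits (c(Suc m := y)) v (Suc m) i = walk_hits c v (Suc m) i" for v i
    by (rule alternating_hits_cong) auto
  have c2: "walk_hits (c(m := z)) v m i = walk_hits c v m i" for v i
    by (rule alternating_hits_cong) auto
  {
    fix v assume "walk_hits (c(m := z)) v (Suc m) n"
    then obtain i where i: "i \<le> n" "walk_hits c v m i" "(-1) ^ m * (walk v i - z) \<ge> 0"
      unfolding alternating_hits_Suc[of _ _ _ m] c2 by auto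
    then have "(-1) ^ m * (walk v i - c m) \<ge> 0" using zsg(1) by (simp add: algebra_simps)
    then have "walk_hits c v (Suc m) i" using i(2) by (auto simp: alternating_hits_Suc)
    then have "\<exists>i\<le>n. walk_hits c v (Suc m) i \<and> (-1) ^ m * (walk v i - z) \<ge> 0"
      using i by blast
  } note E = this
  show "\<exists>k\<le>n. walk_hits c v (Suc m) k" if "walk_hits (c(m := 2 * c m - y + (-1) ^ m * (2 * \<delta>))) v (Suc m) n \<and> small_steps \<delta> v" for v
    using E[of v] that unfolding z_def[symmetric] by blast
  show "walk_hits (c(Suc m := y)) (flip n k v) (Suc (Suc m)) n \<and> small_steps \<delta> (flip n k v)"
    if k: "k \<le> n" and P: "walk_hits (c(m := 2 * c m - y + (-1) ^ m * (2 * \<delta>))) v (Suc m) n \<and> small_steps \<delta> v"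
      and hit: "walk_hits c v (Suc m) k" "\<And>j. j < k \<Longrightarrow> \<not> walk_hits c v (Suc m) j" for k v
  proof -
    from P have P': "walk_hits (c(m := z)) v (Suc m) n" "small_steps \<delta> v"
      by (simp_all add: z_def)
    obtain i where i: "i \<le> n" "walk_hits c v (Suc m) i" "(-1) ^ m * (walk v i - z) \<ge> 0"
      using E[OF P'(1)] by blast
    have ki: "k \<le> i" using hit(2) i(2) not_le by blast
    have over: "(-1) ^ m * (walk v k - c m) \<le> \<delta>"
      by (rule first_hit_overshoot[OF hit c0 sep]) (use P'(2) k in \<open>auto simp: small_steps_def\<close>)
    have "walk_hits c (flip n k v) (Suc m) k" using hit(1) k by (simp only: walk_hits_flip)
    then have "walk_hits c (flip n k v) (Suc m) i" using ki by (rule alternating_hits_mono_time)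
    moreover have "(-1) ^ m * (walk (flip n k v) i - y) \<le> 0"
      using over i(3) zsg(2) unfolding walk_flip_after[OF ki i(1)] by (simp add: algebra_simps)
    ultimately show ?thesis using i(1) P'(2)
      unfolding alternating_hits_Suc[of _ _ _ "Suc m"] c1 small_steps_flip
      by (auto)
  qed
qed (simp_all add: walk_hits_measurable walk_hits_flip small_steps_measurable pred_intros_logic)


section \<open>Collapsing the alternating levels to a single level\<close>

lemma bar_levels_step: "(-1) ^ Suc j * (bar_levels x \<epsilon> (Suc j) - bar_levels x \<epsilon> j) = \<epsilon>"
  by (cases "even j") (simp_all add: bar_levels_def)

lemma bar_levels_0: "bar_levels x \<epsilon> 0 = x + \<epsilon>"
  by (simp add: bar_levels_def)

text \<open>\<open>r\<close> is the distance by which the last level has been pushed outwards.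
  Removing a level pushes the new last one outwards by \<open>r\<close> plus the width \<epsilon> of
  the band.\<close>

lemma reflect_all_levels_le:
  assumes "\<epsilon> > 0" "r \<ge> 0"
  shows "\<P>(v in D. walk_hits ((bar_levels x \<epsilon>)(m := bar_levels x \<epsilon> m + (-1) ^ m * r)) v (Suc m) n)
    \<le> \<P>(v in D. walk_hits ((bar_levels x \<epsilon>)(0 := x + \<epsilon> + r + m * \<epsilon>)) v 1 n)"
  using assms(2)
proof (induction m arbitrary: r)
  case 0
  then show ?case by (simp add: bar_levels_def)
next
  case (Suc m)
  let ?c = "bar_levels x \<epsilon>"
  let ?y = "?c (Suc m) + (-1) ^ Suc m * r"
  define y where "y = ?y"
  have y: "y = ?c m - (-1) ^ m * (\<epsilon> + r)"
    by (cases "even m") (simp_all add: y_def bar_levels_def)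
  have sgn: "(-1) ^ m * (?c m - y) = \<epsilon> + r"
    unfolding y by (cases "even m") simp_all
  have e1: "x + \<epsilon> + r + Suc m * \<epsilon> = x + \<epsilon> + (r + \<epsilon>) + m * \<epsilon>" by (simp add: algebra_simps)
  have e2: "2 * ?c m - ?y = ?c m + (-1) ^ m * (r + \<epsilon>)"
    unfolding y_def[symmetric] y by (simp add: algebra_simps)
  have "\<P>(v in D. walk_hits (?c(Suc m := ?y)) v (Suc (Suc m)) n)
      \<le> \<P>(v in D. walk_hits (?c(m := ?c m + (-1) ^ m * (r + \<epsilon>))) v (Suc m) n)"
    unfolding e2[symmetric] y_def[symmetric]
    by (rule reflect_last_level_le) (use assms Suc.prems sgn in linarith)
  also have "\<dots> \<le> \<P>(v in D. walk_hits (?c(0 := x + \<epsilon> + (r + \<epsilon>) + m * \<epsilon>)) v 1 n)"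
    using assms(1) Suc.prems by (intro Suc.IH) auto
  finally show ?case unfolding e1 .
qed

text \<open>The same bookkeeping for the opposite inequality, with \<open>2 * \<delta>\<close> paid
  for each reflection.\<close>

lemma reflect_all_levels_ge:
  assumes "\<epsilon> > 0" "x > 0" "\<delta> \<ge> 0" "r \<ge> 0"
  shows "\<P>(v in D. walk_hits ((bar_levels x \<epsilon>)(0 := x + \<epsilon> + r + m * (\<epsilon> + 2 * \<delta>))) v 1 n \<and> small_steps \<delta> v)
    \<le> \<P>(v in D. walk_hits ((bar_levels x \<epsilon>)(m := bar_levels x \<epsilon> m + (-1) ^ m * r)) v (Suc m) n \<and> small_steps \<delta> v)"
  using assms(4)
proof (induction m arbitrary: r)
  case 0
  then show ?case by (simp add: bar_levels_def)
next
  case (Suc m)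
  let ?c = "bar_levels x \<epsilon>"
  let ?y = "?c (Suc m) + (-1) ^ Suc m * r"
  define y where "y = ?y"
  have y: "y = ?c m - (-1) ^ m * (\<epsilon> + r)"
    by (cases "even m") (simp_all add: y_def bar_levels_def)
  have sgn: "(-1) ^ m * (?c m - y) = \<epsilon> + r"
    unfolding y by (cases "even m") simp_all
  have e1: "x + \<epsilon> + r + Suc m * (\<epsilon> + 2 * \<delta>) = x + \<epsilon> + (r + \<epsilon> + 2 * \<delta>) + m * (\<epsilon> + 2 * \<delta>)"
    by (simp add: algebra_simps)
  have e2: "2 * ?c m - ?y + (-1) ^ m * (2 * \<delta>) = ?c m + (-1) ^ m * (r + \<epsilon> + 2 * \<delta>)"
    unfolding y_def[symmetric] y by (cases "even m") simp_all
  have "\<P>(v in D. walk_hits (?c(0 := x + \<epsilon> + (r + \<epsilon> + 2 * \<delta>) + m * (\<epsilon> + 2 * \<delta>))) v 1 n \<and> small_steps \<delta> v)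
    \<le> \<P>(v in D. walk_hits (?c(m := ?c m + (-1) ^ m * (r + \<epsilon> + 2 * \<delta>))) v (Suc m) n \<and> small_steps \<delta> v)"
    using assms Suc.prems by (intro Suc.IH) auto
  also have "\<dots> \<le> \<P>(v in D. walk_hits (?c(Suc m := ?y)) v (Suc (Suc m)) n \<and> small_steps \<delta> v)"
    unfolding e2[symmetric] y_def[symmetric]
    by (rule reflect_last_level_ge, unfold bar_levels_step bar_levels_0) (use assms Suc.prems sgn in simp_all)
  finally show ?case unfolding e1 .
qed

section \<open>The maximum of a symmetric walk\<close>

lemma walk_hits_one_iff: "walk_hits c v 1 k \<longleftrightarrow> (\<exists>i\<le>k. walk v i \<ge> c 0)"
  by (simp add: alternating_hits_Suc)

text \<open>A walk that reaches \<open>c 0\<close> but ends below it is reflected, at its first time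
  at or above \<open>c 0\<close>, into one that ends at or above \<open>c 0\<close>. Together with
  the walks that end there anyway this gives the factor 2.\<close>

lemma maximum_le: "\<P>(v in D. walk_hits c v 1 n) \<le> 2 * \<P>(v in D. walk v n \<ge> c 0)"
proof -
  have [measurable]: "Measurable.pred D (\<lambda>v. walk_hits c v 1 n)" "(\<lambda>v. walk v n) \<in> borel_measurable D"
    by (auto intro: walk_hits_measurable)
  have m: "Measurable.pred D (\<lambda>v. walk_hits c v 1 n \<and> walk v n < c 0)"
    "Measurable.pred D (\<lambda>v. walk v n \<ge> c 0)" by measurable
  have "\<P>(v in D. walk_hits c v 1 n) \<le>
      \<P>(v in D. walk v n \<ge> c 0) + \<P>(v in D. walk_hits c v 1 n \<and> walk v n < c 0)"
  proof -
    have "{v \<in> space D. walk_hits c v 1 n} \<subseteq> {v \<in> space D. walk v n \<ge> c 0} \<union>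
        {v \<in> space D. walk_hits c v 1 n \<and> walk v n < c 0}" by (auto simp del: One_nat_def)
    then have "\<P>(v in D. walk_hits c v 1 n) \<le>
        prob ({v \<in> space D. walk v n \<ge> c 0} \<union> {v \<in> space D. walk_hits c v 1 n \<and> walk v n < c 0})"
      by (rule finite_measure_mono) measurable
    also have "\<dots> \<le> \<P>(v in D. walk v n \<ge> c 0) + \<P>(v in D. walk_hits c v 1 n \<and> walk v n < c 0)"
      by (rule measure_Un_le) measurable
    finally show ?thesis .
  qed
  also have "\<P>(v in D. walk_hits c v 1 n \<and> walk v n < c 0) \<le> \<P>(v in D. walk v n \<ge> c 0)"
  proof (rule reflection_le[where S = "\<lambda>k v. walk_hits c v 1 k"])
    fix k v assume k: "k \<le> n" and P: "walk_hits c v 1 n \<and> walk v n < c 0"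
      and hit: "walk_hits c v 1 k" "\<And>j. j < k \<Longrightarrow> \<not> walk_hits c v 1 j"
    have "walk v k \<ge> c 0" using first_hit[of c v 0 k] hit by simp
    then show "walk (flip n k v) n \<ge> c 0" using P walk_flip_after[of k n n v] k by simp
  next
    show "\<exists>k\<le>n. walk_hits c v 1 k" if "walk_hits c v 1 n \<and> walk v n < c 0" for v
      using that by blast
  qed (simp_all add: m walk_hits_measurable walk_hits_flip del: One_nat_def)
  finally show ?thesis by simp
qed

text \<open>Walks that end at or above \<open>c 0 + 2 * \<delta>\<close> count twice: as they are,
  and reflected at the first passage, whose overshoot of at most \<delta> makes the mirror image end
  at or below \<open>c 0\<close>. The two events are disjoint because \<delta> is positive.\<close>

lemma maximum_ge:
  assumes "c 0 > 0" "\<delta> > 0"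
  shows "2 * \<P>(v in D. walk v n \<ge> c 0 + 2 * \<delta> \<and> small_steps \<delta> v) \<le> \<P>(v in D. walk_hits c v 1 n \<and> small_steps \<delta> v)"
proof -
  have [measurable]: "Measurable.pred D (\<lambda>v. walk_hits c v 1 n)" "(\<lambda>v. walk v n) \<in> borel_measurable D"
    by (auto intro: walk_hits_measurable)
  have m: "Measurable.pred D (\<lambda>v. walk_hits c v 1 n \<and> walk v n \<le> c 0 \<and> small_steps \<delta> v)"
    "Measurable.pred D (\<lambda>v. walk v n \<ge> c 0 + 2 * \<delta> \<and> small_steps \<delta> v)" by measurable
  have "\<P>(v in D. walk v n \<ge> c 0 + 2 * \<delta> \<and> small_steps \<delta> v) \<le>
      \<P>(v in D. walk_hits c v 1 n \<and> walk v n \<le> c 0 \<and> small_steps \<delta> v)"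
  proof (rule reflection_le[where S = "\<lambda>k v. walk_hits c v 1 k"])
    fix k v assume k: "k \<le> n" and P: "walk v n \<ge> c 0 + 2 * \<delta> \<and> small_steps \<delta> v"
      and hit: "walk_hits c v 1 k" "\<And>j. j < k \<Longrightarrow> \<not> walk_hits c v 1 j"
    have "(-1) ^ 0 * (walk v k - c 0) \<le> \<delta>"
      by (rule first_hit_overshoot[of c v 0 k]) (use hit assms P k in \<open>auto simp: small_steps_def\<close>)
    then have "walk (flip n k v) n \<le> c 0" using P walk_flip_after[of k n n v] k by simp
    moreover have "walk_hits c (flip n k v) 1 k" using hit(1) k by (simp only: walk_hits_flip)
    then have "walk_hits c (flip n k v) 1 n" using k by (rule alternating_hits_mono_time)
    ultimately show "walk_hits c (flip n k v) 1 n \<and> walk (flip n k v) n \<le> c 0 \<and> small_steps \<delta> (flip n k v)"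
      using P by (simp add: small_steps_flip)
  next
    fix v assume "walk v n \<ge> c 0 + 2 * \<delta> \<and> small_steps \<delta> v"
    then have "walk v n \<ge> c 0" using assms by auto
    then show "\<exists>k\<le>n. walk_hits c v 1 k" unfolding walk_hits_one_iff by blast
  qed (simp_all add: m walk_hits_measurable walk_hits_flip del: One_nat_def)
  moreover have "\<P>(v in D. walk v n \<ge> c 0 + 2 * \<delta> \<and> small_steps \<delta> v) +
      \<P>(v in D. walk_hits c v 1 n \<and> walk v n \<le> c 0 \<and> small_steps \<delta> v)
      \<le> \<P>(v in D. walk_hits c v 1 n \<and> small_steps \<delta> v)"
  proof -
    let ?A = "{v \<in> space D. walk v n \<ge> c 0 + 2 * \<delta> \<and> small_steps \<delta> v}"
    let ?B = "{v \<in> space D. walk_hits c v 1 n \<and> walk v n \<le> c 0 \<and> small_steps \<delta> v}"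
    have "walk_hits c v 1 n" if "walk v n \<ge> c 0 + 2 * \<delta>" for v
      unfolding walk_hits_one_iff using that assms by (intro exI[of _ n]) auto
    then have sub: "?A \<union> ?B \<subseteq> {v \<in> space D. walk_hits c v 1 n \<and> small_steps \<delta> v}" by blast
    have disj: "?A \<inter> ?B = {}" using assms by fastforce
    have "prob ?A + prob ?B = prob (?A \<union> ?B)"
      by (rule finite_measure_Union[symmetric, OF _ _ disj]) measurable
    also have "\<dots> \<le> \<P>(v in D. walk_hits c v 1 n \<and> small_steps \<delta> v)"
      by (rule finite_measure_mono[OF sub]) measurable
    finally show ?thesis .
  qed
  ultimately show ?thesis by linarith
qed

theorem prob_walk_hits_le:
  fixes x \<epsilon> :: real
  assumes "\<epsilon> > 0"
  shows "\<P>(v in D. walk_hits (bar_levels x \<epsilon>) v (Suc m) n) \<le> 2 * \<P>(v in D. walk v n \<ge> x + real (Suc m) * \<epsilon>)"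
  using order_trans[OF reflect_all_levels_le[OF assms, of 0 x m] maximum_le] by (simp add: algebra_simps)

text \<open>The \<open>m\<close> reflections of levels and the reflection of the end point cost
  \<open>2 * \<delta>\<close> each, whence the common factor \<open>Suc m\<close>.\<close>

theorem prob_walk_hits_ge:
  fixes x \<epsilon> \<delta> :: real
  assumes "\<epsilon> > 0" "x > 0" "\<delta> > 0"
  shows "2 * \<P>(v in D. walk v n \<ge> x + real (Suc m) * (\<epsilon> + 2 * \<delta>) \<and> small_steps \<delta> v)
    \<le> \<P>(v in D. walk_hits (bar_levels x \<epsilon>) v (Suc m) n)"
proof -
  have [measurable]: "Measurable.pred D (\<lambda>v. walk_hits c v k n)" for c k
    by (auto intro: walk_hits_measurable)
  let ?c = "(bar_levels x \<epsilon>)(0 := x + \<epsilon> + 0 + m * (\<epsilon> + 2 * \<delta>))"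
  have c0: "?c 0 + 2 * \<delta> = x + real (Suc m) * (\<epsilon> + 2 * \<delta>)" by (simp add: algebra_simps)
  have "2 * \<P>(v in D. walk v n \<ge> ?c 0 + 2 * \<delta> \<and> small_steps \<delta> v) \<le> \<P>(v in D. walk_hits ?c v 1 n \<and> small_steps \<delta> v)"
    using assms by (intro maximum_ge) (simp_all add: add_pos_nonneg)
  also have "\<dots> \<le> \<P>(v in D. walk_hits ((bar_levels x \<epsilon>)(m := bar_levels x \<epsilon> m + (-1) ^ m * 0)) v (Suc m) n \<and> small_steps \<delta> v)"
    using assms by (intro reflect_all_levels_ge) auto
  also have "\<dots> \<le> \<P>(v in D. walk_hits (bar_levels x \<epsilon>) v (Suc m) n)"
    by (intro finite_measure_mono) auto
  finally show ?thesis unfolding c0 .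
qed

end

text \<open>Independence makes the joint law the product of the marginals, and changing the signs of
  coordinates changes no marginal.\<close>

lemma symmetric_walk_distr:
  fixes \<xi> :: "nat \<Rightarrow> 'a \<Rightarrow> real"
  assumes M: "prob_space M"
    and indep: "prob_space.indep_vars M (\<lambda>_. borel) \<xi> {..<n}"
    and sym: "\<And>j. j < n \<Longrightarrow> distr M borel (\<lambda>\<omega>. - \<xi> j \<omega>) = distr M borel (\<xi> j)"
  shows "symmetric_walk (distr M (PiM {..<n} (\<lambda>_. borel)) (\<lambda>\<omega>. \<lambda>j\<in>{..<n}. \<xi> j \<omega>)) n"
proof -
  interpret M: prob_space M by fact
  have meas: "\<xi> j \<in> borel_measurable M" if "j < n" for j
    using indep that by (auto simp: M.indep_vars_def)
  let ?P = "PiM {..<n} (\<lambda>_. borel :: real measure)"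
  let ?X = "\<lambda>\<omega>. \<lambda>j\<in>{..<n}. \<xi> j \<omega>"
  have X: "?X \<in> measurable M ?P" using meas by (intro measurable_restrict) auto
  interpret D: prob_space "distr M ?P ?X" using X by (rule M.prob_space_distr)
  have flip: "flip n k \<in> measurable ?P ?P" for k
    unfolding flip_def by (intro measurable_restrict) measurable
  have eq: "distr M ?P (flip n k \<circ> ?X) = distr M ?P ?X" if "n > 0" for k
  proof -
    let ?\<eta> = "\<lambda>j \<omega>. if j < k then \<xi> j \<omega> else - \<xi> j \<omega>"
    have ind: "M.indep_vars (\<lambda>_. borel) ?\<eta> {..<n}"
      using M.indep_vars_compose2[OF indep, of "\<lambda>j x. if j < k then x else - x" "\<lambda>_. borel"] by simp
    have [simp]: "distr M borel (?\<eta> j) = distr M borel (\<xi> j)" if "j < n" for j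
      using sym[OF that] by (cases "j < k") simp_all
    have ne: "{..<n} \<noteq> {}" using that by auto
    have m\<eta>: "?\<eta> j \<in> borel_measurable M" if "j < n" for j using meas[OF that] by simp
    have "flip n k \<circ> ?X = (\<lambda>\<omega>. \<lambda>j\<in>{..<n}. ?\<eta> j \<omega>)"
      by (intro ext) (simp add: flip_def restrict_def)
    then have "distr M ?P (flip n k \<circ> ?X) = distr M ?P (\<lambda>\<omega>. \<lambda>j\<in>{..<n}. ?\<eta> j \<omega>)"
      by (simp only:)
    also have "\<dots> = PiM {..<n} (\<lambda>j. distr M borel (?\<eta> j))"
      by (rule iffD1[OF M.indep_vars_iff_distr_eq_PiM'[OF ne] ind]) (use m\<eta> in simp)
    also have "\<dots> = PiM {..<n} (\<lambda>j. distr M borel (\<xi> j))" by (intro PiM_cong) auto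
    also have "\<dots> = distr M ?P ?X"
      by (rule iffD1[OF M.indep_vars_iff_distr_eq_PiM'[OF ne] indep, symmetric]) (use meas in simp)
    finally show ?thesis .
  qed
  show ?thesis
  proof
    fix k A assume k: "k \<le> n" and A: "A \<in> sets (distr M ?P ?X)"
    show "measure (distr M ?P ?X) (flip n k -` A \<inter> space (distr M ?P ?X)) = measure (distr M ?P ?X) A"
    \<comment> \<open>The product description of independence is for a nonempty index set; without
      coordinates \<open>flip\<close> is the identity.\<close>
    proof (cases "n = 0")
      case True
      then have "flip n k v = v" if "v \<in> space ?P" for v
        using that by (auto simp: flip_def space_PiM PiE_def extensional_def)
      then have "flip n k -` A \<inter> space ?P = A" using sets.sets_into_space[OF A] by auto
      then show ?thesis by simp
    next
      case False
      have "measure (distr M ?P ?X) (flip n k -` A \<inter> space (distr M ?P ?X)) =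
          measure (distr (distr M ?P ?X) ?P (flip n k)) A"
        using A flip by (subst measure_distr) auto
      also have "\<dots> = measure (distr M ?P (flip n k \<circ> ?X)) A"
        using X flip by (subst distr_distr) auto
      also have "\<dots> = measure (distr M ?P ?X) A" using eq False by simp
      finally show ?thesis .
    qed
  qed simp
qed

subsection \<open>From dyadic grids to Brownian motion\<close>

definition dyadic_grid :: "real \<Rightarrow> nat \<Rightarrow> real set" where
  "dyadic_grid t n = (\<lambda>i. t * real i / 2 ^ n) ` {..2 ^ n}"

lemma alternating_hits_reindex:
  fixes s :: "nat \<Rightarrow> 't::linorder"
  assumes "strict_mono s" "k \<le> N"
  shows "alternating_hits UNIV c (\<lambda>i. w (s i)) m k \<longleftrightarrow> alternating_hits (s ` {..N}) c w m (s k)"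
  using assms(2)
proof (induction m arbitrary: k)
  case (Suc m)
  have "(\<exists>i\<in>s ` {..N}. i \<le> s k \<and> alternating_hits (s ` {..N}) c w m i \<and> 0 \<le> (-1) ^ m * (w i - c m)) \<longleftrightarrow>
      (\<exists>i\<in>{..N}. i \<le> k \<and> alternating_hits (s ` {..N}) c w m (s i) \<and> 0 \<le> (-1) ^ m * (w (s i) - c m))"
    using assms(1) by (simp add: strict_mono_less_eq)
  also have "\<dots> \<longleftrightarrow> (\<exists>i\<in>{..N}. i \<le> k \<and> alternating_hits UNIV c (\<lambda>i. w (s i)) m i \<and> 0 \<le> (-1) ^ m * (w (s i) - c m))"
    using Suc.IH by (intro bex_cong) auto
  also have "\<dots> \<longleftrightarrow> (\<exists>i. i \<le> k \<and> alternating_hits UNIV c (\<lambda>i. w (s i)) m i \<and> 0 \<le> (-1) ^ m * (w (s i) - c m))"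
    using Suc.prems by (auto intro: order_trans)
  finally show ?case unfolding alternating_hits_Suc by simp
qed simp

text \<open>A monotone map keeps the order of the hits, and levels relaxed by \<delta> against their
  direction absorb the change of the values.\<close>

lemma alternating_hits_round:
  assumes "alternating_hits I c w m k" "mono_on J g" "I \<subseteq> J" "k \<in> J"
    and "\<And>i. i \<in> I \<Longrightarrow> \<bar>w (g i) - w i\<bar> \<le> \<delta>"
    and "\<And>j. (-1) ^ j * (c j - c' j) \<ge> \<delta>"
  shows "alternating_hits (g ` I) c' w m (g k)"
  using assms(1,4)
proof (induction m arbitrary: k)
  case (Suc m)
  then obtain i where i: "i \<in> I" "i \<le> k" "alternating_hits I c w m i" "0 \<le> (-1) ^ m * (w i - c m)"
    unfolding alternating_hits_Suc by blast
  have "alternating_hits (g ` I) c' w m (g i)" using Suc.IH i assms(3) by blast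
  moreover have "g i \<le> g k" using assms(2,3) i Suc.prems by (auto dest: mono_onD)
  moreover have "0 \<le> (-1) ^ m * (w (g i) - c' m)"
    using assms(5)[OF i(1)] assms(6)[of m] i(4) by (cases "even m") auto
  ultimately show ?case unfolding alternating_hits_Suc using i(1) by blast
qed simp

lemma dyadic_grid_subset: "t > 0 \<Longrightarrow> dyadic_grid t n \<subseteq> {0..t}"
proof
  fix u assume t: "t > 0" and "u \<in> dyadic_grid t n"
  then obtain i where i: "i \<le> 2 ^ n" "u = t * real i / 2 ^ n" by (auto simp: dyadic_grid_def)
  then have "real i \<le> 2 ^ n" by (metis of_nat_le_iff of_nat_numeral of_nat_power)
  then show "u \<in> {0..t}" using t by (auto simp: i(2) field_simps)
qed

lemma dyadic_grid_mono: "dyadic_grid t n \<subseteq> dyadic_grid t (Suc n)"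
proof
  fix u assume "u \<in> dyadic_grid t n"
  then obtain i where i: "i \<le> 2 ^ n" "u = t * real i / 2 ^ n" by (auto simp: dyadic_grid_def)
  then have "2 * i \<le> 2 ^ Suc n" "u = t * real (2 * i) / 2 ^ Suc n" by (simp_all add: field_simps)
  then show "u \<in> dyadic_grid t (Suc n)" unfolding dyadic_grid_def by blast
qed

text \<open>The relaxed upper level is \<open>x + \<epsilon> - \<delta>\<close>, the relaxed lower
  one \<open>x + \<delta>\<close>: the band loses \<delta> at each end, whence the width
  \<open>\<epsilon> - 2 * \<delta>\<close>.\<close>

lemma alternating_hits_discretize:
  fixes f :: "real \<Rightarrow> real"
  assumes t: "t > 0" and f: "continuous_on {0..t} f" and \<delta>: "\<delta> > 0"
    and hits: "alternating_hits {0..t} (bar_levels x \<epsilon>) f m t"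
  shows "\<exists>n. alternating_hits (dyadic_grid t n) (bar_levels (x + \<delta>) (\<epsilon> - 2 * \<delta>)) f m t"
proof -
  have "uniformly_continuous_on {0..t} f" using f by (intro compact_uniformly_continuous) auto
  then obtain e where e: "e > 0" "\<And>u v. u \<in> {0..t} \<Longrightarrow> v \<in> {0..t} \<Longrightarrow> dist v u < e \<Longrightarrow> dist (f v) (f u) < \<delta>"
    using \<delta> unfolding uniformly_continuous_on_def by metis
  obtain n where n: "t / e < 2 ^ n" using real_arch_pow[of 2 "t / e"] by auto
  have tn: "t / 2 ^ n < e" using n t e(1) by (simp add: field_simps)
  \<comment> \<open>Rounding up to the grid, whose mesh is below the modulus of continuity
    \<open>e\<close>; the map is monotone and fixes \<open>t\<close>.\<close>
  define g where "g u = t * real (nat \<lceil>u * 2 ^ n / t\<rceil>) / 2 ^ n" for u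
  have g1: "u \<le> g u" "g u < u + e" if "u \<in> {0..t}" for u
  proof -
    have nn: "u * 2 ^ n / t \<ge> 0" using that t by auto
    then have c: "real (nat \<lceil>u * 2 ^ n / t\<rceil>) = of_int \<lceil>u * 2 ^ n / t\<rceil>" by simp
    have "u = t * (u * 2 ^ n / t) / 2 ^ n" using t by simp
    also have "\<dots> \<le> g u" unfolding g_def c using t by (intro divide_right_mono mult_left_mono) auto
    finally show "u \<le> g u" .
    have "g u \<le> t * (u * 2 ^ n / t + 1) / 2 ^ n"
      unfolding g_def c using t by (intro divide_right_mono mult_left_mono) (simp_all add: of_int_ceiling_le_add_one)
    also have "\<dots> = u + t / 2 ^ n" using t by (simp add: field_simps)
    finally show "g u < u + e" using tn by simp
  qed
  have gt: "g t = t"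
  proof -
    have "t * 2 ^ n / t = of_nat (2 ^ n)" using t by simp
    then have "nat \<lceil>t * 2 ^ n / t\<rceil> = 2 ^ n" by (simp only: ceiling_of_nat nat_int)
    then show ?thesis unfolding g_def by simp
  qed
  have mono: "mono_on {0..t} g"
    unfolding g_def using t
    by (intro mono_onI divide_right_mono mult_left_mono) (auto intro!: nat_mono ceiling_mono divide_right_mono)
  have grid: "g ` {0..t} \<subseteq> dyadic_grid t n"
  proof
    fix v assume "v \<in> g ` {0..t}"
    then obtain u where u: "u \<in> {0..t}" "v = g u" by blast
    have "u * 2 ^ n / t \<le> t * 2 ^ n / t" using u t by (intro divide_right_mono) auto
    then have "u * 2 ^ n / t \<le> of_int (2 ^ n)" using t by simp
    then have "\<lceil>u * 2 ^ n / t\<rceil> \<le> 2 ^ n" by (simp only: ceiling_le_iff)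
    then have "nat \<lceil>u * 2 ^ n / t\<rceil> \<le> 2 ^ n" by (simp add: nat_le_iff)
    then show "v \<in> dyadic_grid t n" unfolding u(2) g_def dyadic_grid_def by blast
  qed
  have "alternating_hits (g ` {0..t}) (bar_levels (x + \<delta>) (\<epsilon> - 2 * \<delta>)) f m (g t)"
  proof (rule alternating_hits_round[OF hits mono order.refl])
    fix i assume i: "i \<in> {0..t}"
    have "g i \<in> {0..t}" using grid dyadic_grid_subset[OF t] i by blast
    moreover have "dist (g i) i < e" using g1[OF i] by (simp add: dist_real_def)
    ultimately have "dist (f (g i)) (f i) < \<delta>" using e(2) i by blast
    then show "\<bar>f (g i) - f i\<bar> \<le> \<delta>" by (simp add: dist_real_def)
  qed (use t in \<open>auto simp: bar_levels_def\<close>)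
  then show ?thesis unfolding gt using grid by (blast intro: alternating_hits_mono_set)
qed

section \<open>The Gaussian tail\<close>

definition gauss_tail :: "real \<Rightarrow> real \<Rightarrow> real" where
  "gauss_tail t y = measure (density lborel (normal_density 0 (sqrt t))) {y..}"

text \<open>A law with a density has no atoms. Continuity of the tail is what allows \<delta> to
  tend to 0 in the levels.\<close>

lemma isCont_gauss_tail:
  assumes "t > 0"
  shows "isCont (gauss_tail t) y"
proof -
  let ?N = "density lborel (\<lambda>x. ennreal (normal_density 0 (sqrt t) x))"
  interpret N: prob_space ?N using assms by (intro prob_space_normal_density) simp
  interpret N: real_distribution ?N by standard auto
  have atom: "measure ?N {z} = 0" for z
  proof -
    have "emeasure ?N {z} = (\<integral>\<^sup>+u. ennreal (normal_density 0 (sqrt t) u) * indicator {z} u \<partial>lborel)"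
      by (subst emeasure_density) auto
    also have "\<dots> = 0" using nn_integral_null_set[of "{z}" lborel] by simp
    finally show ?thesis by (simp add: measure_def)
  qed
  have "gauss_tail t z = 1 - cdf ?N z" for z
  proof -
    have "gauss_tail t z = measure ?N ({z} \<union> {z<..})"
      unfolding gauss_tail_def by (rule arg_cong[where f = "measure ?N"]) auto
    also have "\<dots> = measure ?N {z<..}"
      by (subst N.finite_measure_Union) (auto simp: atom)
    also have "{z<..} = space ?N - {..z}" by auto
    also have "measure ?N \<dots> = 1 - cdf ?N z"
      by (subst N.prob_compl) (auto simp: cdf_def2)
    finally show ?thesis .
  qed
  then have "gauss_tail t = (\<lambda>z. 1 - cdf ?N z)" by (rule ext)
  then show ?thesis using N.isCont_cdf[of y] atom by simp
qed

context standard_brownian_motion_on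
begin

text \<open>This starts at 0 for every outcome and not only almost surely, so on the grid it equals
  the walk of the increments everywhere.\<close>

definition shifted :: "real \<Rightarrow> 'a \<Rightarrow> real" where
  "shifted u \<omega> = B u \<omega> - B 0 \<omega>"

definition grid_hits :: "nat \<Rightarrow> real \<Rightarrow> real \<Rightarrow> nat \<Rightarrow> 'a set" where
  "grid_hits n x \<epsilon> m = {\<omega> \<in> space M.
     alternating_hits (dyadic_grid T n) (bar_levels x \<epsilon>) (\<lambda>u. shifted u \<omega>) m T}"

definition wild :: "nat \<Rightarrow> real \<Rightarrow> 'a set" where
  "wild n \<delta> = {\<omega> \<in> space M. \<exists>j<2 ^ n. \<bar>B (T * real (Suc j) / 2 ^ n) \<omega> - B (T * real j / 2 ^ n) \<omega>\<bar> > \<delta>}"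

lemma shifted_measurable: "T > 0 \<Longrightarrow> u \<in> {0..T} \<Longrightarrow> shifted u \<in> borel_measurable M"
  unfolding shifted_def using measurable_marginals[of u] measurable_marginals[of 0] by auto

lemma prob_shifted_ge:
  assumes "T > 0"
  shows "\<P>(\<omega> in M. shifted T \<omega> \<ge> y) = gauss_tail T y"
proof -
  have d: "distributed M lborel (shifted T) (\<lambda>y. ennreal (normal_density 0 (sqrt T) y))"
    using gaussian_increments[of 0 T] assms by (simp add: shifted_def[abs_def])
  have m: "shifted T \<in> borel_measurable M" using shifted_measurable assms by simp
  have "\<P>(\<omega> in M. shifted T \<omega> \<ge> y) = measure (distr M lborel (shifted T)) {y..}"
    using m by (subst measure_distr) (auto simp: vimage_def Int_def intro!: arg_cong[where f = "measure M"])
  then show ?thesis using d by (simp add: distributed_def gauss_tail_def)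
qed

lemma grid_point: "T > 0 \<Longrightarrow> i \<le> 2 ^ n \<Longrightarrow> T * real i / 2 ^ n \<in> {0..T}"
  using dyadic_grid_subset[of T n] by (auto simp: dyadic_grid_def)

lemma grid_increments_symmetric_walk:
  fixes n :: nat
  assumes T: "T > 0"
  defines "\<xi> \<equiv> \<lambda>j \<omega>. B (T * real (Suc j) / 2 ^ n) \<omega> - B (T * real j / 2 ^ n) \<omega>"
  shows "symmetric_walk (distr M (PiM {..<2 ^ n} (\<lambda>_. borel)) (\<lambda>\<omega>. \<lambda>j\<in>{..<2 ^ n}. \<xi> j \<omega>)) (2 ^ n)"
proof (rule symmetric_walk_distr)
  show "prob_space M" by (rule prob_space_axioms)
  have "indep_vars (\<lambda>_. borel) (\<lambda>i \<omega>. B (T * real (Suc i) / 2 ^ n) \<omega> - B (T * real i / 2 ^ n) \<omega>) {..<(2 ^ n :: nat)}"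
    by (rule independent_increments[of "\<lambda>i. T * real i / 2 ^ n"]) (use T in \<open>auto simp: field_simps\<close>)
  then show "indep_vars (\<lambda>_. borel) \<xi> {..<2 ^ n}" unfolding \<xi>_def .
  fix j :: nat assume j: "j < 2 ^ n"
  let ?d = "T * real (Suc j) / 2 ^ n - T * real j / 2 ^ n"
  have 1: "T * real j / 2 ^ n \<in> {0..T}" "T * real (Suc j) / 2 ^ n \<in> {0..T}"
    using j T by (intro grid_point; simp)+
  have dpos: "?d > 0" using T by (simp add: field_simps)
  then have d: "distributed M lborel (\<xi> j) (\<lambda>y. ennreal (normal_density 0 (sqrt ?d) y))"
    unfolding \<xi>_def using gaussian_increments[of "T * real j / 2 ^ n" "T * real (Suc j) / 2 ^ n"] 1 by auto
  then have "distributed M lborel (\<lambda>\<omega>. 0 + \<xi> j \<omega> * (-1)) (\<lambda>y. ennreal (normal_density (0 + 0 * (-1)) (\<bar>-1\<bar> * sqrt ?d) y))"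
    using dpos normal_density_affine[of "\<xi> j" 0 "sqrt ?d" "-1" 0] by (simp add: mult.commute)
  then have d': "distributed M lborel (\<lambda>\<omega>. - \<xi> j \<omega>) (\<lambda>y. ennreal (normal_density 0 (sqrt ?d) y))" by simp
  have e: "distr M borel X = distr M lborel X" for X :: "'a \<Rightarrow> real"
    by (intro distr_cong) auto
  show "distr M borel (\<lambda>\<omega>. - \<xi> j \<omega>) = distr M borel (\<xi> j)"
    unfolding e using d d' by (simp add: distributed_def)
qed

text \<open>Everything is pulled back along the map \<open>V\<close> to the grid increments. In the
  lower estimate the restriction to small steps is dropped at the price of
  \<open>prob (wild n \<delta>)\<close>, doubled by the factor in front of the tail.\<close>

lemma grid_hits_bounds:
  assumes T: "T > 0"
  shows "grid_hits n x \<epsilon> m \<in> events"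
    and "\<epsilon> > 0 \<Longrightarrow> prob (grid_hits n x \<epsilon> (Suc m)) \<le> 2 * gauss_tail T (x + real (Suc m) * \<epsilon>)"
    and "\<epsilon> > 0 \<Longrightarrow> x > 0 \<Longrightarrow> \<delta> > 0 \<Longrightarrow>
      prob (grid_hits n x \<epsilon> (Suc m)) \<ge> 2 * gauss_tail T (x + real (Suc m) * (\<epsilon> + 2 * \<delta>)) - 2 * prob (wild n \<delta>)"
    and "wild n \<delta> \<in> events"
proof -
  define N :: nat where "N = 2 ^ n"
  define s where "s j = T * real j / 2 ^ n" for j
  define \<xi> where "\<xi> = (\<lambda>j \<omega>. B (s (Suc j)) \<omega> - B (s j) \<omega>)"
  define V where "V = (\<lambda>\<omega>. \<lambda>j\<in>{..<N}. \<xi> j \<omega>)"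
  define P where "P = PiM {..<N} (\<lambda>_. borel :: real measure)"
  define D where "D = distr M P V"
  interpret D: symmetric_walk D N
    using grid_increments_symmetric_walk[OF T, of n]
    unfolding D_def P_def V_def \<xi>_def s_def N_def .
  have s: "s 0 = 0" "s N = T" "strict_mono s"
    using T by (auto simp: s_def N_def strict_mono_def field_simps)
  have s_in: "s j \<in> {0..T}" if "j \<le> N" for j
    unfolding s_def using that T grid_point N_def by blast
  have grid: "dyadic_grid T n = s ` {..N}" by (simp add: dyadic_grid_def s_def N_def image_def)
  have \<xi>: "\<xi> j \<in> borel_measurable M" if "j < N" for j
    unfolding \<xi>_def using s_in[of j] s_in[of "Suc j"] that
    by (intro borel_measurable_diff measurable_marginals) auto
  have V: "V \<in> measurable M P" unfolding V_def P_def using \<xi> by (intro measurable_restrict) auto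
  have walk: "walk (V \<omega>) k = shifted (s k) \<omega>" if "k \<le> N" for k \<omega>
    using that
  proof (induction k)
    case (Suc k)
    then show ?case by (simp add: walk_Suc) (simp add: V_def \<xi>_def shifted_def)
  qed (simp add: shifted_def s)
  have hits: "walk_hits c (V \<omega>) m N \<longleftrightarrow> alternating_hits (dyadic_grid T n) c (\<lambda>u. shifted u \<omega>) m T" for c m \<omega>
  proof -
    have "walk_hits c (V \<omega>) m N \<longleftrightarrow> alternating_hits UNIV c (\<lambda>i. shifted (s i) \<omega>) m N"
      by (rule alternating_hits_cong) (simp_all add: walk)
    also have "\<dots> \<longleftrightarrow> alternating_hits (s ` {..N}) c (\<lambda>u. shifted u \<omega>) m (s N)"
      by (rule alternating_hits_reindex) (auto simp: s)
    finally show ?thesis by (simp add: grid s)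
  qed
  have transfer: "prob {\<omega> \<in> space M. R (V \<omega>)} = \<P>(v in D. R v)" "{\<omega> \<in> space M. R (V \<omega>)} \<in> events"
    if "Measurable.pred D R" for R
  proof -
    have "{v \<in> space P. R v} \<in> sets P" using that by (simp add: D_def pred_def)
    moreover have "V -` {v \<in> space P. R v} \<inter> space M = {\<omega> \<in> space M. R (V \<omega>)}"
      using measurable_space[OF V] by auto
    ultimately show "prob {\<omega> \<in> space M. R (V \<omega>)} = \<P>(v in D. R v)" "{\<omega> \<in> space M. R (V \<omega>)} \<in> events"
      using V measurable_sets[OF V, of "{v \<in> space P. R v}"] by (simp_all add: D_def measure_distr)
  qed
  have gh: "grid_hits n x \<epsilon> m = {\<omega> \<in> space M. walk_hits (bar_levels x \<epsilon>) (V \<omega>) m N}" for m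
    by (simp add: grid_hits_def hits)
  have wm: "Measurable.pred D (\<lambda>v. walk_hits c v m N)" for c m by (intro D.walk_hits_measurable) simp
  have wmN: "(\<lambda>v. walk v N) \<in> borel_measurable D" by (intro D.walk_measurable) simp
  show "grid_hits n x \<epsilon> m \<in> events" unfolding gh by (rule transfer(2)[OF wm])
  have wild: "wild n \<delta> = {\<omega> \<in> space M. \<not> D.small_steps \<delta> (V \<omega>)}"
  proof -
    have "D.small_steps \<delta> (V \<omega>) \<longleftrightarrow> (\<forall>j<N. \<bar>\<xi> j \<omega>\<bar> \<le> \<delta>)" for \<omega>
      by (simp add: D.small_steps_def V_def)
    then show ?thesis by (auto simp: wild_def \<xi>_def s_def N_def not_le)
  qed
  have ns: "Measurable.pred D (\<lambda>v. \<not> D.small_steps \<delta> v)"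
    using D.small_steps_measurable by (rule pred_intros_logic)
  show wild_event: "wild n \<delta> \<in> events" unfolding wild by (rule transfer(2)[OF ns])
  have tail: "\<P>(v in D. walk v N \<ge> y) = gauss_tail T y" for y
  proof -
    have "Measurable.pred D (\<lambda>v. walk v N \<ge> y)" using wmN by measurable
    from transfer(1)[OF this] show ?thesis
      using prob_shifted_ge[OF T, of y] by (simp add: walk s)
  qed
  show "prob (grid_hits n x \<epsilon> (Suc m)) \<le> 2 * gauss_tail T (x + real (Suc m) * \<epsilon>)" if "\<epsilon> > 0"
    using D.prob_walk_hits_le[OF that, of x m] unfolding gh transfer(1)[OF wm] tail .
  show "prob (grid_hits n x \<epsilon> (Suc m)) \<ge> 2 * gauss_tail T (x + real (Suc m) * (\<epsilon> + 2 * \<delta>)) - 2 * prob (wild n \<delta>)"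
    if "\<epsilon> > 0" "x > 0" "\<delta> > 0"
  proof -
    let ?y = "x + real (Suc m) * (\<epsilon> + 2 * \<delta>)"
    let ?A = "{v \<in> space D. walk v N \<ge> ?y \<and> D.small_steps \<delta> v}"
    let ?C = "{v \<in> space D. \<not> D.small_steps \<delta> v}"
    have A: "?A \<in> sets D" "?C \<in> sets D"
      using wmN D.small_steps_measurable by measurable
    have "gauss_tail T ?y = \<P>(v in D. walk v N \<ge> ?y)" by (simp only: tail)
    also have "\<dots> \<le> measure D (?A \<union> ?C)"
      by (rule D.finite_measure_mono) (use A in auto)
    also have "\<dots> \<le> measure D ?A + measure D ?C"
      by (rule measure_Un_le) (use A in auto)
    also have "measure D ?C = prob (wild n \<delta>)" unfolding wild by (rule transfer(1)[OF ns, symmetric])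
    finally have "2 * gauss_tail T ?y \<le> 2 * measure D ?A + 2 * prob (wild n \<delta>)" by simp
    moreover have "2 * measure D ?A \<le> prob (grid_hits n x \<epsilon> (Suc m))"
      using D.prob_walk_hits_ge[OF that, of m] unfolding gh transfer(1)[OF wm] .
    ultimately show ?thesis by linarith
  qed
qed


text \<open>A continuous path is uniformly continuous on the compact interval, so at fixed \<delta>
  it lies outside \<open>wild n \<delta>\<close> for all large \<open>n\<close>; dominated
  convergence does the rest.\<close>

lemma prob_wild_tendsto_0:
  assumes T: "T > 0" and \<delta>: "\<delta> > 0"
  shows "(\<lambda>n. prob (wild n \<delta>)) \<longlonglongrightarrow> 0"
proof -
  have "(\<lambda>n. \<integral>\<omega>. indicat_real (wild n \<delta>) \<omega> \<partial>M) \<longlonglongrightarrow> (\<integral>\<omega>. 0 \<partial>M)"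
  proof (rule integral_dominated_convergence[where w = "\<lambda>_. 1"])
    show "(\<lambda>\<omega>. indicat_real (wild n \<delta>) \<omega>) \<in> borel_measurable M" for n
      using grid_hits_bounds(4)[OF T] by (intro borel_measurable_indicator)
    show "AE \<omega> in M. (\<lambda>n. indicat_real (wild n \<delta>) \<omega>) \<longlonglongrightarrow> 0"
      using continuous_paths
    proof eventually_elim
      case (elim \<omega>)
      have "uniformly_continuous_on {0..T} (\<lambda>u. B u \<omega>)"
        using elim by (intro compact_uniformly_continuous) auto
      then obtain e where e: "e > 0"
        "\<And>u v. u \<in> {0..T} \<Longrightarrow> v \<in> {0..T} \<Longrightarrow> dist v u < e \<Longrightarrow> dist (B v \<omega>) (B u \<omega>) < \<delta>"
        using \<delta> unfolding uniformly_continuous_on_def by metis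
      obtain n where n: "T / e < 2 ^ n" using real_arch_pow[of 2 "T / e"] by auto
      have "indicat_real (wild k \<delta>) \<omega> = 0" if "k \<ge> n" for k
      proof -
        have "T / e < 2 ^ k" using n that power_increasing[of n k "2::real"] by linarith
        then have small: "T / 2 ^ k < e" using e(1) by (simp add: field_simps)
        have "\<bar>B (T * real (Suc j) / 2 ^ k) \<omega> - B (T * real j / 2 ^ k) \<omega>\<bar> < \<delta>" if "j < 2 ^ k" for j
        proof -
          have "T * real (Suc j) / 2 ^ k - T * real j / 2 ^ k = T / 2 ^ k" by (simp add: field_simps)
          then have "dist (T * real (Suc j) / 2 ^ k) (T * real j / 2 ^ k) < e"
            using small T by (simp only: dist_real_def) (simp add: abs_of_pos)
          then show ?thesis
            using e(2)[of "T * real j / 2 ^ k" "T * real (Suc j) / 2 ^ k"] grid_point[OF T, of j k]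
              grid_point[OF T, of "Suc j" k] that by (simp only: dist_real_def)
        qed
        then show ?thesis by (fastforce simp: wild_def indicator_def)
      qed
      then have "\<forall>\<^sub>F k in sequentially. indicat_real (wild k \<delta>) \<omega> = 0"
        by (auto simp: eventually_sequentially)
      then show ?case by (rule tendsto_eventually)
    qed
  qed (auto simp: indicator_def)
  then show ?thesis using grid_hits_bounds(4)[OF T] by simp
qed

definition dyadic_hits :: "real \<Rightarrow> real \<Rightarrow> nat \<Rightarrow> 'a set" where
  "dyadic_hits x \<epsilon> m = (\<Union>n. grid_hits n x \<epsilon> m)"

lemma dyadic_hits_event: "T > 0 \<Longrightarrow> dyadic_hits x \<epsilon> m \<in> events"
  unfolding dyadic_hits_def using grid_hits_bounds(1) by blast

text \<open>The upper bound holds on each grid and passes to the increasing union. For the lower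
  bound the order of the limits matters: \<open>n\<close> grows at fixed \<delta> to remove the wild
  paths, then \<delta> tends to 0.\<close>

lemma prob_dyadic_hits:
  assumes T: "T > 0" and "\<epsilon> > 0" "x > 0"
  shows "prob (dyadic_hits x \<epsilon> (Suc m)) = 2 * gauss_tail T (x + real (Suc m) * \<epsilon>)"
proof (rule antisym)
  have "incseq (\<lambda>n. grid_hits n x \<epsilon> (Suc m))"
    unfolding grid_hits_def using dyadic_grid_mono
    by (intro incseq_SucI) (blast intro: alternating_hits_mono_set)
  then have lim: "(\<lambda>n. prob (grid_hits n x \<epsilon> (Suc m))) \<longlonglongrightarrow> prob (dyadic_hits x \<epsilon> (Suc m))"
    unfolding dyadic_hits_def using grid_hits_bounds(1)[OF T] by (intro finite_Lim_measure_incseq) auto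
  show "prob (dyadic_hits x \<epsilon> (Suc m)) \<le> 2 * gauss_tail T (x + real (Suc m) * \<epsilon>)"
    by (rule LIMSEQ_le_const2[OF lim]) (use grid_hits_bounds(2)[OF T assms(2)] in blast)
  have *: "2 * gauss_tail T (x + real (Suc m) * (\<epsilon> + 2 * \<delta>)) \<le> prob (dyadic_hits x \<epsilon> (Suc m))" if "\<delta> > 0" for \<delta>
  proof -
    have "(\<lambda>n. 2 * gauss_tail T (x + real (Suc m) * (\<epsilon> + 2 * \<delta>)) - 2 * prob (wild n \<delta>))
      \<longlonglongrightarrow> 2 * gauss_tail T (x + real (Suc m) * (\<epsilon> + 2 * \<delta>)) - 2 * 0"
      by (intro tendsto_intros prob_wild_tendsto_0 T that)
    then have "2 * gauss_tail T (x + real (Suc m) * (\<epsilon> + 2 * \<delta>)) - 2 * 0 \<le> prob (dyadic_hits x \<epsilon> (Suc m))"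
      by (rule LIMSEQ_le[OF _ lim]) (use grid_hits_bounds(3)[OF T assms(2,3) that] in blast)
    then show ?thesis by simp
  qed
  have "isCont (\<lambda>\<delta>. 2 * gauss_tail T (x + real (Suc m) * (\<epsilon> + 2 * \<delta>))) 0"
    by (intro continuous_intros isCont_o2[OF _ isCont_gauss_tail[OF T]])
  then have "((\<lambda>\<delta>. 2 * gauss_tail T (x + real (Suc m) * (\<epsilon> + 2 * \<delta>)))
      \<longlongrightarrow> 2 * gauss_tail T (x + real (Suc m) * (\<epsilon> + 2 * 0))) (at_right 0)"
    unfolding isCont_def by (rule tendsto_within_subset) auto
  then have "2 * gauss_tail T (x + real (Suc m) * (\<epsilon> + 2 * 0)) \<le> prob (dyadic_hits x \<epsilon> (Suc m))"
    by (rule tendsto_upperbound) (use * in \<open>auto simp: eventually_at_filter\<close>)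
  then show "2 * gauss_tail T (x + real (Suc m) * \<epsilon>) \<le> prob (dyadic_hits x \<epsilon> (Suc m))" by simp
qed

text \<open>The integrand is not claimed to be measurable. Almost surely its terms lie between the
  indicators of \<open>Q k\<close> (hits visible on some grid) and of \<open>R k\<close> (grid hits
  for a sequence of slightly narrower bands), and the probability of \<open>R k\<close> does not
  exceed that of \<open>Q k\<close>. The enclosure suffices, as monotonicity of
  \<open>nn_integral\<close> applies to arbitrary functions.\<close>

lemma nn_integral_alternating_hits:
  assumes T: "T > 0" and \<epsilon>: "\<epsilon> > 0" and x: "x > 0"
  shows "(\<integral>\<^sup>+\<omega>. (\<Sum>k. of_bool (alternating_hits {0..T} (bar_levels x \<epsilon>) (\<lambda>u. B u \<omega>) (2 * k + 1) T)) \<partial>M)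
    = (\<Sum>k. ennreal (2 * gauss_tail T (x + real (2 * k + 1) * \<epsilon>)))"
proof -
  \<comment> \<open>A null sequence; the 3 keeps the narrowed width
    \<open>\<epsilon> - 2 * d j\<close> positive from \<open>j = 0\<close> on.\<close>
  define d where "d j = \<epsilon> / (real j + 3)" for j
  have d: "d j > 0" "\<epsilon> - 2 * d j > 0" for j
    using \<epsilon> by (simp_all add: d_def field_simps add_pos_nonneg)
  define Q where "Q k = dyadic_hits x \<epsilon> (2 * k + 1)" for k
  define R where "R k = (\<Inter>j. dyadic_hits (x + d j) (\<epsilon> - 2 * d j) (2 * k + 1))" for k
  have ev: "Q k \<in> events" "R k \<in> events" for k
    unfolding Q_def R_def using dyadic_hits_event[OF T] by blast+
  have Q: "emeasure M (Q k) = ennreal (2 * gauss_tail T (x + real (2 * k + 1) * \<epsilon>))" for k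
    unfolding Q_def using prob_dyadic_hits[OF T \<epsilon> x, of "2 * k"] by (simp add: emeasure_eq_measure)
  have R: "emeasure M (R k) \<le> ennreal (2 * gauss_tail T (x + real (2 * k + 1) * \<epsilon>))" for k
  proof -
    have *: "prob (R k) \<le> 2 * gauss_tail T (x + d j + real (2 * k + 1) * (\<epsilon> - 2 * d j))" for j
    proof -
      have "prob (R k) \<le> prob (dyadic_hits (x + d j) (\<epsilon> - 2 * d j) (Suc (2 * k)))"
        unfolding R_def using dyadic_hits_event[OF T] by (intro finite_measure_mono) auto
      also have "\<dots> = 2 * gauss_tail T (x + d j + real (Suc (2 * k)) * (\<epsilon> - 2 * d j))"
        using d[of j] x by (intro prob_dyadic_hits T) auto
      finally show ?thesis by simp
    qed
    have d0: "d \<longlonglongrightarrow> 0" unfolding d_def by real_asymp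
    have "(\<lambda>j. x + d j + real (2 * k + 1) * (\<epsilon> - 2 * d j)) \<longlonglongrightarrow> x + 0 + real (2 * k + 1) * (\<epsilon> - 2 * 0)"
      by (intro tendsto_intros d0)
    from isCont_tendsto_compose[OF isCont_gauss_tail[OF T] this]
    have "(\<lambda>j. 2 * gauss_tail T (x + d j + real (2 * k + 1) * (\<epsilon> - 2 * d j)))
        \<longlonglongrightarrow> 2 * gauss_tail T (x + 0 + real (2 * k + 1) * (\<epsilon> - 2 * 0))"
      by (rule tendsto_mult_left)
    then have "prob (R k) \<le> 2 * gauss_tail T (x + 0 + real (2 * k + 1) * (\<epsilon> - 2 * 0))"
      by (rule LIMSEQ_le_const) (use * in blast)
    then show ?thesis by (simp add: emeasure_eq_measure ennreal_leI)
  qed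
  have sandwich: "AE \<omega> in M. \<forall>k. indicator (Q k) \<omega> \<le> (of_bool (alternating_hits {0..T} (bar_levels x \<epsilon>) (\<lambda>u. B u \<omega>) (2 * k + 1) T) :: ennreal)
      \<and> of_bool (alternating_hits {0..T} (bar_levels x \<epsilon>) (\<lambda>u. B u \<omega>) (2 * k + 1) T) \<le> (indicator (R k) \<omega> :: ennreal)"
    using continuous_paths starts_at_0 AE_space
  proof eventually_elim
    case (elim \<omega>)
    have sh: "(\<lambda>u. shifted u \<omega>) = (\<lambda>u. B u \<omega>)" using elim by (simp add: shifted_def)
    have 1: "alternating_hits {0..T} (bar_levels x \<epsilon>) (\<lambda>u. B u \<omega>) (2 * k + 1) T" if "\<omega> \<in> Q k" for k
    proof -
      from that obtain n where "alternating_hits (dyadic_grid T n) (bar_levels x \<epsilon>) (\<lambda>u. shifted u \<omega>) (2 * k + 1) T"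
        unfolding Q_def dyadic_hits_def grid_hits_def by blast
      then show ?thesis using dyadic_grid_subset[OF T] unfolding sh by (rule alternating_hits_mono_set)
    qed
    have 2: "\<omega> \<in> R k" if h: "alternating_hits {0..T} (bar_levels x \<epsilon>) (\<lambda>u. B u \<omega>) (2 * k + 1) T" for k
    proof -
      have "\<exists>n. alternating_hits (dyadic_grid T n) (bar_levels (x + d j) (\<epsilon> - 2 * d j)) (\<lambda>u. shifted u \<omega>) (2 * k + 1) T" for j
        unfolding sh
        by (rule alternating_hits_discretize[OF T _ d(1) h]) (use elim in blast)
      then show ?thesis using elim unfolding R_def dyadic_hits_def grid_hits_def by blast
    qed
    show ?case
    proof (intro allI conjI)
      fix k
      show "indicator (Q k) \<omega> \<le> (of_bool (alternating_hits {0..T} (bar_levels x \<epsilon>) (\<lambda>u. B u \<omega>) (2 * k + 1) T) :: ennreal)"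
        using 1[of k] by (cases "\<omega> \<in> Q k") simp_all
      show "of_bool (alternating_hits {0..T} (bar_levels x \<epsilon>) (\<lambda>u. B u \<omega>) (2 * k + 1) T) \<le> (indicator (R k) \<omega> :: ennreal)"
        using 2[of k] by (cases "\<omega> \<in> R k") auto
    qed
  qed
  show ?thesis
  proof (rule antisym)
    have "(\<integral>\<^sup>+\<omega>. (\<Sum>k. of_bool (alternating_hits {0..T} (bar_levels x \<epsilon>) (\<lambda>u. B u \<omega>) (2 * k + 1) T)) \<partial>M)
        \<le> (\<integral>\<^sup>+\<omega>. (\<Sum>k. indicator (R k) \<omega>) \<partial>M)"
      by (rule nn_integral_mono_AE) (use sandwich in eventually_elim, intro suminf_le, auto)
    also have "\<dots> = (\<Sum>k. emeasure M (R k))"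
      using ev by (subst nn_integral_suminf) auto
    also have "\<dots> \<le> (\<Sum>k. ennreal (2 * gauss_tail T (x + real (2 * k + 1) * \<epsilon>)))"
      using R by (intro suminf_le) auto
    finally show "(\<integral>\<^sup>+\<omega>. (\<Sum>k. of_bool (alternating_hits {0..T} (bar_levels x \<epsilon>) (\<lambda>u. B u \<omega>) (2 * k + 1) T)) \<partial>M)
        \<le> (\<Sum>k. ennreal (2 * gauss_tail T (x + real (2 * k + 1) * \<epsilon>)))" .
    have "(\<Sum>k. ennreal (2 * gauss_tail T (x + real (2 * k + 1) * \<epsilon>))) = (\<integral>\<^sup>+\<omega>. (\<Sum>k. indicator (Q k) \<omega>) \<partial>M)"
      unfolding Q[symmetric] using ev by (subst nn_integral_suminf) auto
    also have "\<dots> \<le> (\<integral>\<^sup>+\<omega>. (\<Sum>k. of_bool (alternating_hits {0..T} (bar_levels x \<epsilon>) (\<lambda>u. B u \<omega>) (2 * k + 1) T)) \<partial>M)"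
      by (rule nn_integral_mono_AE) (use sandwich in eventually_elim, intro suminf_le, auto)
    finally show "(\<Sum>k. ennreal (2 * gauss_tail T (x + real (2 * k + 1) * \<epsilon>)))
      \<le> (\<integral>\<^sup>+\<omega>. (\<Sum>k. of_bool (alternating_hits {0..T} (bar_levels x \<epsilon>) (\<lambda>u. B u \<omega>) (2 * k + 1) T)) \<partial>M)" .
  qed
qed

theorem expected_num_bars_eq:
  assumes "T > 0" "\<epsilon> > 0" "x > 0"
  shows "expected_num_bars M B T x \<epsilon> = (\<Sum>k. ennreal (2 * gauss_tail T (x + real (2 * k + 1) * \<epsilon>)))"
  unfolding expected_num_bars_def num_bars_eq_suminf[OF assms(2)] by (rule nn_integral_alternating_hits[OF assms])

end

subsection \<open>Analytic continuation of the zeta function\<close>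

text \<open>The Weierstrass test with local majorants. The underlying theorem on series of
  differentiable functions asks for a complex majorant with values in the nonnegative reals, whence
  the casts of \<open>h\<close>.\<close>

lemma holomorphic_on_suminf_local:
  fixes f :: "nat \<Rightarrow> complex \<Rightarrow> complex"
  assumes "open S" and hol: "\<And>n. f n holomorphic_on S"
    and bound: "\<And>x. x \<in> S \<Longrightarrow> \<exists>d h. 0 < d \<and> summable h \<and> (\<forall>n. \<forall>y\<in>ball x d \<inter> S. cmod (f n y) \<le> h n)"
  shows "(\<lambda>s. \<Sum>n. f n s) holomorphic_on S" and "s \<in> S \<Longrightarrow> summable (\<lambda>n. f n s)"
proof -
  have A1: "\<exists>d h. 0 < d \<and> summable h \<and> range h \<subseteq> \<real>\<^sub>\<ge>\<^sub>0 \<and>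
      (\<forall>\<^sub>F n in sequentially. \<forall>y\<in>ball x d \<inter> S. cmod (f n y) \<le> cmod (h n))" if "x \<in> S" for x
  proof -
    from bound[OF that] obtain d h
      where d: "0 < d" "summable h" "\<And>n y. y \<in> ball x d \<inter> S \<Longrightarrow> cmod (f n y) \<le> h n" by blast
    have h: "h n \<ge> 0" for n
    proof -
      have "cmod (f n x) \<le> h n" using d(1) that by (intro d(3)) simp
      then show ?thesis by (rule order_trans[OF norm_ge_zero])
    qed
    have "summable (\<lambda>n. complex_of_real (h n))" using d(2) by (simp only: summable_complex_of_real)
    moreover have "range (\<lambda>n. complex_of_real (h n)) \<subseteq> \<real>\<^sub>\<ge>\<^sub>0"
      using h by (simp add: image_subset_iff)
    moreover have "\<forall>\<^sub>F n in sequentially. \<forall>y\<in>ball x d \<inter> S. cmod (f n y) \<le> cmod (complex_of_real (h n))"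
    proof (intro always_eventually allI ballI)
      fix n y assume "y \<in> ball x d \<inter> S"
      then have "cmod (f n y) \<le> h n" by (rule d(3))
      also have "h n = cmod (complex_of_real (h n))" using h[of n] by simp
      finally show "cmod (f n y) \<le> cmod (complex_of_real (h n))" .
    qed
    ultimately show ?thesis
      using d(1) by (intro exI[of _ d] exI[of _ "\<lambda>n. complex_of_real (h n)"] conjI)
  qed
  have A2: "f n field_differentiable at x" if "x \<in> S" for n x
    by (rule holomorphic_on_imp_differentiable_at[OF hol \<open>open S\<close> that])
  obtain g where "\<forall>x\<in>S. ((\<lambda>n. f n x) sums g x) \<and> g field_differentiable (at x)"
    by (rule series_differentiable_comparison_complex[OF \<open>open S\<close> A2 A1])
  then have g: "(\<lambda>n. f n x) sums g x" "g field_differentiable (at x)" if "x \<in> S" for x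
    using that by simp_all
  show "summable (\<lambda>n. f n s)" if "s \<in> S" using g(1)[OF that] by (rule sums_summable)
  have "g holomorphic_on S"
    by (rule holomorphic_onI) (rule field_differentiable_at_within[OF g(2)])
  then show "(\<lambda>s. \<Sum>n. f n s) holomorphic_on S"
    by (rule holomorphic_transform) (rule sums_unique[OF g(1)])
qed

text \<open>The zeta series without its first term. Starting at 2 lets every term be the centre of a
  Taylor expansion towards the preceding integer that stays in \<open>u \<ge> 1\<close>.\<close>

definition zeta_tail :: "complex \<Rightarrow> complex" where
  "zeta_tail s = (\<Sum>n. of_nat (n + 2) powr (- s))"

lemma norm_of_real_powr: "u \<ge> 0 \<Longrightarrow> cmod (complex_of_real u powr z) = u powr Re z"
  by (simp add: norm_powr_real_powr)

lemma summable_shifted_powr: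
  assumes "Re s > 1" "k > 0"
  shows "summable (\<lambda>n. (of_nat (n + k) :: complex) powr (- s))"
proof (rule summable_norm_cancel)
  have "summable (\<lambda>n. real n powr (- Re s))" using assms by (simp add: summable_real_powr_iff)
  then have "summable (\<lambda>n. real (n + k) powr (- Re s))" by (rule summable_ignore_initial_segment)
  then show "summable (\<lambda>n. cmod ((of_nat (n + k) :: complex) powr (- s)))"
    using norm_of_real_powr[of "real (_ + k)" "- s"] by simp
qed

lemma holomorphic_zeta_tail: "zeta_tail holomorphic_on {s. Re s > 1}"
  unfolding zeta_tail_def
proof (rule holomorphic_on_suminf_local(1))
  show "open {s. Re s > 1}" by (rule open_halfspace_Re_gt)
  show "(\<lambda>s. of_nat (n + 2) powr (- s)) holomorphic_on {s. Re s > 1}" for n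
    by (intro holomorphic_intros) (simp add: complex_nonpos_Reals_iff)
  fix x assume "x \<in> {s. Re s > 1}"
  then have x: "Re x > 1" by simp
  \<comment> \<open>Half the distance to the line \<open>Re s = 1\<close>: the majorant has the
    exponent \<open>Re x - d\<close>, which still exceeds 1.\<close>
  define d where "d = (Re x - 1) / 2"
  have "summable (\<lambda>n. real n powr (- (Re x - d)))"
    using x by (simp add: summable_real_powr_iff d_def field_simps)
  then have "summable (\<lambda>n. real (n + 2) powr (- (Re x - d)))" by (rule summable_ignore_initial_segment)
  moreover have "cmod (of_nat (n + 2) powr (- y)) \<le> real (n + 2) powr (- (Re x - d))"
    if "y \<in> ball x d" for n y
  proof -
    have "\<bar>Re (x - y)\<bar> < d" using that abs_Re_le_cmod[of "x - y"] by (simp add: dist_norm)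
    then have "- Re y \<le> - (Re x - d)" by auto
    then have "real (n + 2) powr (- Re y) \<le> real (n + 2) powr (- (Re x - d))"
      by (intro powr_mono) auto
    then show ?thesis using norm_of_real_powr[of "real (n + 2)" "- y"] by simp
  qed
  moreover have "d > 0" using x by (simp add: d_def)
  ultimately show "\<exists>d h. 0 < d \<and> summable h \<and>
      (\<forall>n. \<forall>y\<in>ball x d \<inter> {s. Re s > 1}. cmod (of_nat (n + 2) powr (- y)) \<le> h n)"
    by (intro exI[of _ d] exI[of _ "\<lambda>n. real (n + 2) powr (- (Re x - d))"] conjI allI ballI) auto
qed

text \<open>The remainder of order \<open>K\<close> in the Taylor expansion of
  \<open>u powr (1 - s)\<close> about \<open>n + 2\<close>, evaluated at
  \<open>n + 1\<close>.\<close>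

definition powr_remainder :: "nat \<Rightarrow> nat \<Rightarrow> complex \<Rightarrow> complex" where
  "powr_remainder K n s = of_nat (n + 1) powr (1 - s) -
     (\<Sum>i\<le>K. pochhammer (s - 1) i / fact i * of_nat (n + 2) powr (1 - s - of_nat i))"

lemma norm_powr_remainder_le:
  assumes "Re s + real K > 0"
  shows "cmod (powr_remainder K n s) \<le> cmod (pochhammer (s - 1) (Suc K)) * real (n + 1) powr (- Re s - real K)"
proof -
  \<comment> \<open>\<open>f i\<close> is the \<open>i\<close>-th derivative of
    \<open>u powr (1 - s)\<close>, its falling factorial written as a signed Pochhammer symbol. The
    step from \<open>n + 2\<close> to \<open>n + 1\<close> is -1, so the signs cancel in the
    expansion.\<close>
  define f where "f i u = (-1) ^ i * pochhammer (s - 1) i * u powr (1 - s - of_nat i)" for i and u :: complex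
  let ?S = "closed_segment (of_nat (n + 1)) (of_nat (n + 2)) :: complex set"
  have S: "\<exists>v. u = of_real v \<and> real (n + 1) \<le> v" if "u \<in> ?S" for u
  proof -
    have "?S = of_real ` closed_segment (real (n + 1)) (real (n + 2))"
      using closed_segment_of_real[of "real (n + 1)" "real (n + 2)"] by simp
    then show ?thesis using that by (auto simp: closed_segment_eq_real_ivl)
  qed
  have taylor: "cmod (f 0 (of_nat (n + 1)) - (\<Sum>i\<le>K. f i (of_nat (n + 2)) * (of_nat (n + 1) - of_nat (n + 2)) ^ i / fact i))
      \<le> (cmod (pochhammer (s - 1) (Suc K)) * real (n + 1) powr (- Re s - real K)) * cmod (of_nat (n + 1) - of_nat (n + 2)) ^ Suc K / fact K"
  proof (rule complex_Taylor[of ?S])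
    show "(f i has_field_derivative f (Suc i) u) (at u within ?S)" if "u \<in> ?S" for i u
    proof -
      from S[OF that] obtain v where v: "u = of_real v" "real (n + 1) \<le> v" by blast
      then have u: "u \<notin> \<real>\<^sub>\<le>\<^sub>0" by auto
      then have u0: "u \<noteq> 0" by auto
      have "f (Suc i) u = (-1) ^ i * pochhammer (s - 1) i * ((1 - s - of_nat i) * u powr (1 - s - of_nat i - 1))"
        by (simp add: f_def pochhammer_Suc algebra_simps)
      moreover have "(f i has_field_derivative (-1) ^ i * pochhammer (s - 1) i * ((1 - s - of_nat i) * u powr (1 - s - of_nat i - 1))) (at u)"
        unfolding f_def using u by (auto intro!: derivative_eq_intros)
      ultimately have "(f i has_field_derivative f (Suc i) u) (at u)" by (simp only:)
      then show ?thesis by (rule has_field_derivative_at_within)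
    qed
    show "cmod (f (Suc K) u) \<le> cmod (pochhammer (s - 1) (Suc K)) * real (n + 1) powr (- Re s - real K)"
      if "u \<in> ?S" for u
    proof -
      from S[OF that] obtain v where v: "u = of_real v" "real (n + 1) \<le> v" by blast
      then have "cmod (f (Suc K) u) = cmod (pochhammer (s - 1) (Suc K)) * v powr (- Re s - real K)"
        by (simp add: f_def norm_mult norm_power norm_of_real_powr)
      \<comment> \<open>The exponent is negative, so the left end of the segment gives the
        bound.\<close>
      also have "v powr (- Re s - real K) \<le> real (n + 1) powr (- Re s - real K)"
        using v assms by (intro powr_mono2') auto
      finally show ?thesis by (simp add: mult_left_mono)
    qed
  qed auto
  have step: "cmod (of_nat (n + 1) - of_nat (n + 2)) = 1" by simp
  have rem: "f 0 (of_nat (n + 1)) - (\<Sum>i\<le>K. f i (of_nat (n + 2)) * (of_nat (n + 1) - of_nat (n + 2)) ^ i / fact i) = powr_remainder K n s"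
  proof -
    have "f i (of_nat (n + 2)) * (of_nat (n + 1) - of_nat (n + 2)) ^ i / fact i =
        pochhammer (s - 1) i / fact i * of_nat (n + 2) powr (1 - s - of_nat i)" for i
    proof -
      have "(of_nat (n + 1) - of_nat (n + 2) :: complex) = -1" by simp
      moreover have "(-1) ^ i * (-1) ^ i = (1 :: complex)" by (simp flip: power_mult_distrib)
      moreover have "f i w * (-1) ^ i = ((-1) ^ i * (-1) ^ i) * (pochhammer (s - 1) i * w powr (1 - s - of_nat i))" for w
        by (simp only: f_def mult_ac)
      ultimately show ?thesis by simp
    qed
    moreover have "f 0 (of_nat (n + 1)) = of_nat (n + 1) powr (1 - s)" by (simp add: f_def)
    ultimately show ?thesis unfolding powr_remainder_def by (simp only:)
  qed
  have "cmod (powr_remainder K n s) \<le> cmod (pochhammer (s - 1) (Suc K)) * real (n + 1) powr (- Re s - real K) * 1 ^ Suc K / fact K"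
    using taylor unfolding rem step .
  also have "(cmod (pochhammer (s - 1) (Suc K)) * real (n + 1) powr (- Re s - real K)) * 1 ^ Suc K / fact K
      \<le> cmod (pochhammer (s - 1) (Suc K)) * real (n + 1) powr (- Re s - real K)"
    using divide_left_mono[of 1 "fact K :: real" "cmod (pochhammer (s - 1) (Suc K)) * real (n + 1) powr (- Re s - real K)"]
    by (simp add: fact_ge_1)
  finally show ?thesis .
qed

lemma holomorphic_on_pochhammer [holomorphic_intros]:
  "f holomorphic_on A \<Longrightarrow> (\<lambda>s. pochhammer (f s) n :: complex) holomorphic_on A"
  unfolding pochhammer_prod by (intro holomorphic_intros)

text \<open>The terms decay like \<open>n powr (- Re s - K)\<close>, and the Pochhammer factor is
  bounded on compact discs. A disc whose radius is half the distance to the boundary keeps the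
  exponent below -1.\<close>

lemma powr_remainder_series:
  fixes K :: nat
  defines "A \<equiv> {s. Re s + real K > 1}"
  shows "(\<lambda>s. \<Sum>n. powr_remainder K n s) holomorphic_on A" and "s \<in> A \<Longrightarrow> summable (\<lambda>n. powr_remainder K n s)"
proof -
  have c1: "open A"
  proof -
    have "A = {s. Re s > 1 - real K}" by (auto simp: A_def)
    then show ?thesis by (simp add: open_halfspace_Re_gt)
  qed
  have c2: "powr_remainder K n holomorphic_on A" for n
    unfolding powr_remainder_def by (intro holomorphic_intros) (simp_all add: complex_nonpos_Reals_iff)
  have c3: "\<exists>d h. 0 < d \<and> summable h \<and> (\<forall>n. \<forall>y\<in>ball x d \<inter> A. cmod (powr_remainder K n y) \<le> h n)"
    if "x \<in> A" for x
  proof -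
    have x: "Re x + real K > 1" using that by (simp add: A_def)
    define d where "d = (Re x + real K - 1) / 2"
    have "compact ((\<lambda>y. pochhammer (y - 1) (Suc K)) ` cball x d)"
      by (intro compact_continuous_image holomorphic_on_imp_continuous_on holomorphic_intros compact_cball)
    then have "bounded ((\<lambda>y. pochhammer (y - 1) (Suc K)) ` cball x d)" by (rule compact_imp_bounded)
    then obtain C where "\<forall>z\<in>(\<lambda>y. pochhammer (y - 1) (Suc K)) ` cball x d. cmod z \<le> C"
      unfolding bounded_iff by blast
    then have C: "\<And>y. y \<in> cball x d \<Longrightarrow> cmod (pochhammer (y - 1) (Suc K)) \<le> C" by simp
    have "summable (\<lambda>n. real n powr (- (Re x - d) - real K))"
      using x by (simp add: summable_real_powr_iff d_def field_simps)
    then have "summable (\<lambda>n. real (n + 1) powr (- (Re x - d) - real K))" by (rule summable_ignore_initial_segment)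
    then have "summable (\<lambda>n. C * real (n + 1) powr (- (Re x - d) - real K))" by (rule summable_mult)
    moreover have "cmod (powr_remainder K n y) \<le> C * real (n + 1) powr (- (Re x - d) - real K)"
      if y: "y \<in> ball x d \<inter> A" for n y
    proof -
      have "\<bar>Re (x - y)\<bar> < d" using y abs_Re_le_cmod[of "x - y"] by (simp add: dist_norm)
      then have "- Re y - real K \<le> - (Re x - d) - real K" by auto
      then have p: "real (n + 1) powr (- Re y - real K) \<le> real (n + 1) powr (- (Re x - d) - real K)"
        by (intro powr_mono) auto
      have "cmod (powr_remainder K n y) \<le> cmod (pochhammer (y - 1) (Suc K)) * real (n + 1) powr (- Re y - real K)"
        using y by (intro norm_powr_remainder_le) (auto simp: A_def)
      also have "\<dots> \<le> C * real (n + 1) powr (- (Re x - d) - real K)"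
        using C[of y] y p by (intro mult_mono) (auto intro: order_trans[OF norm_ge_zero])
      finally show ?thesis .
    qed
    moreover have "d > 0" using x by (simp add: d_def)
    ultimately show ?thesis
      by (intro exI[of _ d] exI[of _ "\<lambda>n. C * real (n + 1) powr (- (Re x - d) - real K)"] conjI allI ballI)
  qed
  show "(\<lambda>s. \<Sum>n. powr_remainder K n s) holomorphic_on A"
    by (rule holomorphic_on_suminf_local(1)[OF c1 c2 c3])
  show "s \<in> A \<Longrightarrow> summable (\<lambda>n. powr_remainder K n s)"
    by (rule holomorphic_on_suminf_local(2)[OF c1 c2 c3])
qed

text \<open>
  Summing the Taylor expansion of \<open>u powr (1 - s)\<close> from \<open>n + 2\<close> to \<open>n + 1\<close> expresses \<open>zeta_tail s\<close> by
  its values at \<open>s + 1\<close>, \<dots>, \<open>s + K - 1\<close> and a remainder that converges for \<open>Re s > 1 - K\<close>. This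
  allows the continuation of \<open>(s - 1) * zeta_tail s\<close> by one unit to the left.
\<close>

lemma zeta_tail_recursion:
  assumes s: "Re s > 1" and K: "K \<ge> 1"
  shows "(s - 1) * zeta_tail s = 1 - (\<Sum>i\<in>{2..K}. pochhammer (s - 1) i / fact i * zeta_tail (s + of_nat i - 1))
    - (\<Sum>n. powr_remainder K n s)"
proof -
  let ?a = "\<lambda>i n. pochhammer (s - 1) i / fact i * of_nat (n + 2) powr (1 - s - of_nat i)"
  have tele: "(\<lambda>n. of_nat (n + 1) powr (1 - s) - of_nat (n + 2) powr (1 - s)) sums (1 :: complex)"
  proof -
    have "(\<lambda>n. complex_of_real (real (n + 1)) powr (1 - s)) \<longlonglongrightarrow> 0"
    proof (rule tendsto_norm_zero_cancel)
      have "(\<lambda>n. real (n + 1) powr (1 - Re s)) \<longlonglongrightarrow> 0" using s by real_asymp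
      then show "(\<lambda>n. cmod (complex_of_real (real (n + 1)) powr (1 - s))) \<longlonglongrightarrow> 0"
        by (subst norm_of_real_powr) auto
    qed
    from telescope_sums'[OF this] show ?thesis by (simp add: add.commute)
  qed
  have ser: "(\<lambda>n. ?a i n) sums (pochhammer (s - 1) i / fact i * zeta_tail (s + of_nat i - 1))" if "i \<ge> 1" for i
  proof -
    have "(\<lambda>n. of_nat (n + 2) powr (- (s + of_nat i - 1))) sums zeta_tail (s + of_nat i - 1)"
      unfolding zeta_tail_def using s that by (intro summable_sums summable_shifted_powr) auto
    then show ?thesis by (intro sums_mult) (simp add: algebra_simps)
  qed
  have "(\<lambda>n. powr_remainder K n s) sums (\<Sum>n. powr_remainder K n s)"
    using powr_remainder_series(2)[of s K] s by (intro summable_sums) simp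
  then have "(\<lambda>n. (\<Sum>i\<in>{1..K}. ?a i n) + powr_remainder K n s) sums
      ((\<Sum>i\<in>{1..K}. pochhammer (s - 1) i / fact i * zeta_tail (s + of_nat i - 1)) + (\<Sum>n. powr_remainder K n s))"
    by (intro sums_add sums_sum ser) auto
  moreover have "(\<Sum>i\<in>{1..K}. ?a i n) + powr_remainder K n s = of_nat (n + 1) powr (1 - s) - of_nat (n + 2) powr (1 - s)" for n
  proof -
    \<comment> \<open>The term \<open>i = 0\<close> of the expansion is the second half of the
      telescoping difference.\<close>
    have "{..K} = insert 0 {1..K}" by auto
    then have "(\<Sum>i\<le>K. ?a i n) = of_nat (n + 2) powr (1 - s) + (\<Sum>i\<in>{1..K}. ?a i n)" by simp
    then show ?thesis unfolding powr_remainder_def by simp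
  qed
  ultimately have "1 = (\<Sum>i\<in>{1..K}. pochhammer (s - 1) i / fact i * zeta_tail (s + of_nat i - 1)) + (\<Sum>n. powr_remainder K n s)"
    using tele sums_unique2 by simp
  \<comment> \<open>The term \<open>i = 1\<close> is \<open>(s - 1) * zeta_tail s\<close>, the
    quantity to be isolated.\<close>
  also have "{1..K} = insert 1 {2..K}" using K by auto
  finally show ?thesis by (simp add: algebra_simps)
qed

lemma zeta_tail_continuation_halfplane:
  "\<exists>H. H holomorphic_on {s. Re s > 1 - real m} \<and> (\<forall>s. Re s > 1 \<longrightarrow> H s = (s - 1) * zeta_tail s)"
proof (induction m)
  case 0
  have "(\<lambda>s. (s - 1) * zeta_tail s) holomorphic_on {s. Re s > 1 - real 0}"
    using holomorphic_zeta_tail by (intro holomorphic_intros) simp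
  then show ?case by (intro exI[of _ "\<lambda>s. (s - 1) * zeta_tail s"]) simp
next
  case (Suc m)
  then obtain H where H: "H holomorphic_on {s. Re s > 1 - real m}"
    "\<And>s. Re s > 1 \<Longrightarrow> H s = (s - 1) * zeta_tail s" by blast
  \<comment> \<open>The recursion contains \<open>pochhammer (s - 1) i\<close>. Its last factor
    \<open>s + i - 2\<close> is the one that \<open>H (s + i - 1)\<close> already carries, hence the
    index \<open>i - 1\<close>. Since \<open>i\<close> is at least 2, \<open>H\<close> is evaluated
    at least one unit to the right of \<open>s\<close>.\<close>
  define H' where "H' s = 1 - (\<Sum>i\<in>{2..Suc m}. pochhammer (s - 1) (i - 1) / fact i * H (s + of_nat i - 1))
    - (\<Sum>n. powr_remainder (Suc m) n s)" for s
  have "(\<lambda>s. H (s + of_nat i - 1)) holomorphic_on {s. Re s > 1 - real (Suc m)}" if "i \<in> {2..Suc m}" for i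
  proof -
    have "(H \<circ> (\<lambda>s. s + of_nat i - 1)) holomorphic_on {s. Re s > 1 - real (Suc m)}"
      using that by (intro holomorphic_on_compose_gen[OF _ H(1)] holomorphic_intros) auto
    then show ?thesis by (simp add: o_def)
  qed
  moreover have "(\<lambda>s. \<Sum>n. powr_remainder (Suc m) n s) holomorphic_on {s. Re s > 1 - real (Suc m)}"
    using powr_remainder_series(1)[of "Suc m"] by (rule holomorphic_on_subset) auto
  ultimately have "H' holomorphic_on {s. Re s > 1 - real (Suc m)}"
    unfolding H'_def by (intro holomorphic_intros) auto
  moreover have "H' s = (s - 1) * zeta_tail s" if s: "Re s > 1" for s
  proof -
    have "pochhammer (s - 1) (i - 1) / fact i * H (s + of_nat i - 1) = pochhammer (s - 1) i / fact i * zeta_tail (s + of_nat i - 1)"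
      if i: "i \<in> {2..Suc m}" for i
    proof -
      obtain j where j: "i = Suc j" using i by (cases i) auto
      have "H (s + of_nat i - 1) = (s + of_nat i - 1 - 1) * zeta_tail (s + of_nat i - 1)"
        using s i by (intro H(2)) auto
      also have "s + of_nat i - 1 - 1 = s - 1 + of_nat j" by (simp add: j)
      finally have "H (s + of_nat i - 1) = (s - 1 + of_nat j) * zeta_tail (s + of_nat i - 1)" .
      moreover have "pochhammer (s - 1) i = pochhammer (s - 1) (i - 1) * (s - 1 + of_nat j)"
        by (simp add: j pochhammer_Suc)
      ultimately show ?thesis by (simp only: mult_ac times_divide_eq_right times_divide_eq_left)
    qed
    then have "(\<Sum>i\<in>{2..Suc m}. pochhammer (s - 1) (i - 1) / fact i * H (s + of_nat i - 1)) =
        (\<Sum>i\<in>{2..Suc m}. pochhammer (s - 1) i / fact i * zeta_tail (s + of_nat i - 1))"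
      by (rule sum.cong[OF refl])
    then show ?thesis unfolding H'_def using zeta_tail_recursion[OF s, of "Suc m"] by simp
  qed
  ultimately show ?case by blast
qed

lemma zeta_tail_continuation:
  "\<exists>H. H holomorphic_on UNIV \<and> (\<forall>s. Re s > 1 \<longrightarrow> H s = (s - 1) * zeta_tail s)"
proof -
  obtain H where H: "\<And>m. H m holomorphic_on {s. Re s > 1 - real m}"
    "\<And>m s. Re s > 1 \<Longrightarrow> H m s = (s - 1) * zeta_tail s"
    using zeta_tail_continuation_halfplane by metis
  have eq: "H m s = H k s" if "m \<le> k" "Re s > 1 - real m" for m k s
  proof (rule analytic_continuation_open[where f = "H m" and g = "H k" and s = "{s. Re s > 1}" and s' = "{s. Re s > 1 - real m}"])
    show "H k holomorphic_on {s. Re s > 1 - real m}"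
      using H(1)[of k] by (rule holomorphic_on_subset) (use that in auto)
    show "{s. Re s > 1} \<noteq> {}" by (auto intro: exI[of _ 2])
  qed (use that H in \<open>auto intro: open_halfspace_Re_gt convex_connected convex_halfspace_Re_gt\<close>)
  \<comment> \<open>The functions on the nested half-planes agree, so every large enough index gives
    the same value; \<open>2 - Re s\<close> makes the inequality \<open>Re s > 1 - real m\<close>
    strict.\<close>
  define G where "G s = H (nat \<lceil>2 - Re s\<rceil>) s" for s
  have G: "G s = H m s" if "Re s > 1 - real m" for m s
  proof -
    let ?k = "nat \<lceil>2 - Re s\<rceil>"
    have "2 - Re s \<le> real ?k" by linarith
    then have "Re s > 1 - real ?k" by linarith
    then show ?thesis using eq[of m ?k s] eq[of ?k m s] that unfolding G_def by (cases "m \<le> ?k") auto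
  qed
  have "G holomorphic_on (\<Union>m. {s. Re s > 1 - real m})"
  proof (rule holomorphic_on_UN_open)
    show "G holomorphic_on {s. Re s > 1 - real m}" for m
      using H(1)[of m] by (rule holomorphic_transform) (use G in auto)
  qed (rule open_halfspace_Re_gt)
  moreover have "(\<Union>m. {s. Re s > 1 - real m}) = UNIV"
  proof -
    have "\<exists>m. Re s > 1 - real m" for s
      using reals_Archimedean2[of "1 - Re s"] by (auto simp: algebra_simps)
    then show ?thesis by blast
  qed
  ultimately have "G holomorphic_on UNIV" by simp
  moreover have "G s = (s - 1) * zeta_tail s" if "Re s > 1" for s
    using G[of 0 s] H(2) that by simp
  ultimately show ?thesis by blast
qed

text \<open>This makes the definite description usable: existence comes from \<open>H\<close>,
  uniqueness from the identity theorem on the connected punctured plane, with the value at 1 fixed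
  by convention.\<close>

lemma riemann_zeta_continuation:
  "\<exists>H. H holomorphic_on UNIV \<and> riemann_zeta = (\<lambda>s. if s = 1 then 0 else 1 + H s / (s - 1)) \<and>
    (\<forall>s. Re s > 1 \<longrightarrow> (\<lambda>n. 1 / of_nat (Suc n) powr s) sums riemann_zeta s)"
proof -
  obtain H where H: "H holomorphic_on UNIV" "\<And>s. Re s > 1 \<Longrightarrow> H s = (s - 1) * zeta_tail s"
    using zeta_tail_continuation by blast
  define Z where "Z = (\<lambda>s. if s = 1 then 0 else 1 + H s / (s - 1))"
  let ?P = "\<lambda>f. f holomorphic_on (- {1}) \<and> (\<forall>s. Re s > 1 \<longrightarrow> (\<lambda>n. 1 / of_nat (Suc n) powr s) sums f s) \<and> f 1 = (0 :: complex)"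
  have sums: "(\<lambda>n. 1 / of_nat (Suc n) powr s) sums Z s" if s: "Re s > 1" for s
  proof -
    have "(\<lambda>n. of_nat (n + 2) powr (- s)) sums zeta_tail s"
      unfolding zeta_tail_def using s by (intro summable_sums summable_shifted_powr) auto
    then have "(\<lambda>n. 1 / of_nat (Suc (Suc n)) powr s) sums zeta_tail s"
      by (simp add: powr_minus divide_inverse)
    then have "(\<lambda>n. 1 / of_nat (Suc n) powr s) sums (zeta_tail s + 1 / of_nat (Suc 0) powr s)"
      by (rule sums_Suc)
    moreover have "s \<noteq> 1" using s by auto
    then have "Z s = 1 + zeta_tail s" unfolding Z_def using H(2)[OF s] by simp
    ultimately show ?thesis by (simp add: add.commute)
  qed
  have "(\<lambda>s. 1 + H s / (s - 1)) holomorphic_on (- {1})"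
    using H(1) by (intro holomorphic_intros holomorphic_on_subset[OF H(1)]) auto
  then have "Z holomorphic_on (- {1})" by (rule holomorphic_transform) (auto simp: Z_def)
  then have PZ: "?P Z" using sums by (simp add: Z_def)
  have "f = Z" if f: "?P f" for f
  proof
    fix s
    show "f s = Z s"
    proof (cases "s = 1")
      case True
      then show ?thesis using f PZ by simp
    next
      case False
      show ?thesis
      proof (rule analytic_continuation_open[where f = f and g = Z and s = "{s. Re s > 1}" and s' = "- {1}"])
        show "connected (- {1 :: complex})" by (rule connected_punctured_universe) simp
        show "{s. Re s > 1} \<noteq> {}" by (auto intro: exI[of _ 2])
        show "f z = Z z" if "z \<in> {s. Re s > 1}" for z
          using f sums[of z] that sums_unique2 by blast
      qed (use f PZ False in \<open>auto intro: open_halfspace_Re_gt\<close>)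
    qed
  qed
  with PZ have "riemann_zeta = Z" unfolding riemann_zeta_def by (intro the_equality)
  note rz = this
  show ?thesis
  proof (intro exI[of _ H] conjI allI impI)
    show "riemann_zeta = (\<lambda>s. if s = 1 then 0 else 1 + H s / (s - 1))"
      using rz Z_def by (rule trans)
    show "(\<lambda>n. 1 / of_nat (Suc n) powr s) sums riemann_zeta s" if "Re s > 1" for s
      unfolding rz using that by (rule sums)
  qed (rule H(1))
qed

lemma riemann_zeta_sums: "Re s > 1 \<Longrightarrow> (\<lambda>n. 1 / of_nat (Suc n) powr s) sums riemann_zeta s"
  using riemann_zeta_continuation by blast

lemma meromorphic_riemann_zeta: "riemann_zeta meromorphic_on UNIV"
proof -
  obtain H where H: "H holomorphic_on UNIV" "riemann_zeta = (\<lambda>s. if s = 1 then 0 else 1 + H s / (s - 1))"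
    using riemann_zeta_continuation by blast
  have "H meromorphic_on UNIV" using H(1) by (intro analytic_on_imp_meromorphic_on) (simp add: analytic_on_open)
  then have "(\<lambda>s. 1 + H s / (s - 1)) meromorphic_on UNIV" by (intro meromorphic_intros)
  \<comment> \<open>Meromorphy is decided on punctured neighbourhoods, so the conventional value at
    1 is harmless.\<close>
  moreover have "eventually (\<lambda>w. riemann_zeta w = 1 + H w / (w - 1)) (at z)" for z
    using eventually_neq_at_within[of 1 z UNIV] by eventually_elim (simp add: H(2))
  ultimately show ?thesis by (subst meromorphic_on_cong[OF _ refl])
qed

subsection \<open>Confluent hypergeometric functions\<close>

lemma hypergeo_majorant_summable:
  fixes r b R :: real
  assumes "b > 0" "r \<ge> 0" "R \<ge> 0"
  shows "summable (\<lambda>n. pochhammer r n / pochhammer b n * R ^ n / fact n)"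
proof -
  let ?f = "\<lambda>n. pochhammer r n / pochhammer b n * R ^ n / fact n"
  have "(\<lambda>n. (r + real n) / (b + real n) * R / (real n + 1)) \<longlonglongrightarrow> 0"
    by real_asymp
  then have "\<forall>\<^sub>F n in sequentially. (r + real n) / (b + real n) * R / (real n + 1) < 1 / 2"
    by (rule order_tendstoD) simp
  then obtain N where N: "\<And>n. n \<ge> N \<Longrightarrow> (r + real n) / (b + real n) * R / (real n + 1) < 1 / 2"
    by (auto simp: eventually_sequentially)
  have pos: "?f n \<ge> 0" for n
    using assms by (auto simp: pochhammer_prod intro!: mult_nonneg_nonneg divide_nonneg_nonneg prod_nonneg)
  show ?thesis
  proof (rule summable_ratio_test)
    show "norm (?f (Suc n)) \<le> 1 / 2 * norm (?f n)" if "n \<ge> N" for n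
    proof -
      have "?f (Suc n) = ((r + real n) / (b + real n) * R / (real n + 1)) * ?f n"
        by (simp add: pochhammer_Suc ac_simps)
      also have "\<dots> \<le> 1 / 2 * ?f n" using N[OF that] pos[of n] by (intro mult_right_mono) auto
      finally show ?thesis using pos by (simp only: real_norm_def abs_of_nonneg)
    qed
  qed simp
qed

lemma norm_pochhammer_le:
  fixes a :: complex
  assumes "cmod a \<le> r"
  shows "cmod (pochhammer a n) \<le> pochhammer r n"
  unfolding pochhammer_prod prod_norm[symmetric]
proof (intro prod_mono conjI norm_ge_zero)
  fix i
  show "cmod (a + of_nat i) \<le> r + of_nat i"
    using norm_triangle_ineq[of a "of_nat i"] assms by simp
qed

lemma norm_hypergeo_term_le:
  fixes a z :: complex and b :: real
  assumes "cmod a \<le> r" "b > 0"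
  shows "cmod (pochhammer a n / pochhammer (of_real b) n * z ^ n / fact n)
    \<le> pochhammer r n / pochhammer b n * cmod z ^ n / fact n"
proof -
  have "cmod (pochhammer (of_real b) n) = pochhammer b n"
    using assms by (simp add: pochhammer_of_real pochhammer_nonneg)
  moreover have "pochhammer b n \<ge> 0" using assms by (simp add: pochhammer_nonneg)
  ultimately show ?thesis
    using norm_pochhammer_le[OF assms(1), of n]
    by (simp add: norm_mult norm_divide norm_power divide_right_mono mult_right_mono)
qed

lemma summable_norm_hypergeo:
  fixes a z :: complex and b :: real
  assumes "b > 0"
  shows "summable (\<lambda>n. cmod (pochhammer a n / pochhammer (of_real b) n * z ^ n / fact n))"
  by (rule summable_comparison_test'[OF hypergeo_majorant_summable[OF assms norm_ge_zero[of a] norm_ge_zero[of z]], of 0])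
    (simp only: norm_hypergeo_term_le[OF order.refl assms] real_norm_def abs_norm_cancel)

lemma hypergeo_sums:
  fixes b :: real
  assumes "b > 0"
  shows "(\<lambda>n. pochhammer a n / pochhammer (of_real b) n * z ^ n / fact n) sums hypergeo_1F1 a (of_real b) z"
  unfolding hypergeo_1F1_def
  by (rule summable_sums[OF summable_norm_cancel[OF summable_norm_hypergeo[OF assms]]])

text \<open>It is the parameter \<open>a\<close>, not the argument, that depends on \<open>p\<close>
  in the closed form. On the unit ball about \<open>x\<close> the majorant with
  \<open>cmod x + 1\<close> in place of \<open>a\<close> serves all points at once.\<close>

lemma holomorphic_hypergeo:
  fixes b :: real
  assumes "b > 0"
  shows "(\<lambda>a. hypergeo_1F1 a (of_real b) z) holomorphic_on UNIV"
  unfolding hypergeo_1F1_def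
proof (rule holomorphic_on_suminf_local(1))
  show "(\<lambda>a. pochhammer a n / pochhammer (of_real b) n * z ^ n / fact n) holomorphic_on UNIV" for n
    unfolding divide_inverse by (intro holomorphic_intros)
  fix x :: complex
  have "cmod (pochhammer y n / pochhammer (of_real b) n * z ^ n / fact n)
      \<le> pochhammer (cmod x + 1) n / pochhammer b n * cmod z ^ n / fact n" if "y \<in> ball x 1 \<inter> UNIV" for n y
  proof (rule norm_hypergeo_term_le[OF _ assms])
    have "cmod y \<le> cmod x + cmod (y - x)" using norm_triangle_ineq[of x "y - x"] by simp
    then show "cmod y \<le> cmod x + 1" using that by (simp add: dist_norm norm_minus_commute)
  qed
  then show "\<exists>d h. 0 < d \<and> summable h \<and> (\<forall>n. \<forall>y\<in>ball x d \<inter> UNIV. cmod (pochhammer y n / pochhammer (of_real b) n * z ^ n / fact n) \<le> h n)"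
    by (intro exI[of _ 1] exI[of _ "\<lambda>n. pochhammer (cmod x + 1) n / pochhammer b n * cmod z ^ n / fact n"] conjI allI ballI
        hypergeo_majorant_summable assms) auto
qed simp

text \<open>Kummer's transformation; the Cauchy product coefficients are Chu--Vandermonde sums.\<close>

lemma hypergeo_kummer:
  fixes b :: real
  assumes b: "b > 0"
  shows "exp (- z) * hypergeo_1F1 a (of_real b) z = hypergeo_1F1 (of_real b - a) (of_real b) (- z)"
proof -
  let ?f = "\<lambda>n. pochhammer a n / pochhammer (of_real b) n * z ^ n / fact n"
  let ?e = "\<lambda>n. (- z) ^ n / fact n"
  have e: "?e sums exp (- z)" "summable (\<lambda>n. cmod (?e n))"
    using exp_converges[of "- z"] summable_norm_exp[of "- z"] by (simp_all add: scaleR_conv_of_real field_simps)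
  have "(\<lambda>k. \<Sum>i\<le>k. ?f i * ?e (k - i)) sums ((\<Sum>k. ?f k) * (\<Sum>k. ?e k))"
    by (rule Cauchy_product_sums[OF summable_norm_hypergeo[OF b] e(2)])
  also have "(\<Sum>k. ?f k) = hypergeo_1F1 a (of_real b) z" by (simp add: hypergeo_1F1_def)
  also have "(\<Sum>k. ?e k) = exp (- z)" using e(1) by (rule sums_unique[symmetric])
  also have "(\<lambda>k. \<Sum>i\<le>k. ?f i * ?e (k - i)) = (\<lambda>k. pochhammer (of_real b - a) k / pochhammer (of_real b) k * (- z) ^ k / fact k)"
  proof
    fix k
    have c: "\<forall>i\<in>{0..<k}. (of_real b :: complex) \<noteq> - of_nat i"
    proof
      fix i
      have "b \<noteq> - real i" using b by linarith
      then show "(of_real b :: complex) \<noteq> - of_nat i" by (metis of_real_eq_iff of_real_minus of_real_of_nat_eq)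
    qed
    \<comment> \<open>The binomial coefficient hidden in \<open>fact i * fact (k - i)\<close>
      becomes \<open>pochhammer (- of_nat k) i\<close>, and its sign cancels the one from writing
      \<open>z\<close> as the negative of \<open>- z\<close>; a Vandermonde summand remains.\<close>
    have "?f i * ?e (k - i) = (- z) ^ k / fact k * (pochhammer a i * pochhammer (- of_nat k) i / (of_nat (fact i) * pochhammer (of_real b) i))"
      if "i \<le> k" for i
    proof -
      have "of_nat (k choose i) = (of_nat k gchoose i :: complex)" by (simp add: binomial_gbinomial)
      then have ch: "(fact k / (fact i * fact (k - i)) :: complex) = (- 1) ^ i * pochhammer (- of_nat k) i / fact i"
        using that by (simp add: binomial_fact gbinomial_pochhammer)
      then have p: "pochhammer (- of_nat k) i = ((- 1) ^ i * (fact k / fact (k - i)) :: complex)"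
        by (cases "even i") (simp_all add: field_simps)
      have zz: "z ^ i * (- z) ^ (k - i) = (- 1) ^ i * (- z) ^ k"
      proof -
        have "z ^ i = (- 1) ^ i * (- z) ^ i" by (simp flip: power_mult_distrib)
        moreover have "(- z) ^ k = (- z) ^ i * (- z) ^ (k - i)" using that by (simp flip: power_add)
        ultimately show ?thesis by simp
      qed
      have "?f i * ?e (k - i) = pochhammer a i / pochhammer (of_real b) i / fact i / fact (k - i) * (z ^ i * (- z) ^ (k - i))"
        by simp
      also have "\<dots> = (- z) ^ k / fact k * (pochhammer a i * pochhammer (- of_nat k) i / (of_nat (fact i) * pochhammer (of_real b) i))"
        unfolding zz p by (simp add: ac_simps)
      finally show ?thesis .
    qed
    then have "(\<Sum>i\<le>k. ?f i * ?e (k - i)) =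
        (\<Sum>i\<in>{0..k}. (- z) ^ k / fact k * (pochhammer a i * pochhammer (- of_nat k) i / (of_nat (fact i) * pochhammer (of_real b) i)))"
      by (intro sum.cong) auto
    also have "\<dots> = (- z) ^ k / fact k * (pochhammer (of_real b - a) k / pochhammer (of_real b) k)"
      unfolding sum_distrib_left[symmetric] Vandermonde_pochhammer[OF c] ..
    also have "\<dots> = pochhammer (of_real b - a) k / pochhammer (of_real b) k * (- z) ^ k / fact k"
      by (simp add: ac_simps)
    finally show "(\<Sum>i\<le>k. ?f i * ?e (k - i)) = pochhammer (of_real b - a) k / pochhammer (of_real b) k * (- z) ^ k / fact k" .
  qed
  finally have "(\<lambda>k. pochhammer (of_real b - a) k / pochhammer (of_real b) k * (- z) ^ k / fact k)
      sums (hypergeo_1F1 a (of_real b) z * exp (- z))" .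
  from sums_unique2[OF this hypergeo_sums[OF b]] show ?thesis by (simp add: mult.commute)
qed

section \<open>Mellin transform of the Gaussian\<close>

lemma of_real_powr_eq_exp: "u > 0 \<Longrightarrow> complex_of_real u powr z = exp (z * of_real (ln u))"
  by (simp add: powr_def Ln_of_real)

text \<open>The substitution \<open>v = u\<^sup>2 / (2 * t)\<close> turns Euler's integral for
  \<open>Gamma (z / 2)\<close> into \<open>2 * (2 * t) powr (- (z / 2))\<close> times the integral
  sought.\<close>

lemma gaussian_mellin:
  fixes z :: complex
  assumes t: "t > 0" and z: "Re z > 0"
  shows "set_integrable lborel {0<..} (\<lambda>u. of_real u powr (z - 1) * of_real (exp (- u\<^sup>2 / (2 * t))))"
    and "(LINT u:{0<..}|lborel. of_real u powr (z - 1) * of_real (exp (- u\<^sup>2 / (2 * t)))) =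
      of_real (2 * t) powr (z / 2) * Gamma (z / 2) / 2"
proof -
  define f where "f v = complex_of_real v powr (z / 2 - 1) / of_real (exp v)" for v
  define g where "g u = u\<^sup>2 / (2 * t)" for u :: real
  define h where "h u = complex_of_real u powr (z - 1) * of_real (exp (- u\<^sup>2 / (2 * t)))" for u :: real
  have img: "g ` {0<..} = {0<..}"
  proof (intro equalityI subsetI)
    fix v :: real assume "v \<in> {0<..}"
    then have "v = g (sqrt (2 * t * v))" "sqrt (2 * t * v) \<in> {0<..}" using t by (auto simp: g_def)
    then show "v \<in> g ` {0<..}" by blast
  qed (use t in \<open>auto simp: g_def\<close>)
  have inj: "inj_on g {0<..}"
    using t by (auto simp: g_def inj_on_def power2_eq_iff)
  have der: "(g has_field_derivative (u / t)) (at u within {0<..})" for u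
    unfolding g_def using t by (auto intro!: derivative_eq_intros)
  have f: "f absolutely_integrable_on {0<..}" "integral {0<..} f = Gamma (z / 2)"
    unfolding f_def using z absolutely_integrable_Gamma_integral'[of "z / 2"] Gamma_integral_complex'[of "z / 2"]
    by (simp_all add: integral_unique)
  have transform: "\<bar>u / t\<bar> *\<^sub>R f (g u) = (2 * of_real (2 * t) powr (- (z / 2))) * h u" if "u \<in> {0<..}" for u
  proof -
    have u: "u > 0" using that by simp
    have "g u > 0" using u t by (simp add: g_def)
    then have "complex_of_real (g u) powr (z / 2 - 1) = exp ((z / 2 - 1) * of_real (ln (g u)))"
      by (rule of_real_powr_eq_exp)
    also have "ln (g u) = 2 * ln u - ln (2 * t)"
      using u t by (simp add: g_def ln_div ln_realpow)
    also have "exp ((z / 2 - 1) * of_real (2 * ln u - ln (2 * t))) =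
        exp ((z - 1) * of_real (ln u)) * exp (- (z / 2) * of_real (ln (2 * t))) * (exp (of_real (ln (2 * t))) / exp (of_real (ln u)))"
      unfolding exp_diff[symmetric] exp_add[symmetric]
      by (rule arg_cong[where f = exp]) (simp add: field_simps)
    also have "\<dots> = of_real u powr (z - 1) * of_real (2 * t) powr (- (z / 2)) * (of_real (2 * t) / of_real u)"
      using u t by (simp add: of_real_powr_eq_exp exp_of_real del: of_real_mult)
    finally have P: "complex_of_real (g u) powr (z / 2 - 1) =
        of_real u powr (z - 1) * of_real (2 * t) powr (- (z / 2)) * (of_real (2 * t) / of_real u)" .
    have "\<bar>u / t\<bar> *\<^sub>R f (g u) = of_real (u / t) * (of_real (g u) powr (z / 2 - 1) * of_real (exp (- g u)))"
      using u t by (simp add: f_def scaleR_conv_of_real exp_minus inverse_eq_divide)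
    also have "\<dots> = (of_real (u / t) * (of_real (2 * t) / of_real u)) * of_real (2 * t) powr (- (z / 2)) * h u"
    proof -
      have "exp (- g u) = exp (- u\<^sup>2 / (2 * t))" by (simp add: g_def)
      then show ?thesis unfolding P h_def by (simp only: mult_ac)
    qed
    also have "of_real (u / t) * (of_real (2 * t) / of_real u) = (2 :: complex)"
      using u t by simp
    finally show ?thesis .
  qed
  have AI: "(\<lambda>u. \<bar>u / t\<bar> *\<^sub>R f (g u)) absolutely_integrable_on {0<..} \<and>
      integral {0<..} (\<lambda>u. \<bar>u / t\<bar> *\<^sub>R f (g u)) = Gamma (z / 2)"
    using has_absolute_integral_change_of_variables_real[of "{0<..}" g "\<lambda>u. u / t" f "Gamma (z / 2)"] der inj f
    unfolding img by simp
  define c where "c = 2 * complex_of_real (2 * t) powr (- (z / 2))"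
  have c0: "c \<noteq> 0" using t by (simp add: c_def)
  have "set_integrable lebesgue {0<..} (\<lambda>u. \<bar>u / t\<bar> *\<^sub>R f (g u)) \<longleftrightarrow> set_integrable lebesgue {0<..} (\<lambda>u. c * h u)"
    unfolding c_def by (rule set_integrable_cong[OF refl refl transform])
  then have "set_integrable lebesgue {0<..} (\<lambda>u. c * h u)" using AI by blast
  then have L: "set_integrable lebesgue {0<..} h" using c0 by (simp add: set_integrable_mult_right_iff)
  \<comment> \<open>The change of variables lives on the completed measure \<open>lebesgue\<close>;
    Borel measurability of the integrand brings the result back to \<open>lborel\<close>.\<close>
  have hm: "(\<lambda>u. indicator {0<..} u *\<^sub>R h u) \<in> borel_measurable lborel"
    unfolding h_def by measurable
  have B: "set_integrable lborel {0<..} h"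
    using L integrable_completion[OF hm] unfolding set_integrable_def by simp
  then show "set_integrable lborel {0<..} (\<lambda>u. of_real u powr (z - 1) * of_real (exp (- u\<^sup>2 / (2 * t))))"
    unfolding h_def .
  have "c * (LINT u:{0<..}|lborel. h u) = c * (LINT u:{0<..}|lebesgue. h u)"
    unfolding set_lebesgue_integral_def using integral_completion[OF hm] by simp
  also have "\<dots> = (LINT u:{0<..}|lebesgue. c * h u)" by (rule set_integral_mult_right[symmetric])
  also have "\<dots> = (LINT u:{0<..}|lebesgue. \<bar>u / t\<bar> *\<^sub>R f (g u))"
    unfolding c_def
  proof (rule set_lebesgue_integral_cong)
    show "{0 :: real<..} \<in> sets lebesgue" by simp
    show "\<forall>u. u \<in> {0<..} \<longrightarrow> 2 * complex_of_real (2 * t) powr - (z / 2) * h u = \<bar>u / t\<bar> *\<^sub>R f (g u)"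
      by (intro allI impI transform[symmetric])
  qed
  also have "\<dots> = Gamma (z / 2)"
    using set_lebesgue_integral_eq_integral(2)[OF conjunct1[OF AI]] conjunct2[OF AI] by (rule trans)
  finally have "c * (LINT u:{0<..}|lborel. h u) = Gamma (z / 2)" .
  then have "(LINT u:{0<..}|lborel. h u) = Gamma (z / 2) / c" using c0 by (simp only: eq_divide_eq mult.commute) simp
  also have "\<dots> = of_real (2 * t) powr (z / 2) * Gamma (z / 2) / 2"
    unfolding c_def by (simp add: powr_minus_divide)
  finally show "(LINT u:{0<..}|lborel. of_real u powr (z - 1) * of_real (exp (- u\<^sup>2 / (2 * t)))) =
      of_real (2 * t) powr (z / 2) * Gamma (z / 2) / 2"
    unfolding h_def .
qed

subsection \<open>Tilted Gaussian moments\<close>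

lemma complex_powr_add_nat: "u > 0 \<Longrightarrow> complex_of_real u powr (z + of_nat n) = complex_of_real u powr z * of_real u ^ n"
  by (simp add: powr_add powr_nat')

lemma of_real_exp_sums: "(\<lambda>n. complex_of_real v ^ n / fact n) sums of_real (exp v)"
  using exp_converges[of "complex_of_real v"] by (simp add: scaleR_conv_of_real exp_of_real divide_inverse mult.commute)

lemma sum_power_le_exp:
  fixes v :: real
  assumes "v \<ge> 0"
  shows "(\<Sum>n<N. v ^ n / fact n) \<le> exp v"
proof -
  have s: "(\<lambda>n. v ^ n / fact n) sums exp v"
    using exp_converges[of v] by (simp add: divide_inverse mult.commute)
  have "(\<Sum>n<N. v ^ n / fact n) \<le> (\<Sum>n. v ^ n / fact n)"
    using assms by (intro sum_le_suminf sums_summable[OF s]) auto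
  then show ?thesis using sums_unique[OF s] by simp
qed

text \<open>
  Expanding the last factor of the integrand gives Gaussian moments. Completing the square provides
  the bound for the partial sums.
\<close>

lemma tilted_gaussian_expansion:
  fixes p :: complex
  assumes t: "t > 0" and x: "x \<ge> 0" and p: "Re p > -1"
  defines "F \<equiv> \<lambda>y. of_real y powr p * of_real (exp (- y\<^sup>2 / (2 * t))) * of_real (exp (- (x * y / t)))"
  shows "set_integrable lborel {0<..} F"
    and "(\<lambda>n. of_real (- x / t) ^ n / fact n * (of_real (2 * t) powr ((p + of_nat n + 1) / 2) * Gamma ((p + of_nat n + 1) / 2) / 2))
      sums (LINT y:{0<..}|lborel. F y)"
proof -
  define m where "m n y = complex_of_real y powr (p + of_nat n + 1 - 1) * of_real (exp (- y\<^sup>2 / (2 * t)))" for n :: nat and y :: real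
  define a where "a n = complex_of_real (- x / t) ^ n / fact n" for n
  have "Re (p + of_nat n + 1) > 0" for n :: nat using p by simp
  note mellin = gaussian_mellin[OF t this, folded m_def]
  have meas: "(\<lambda>y. indicator {0<..} y *\<^sub>R F y) \<in> borel_measurable lborel"
    unfolding F_def by measurable
  \<comment> \<open>Since \<open>(x - y / 2)\<^sup>2 / t\<close> is nonnegative,
    \<open>x * y / t\<close> is at most \<open>x\<^sup>2 / t + y\<^sup>2 / (4 * t)\<close>. Half of
    the Gaussian exponent is spent on the second summand, and a Gaussian of variance
    \<open>2 * t\<close> is left.\<close>
  define w where "w y = indicator {0<..} y * (y powr Re p * exp (- y\<^sup>2 / (2 * (2 * t)))) * exp (x\<^sup>2 / t)" for y :: real
  have w: "integrable lborel w"
  proof -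
    have "set_integrable lborel {0<..} (\<lambda>u. complex_of_real u powr (p + 1 - 1) * of_real (exp (- u\<^sup>2 / (2 * (2 * t)))))"
      using t p by (intro gaussian_mellin(1)) auto
    then have "integrable lborel (\<lambda>u. cmod (indicator {0<..} u *\<^sub>R (complex_of_real u powr (p + 1 - 1) * of_real (exp (- u\<^sup>2 / (2 * (2 * t)))))))"
      unfolding set_integrable_def by (rule integrable_norm)
    also have "(\<lambda>u. cmod (indicator {0<..} u *\<^sub>R (complex_of_real u powr (p + 1 - 1) * of_real (exp (- u\<^sup>2 / (2 * (2 * t))))))) =
        (\<lambda>u. indicator {0<..} u * (u powr Re p * exp (- u\<^sup>2 / (2 * (2 * t)))))"
      by (rule ext) (simp add: indicator_def norm_mult norm_of_real_powr)
    finally show ?thesis unfolding w_def by (rule integrable_mult_left)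
  qed
  have bound: "y powr Re p * exp (- y\<^sup>2 / (2 * t)) * exp (x * y / t) \<le> w y" if "y > 0" for y
  proof -
    have "x * y / t \<le> x\<^sup>2 / t + y\<^sup>2 / (4 * t)"
    proof -
      have "0 \<le> (x - y / 2)\<^sup>2 / t" using t by simp
      also have "\<dots> = x\<^sup>2 / t + y\<^sup>2 / (4 * t) - x * y / t"
        using t by (simp add: power2_eq_square field_simps)
      finally show ?thesis by simp
    qed
    moreover have "y\<^sup>2 / (2 * t) = y\<^sup>2 / (4 * t) + y\<^sup>2 / (4 * t)" using t by (simp add: field_simps)
    ultimately have "- y\<^sup>2 / (2 * t) + x * y / t \<le> - y\<^sup>2 / (2 * (2 * t)) + x\<^sup>2 / t" by simp
    then have "exp (- y\<^sup>2 / (2 * t) + x * y / t) \<le> exp (- y\<^sup>2 / (2 * (2 * t)) + x\<^sup>2 / t)" by simp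
    then have "y powr Re p * exp (- y\<^sup>2 / (2 * t) + x * y / t) \<le> y powr Re p * exp (- y\<^sup>2 / (2 * (2 * t)) + x\<^sup>2 / t)"
      by (rule mult_left_mono) simp
    then show ?thesis unfolding w_def exp_add using that by (simp only: mult.assoc indicator_simps greaterThan_iff mult_1)
  qed
  define s where "s N y = (\<Sum>n<N. indicator {0<..} y *\<^sub>R (a n * m n y))" for N and y :: real
  have si: "integrable lborel (s N)" "integral\<^sup>L lborel (s N) = (\<Sum>n<N. a n * (LINT y:{0<..}|lborel. m n y))" for N
  proof -
    have i: "integrable lborel (\<lambda>y. indicator {0<..} y *\<^sub>R (a n * m n y))" for n
      using set_integrable_mult_right[OF mellin(1)] unfolding set_integrable_def by simp
    then show "integrable lborel (s N)" unfolding s_def by (intro Bochner_Integration.integrable_sum)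
    have "integral\<^sup>L lborel (s N) = (\<Sum>n<N. LINT y|lborel. indicator {0<..} y *\<^sub>R (a n * m n y))"
      unfolding s_def using i by (intro Bochner_Integration.integral_sum)
    also have "\<dots> = (\<Sum>n<N. a n * (LINT y:{0<..}|lborel. m n y))"
    proof (intro sum.cong refl)
      fix n
      show "(LINT y|lborel. indicator {0<..} y *\<^sub>R (a n * m n y)) = a n * (LINT y:{0<..}|lborel. m n y)"
        using set_integral_mult_right[of lborel "{0<..}" "a n" "m n"] by (simp only: set_lebesgue_integral_def)
    qed
    finally show "integral\<^sup>L lborel (s N) = (\<Sum>n<N. a n * (LINT y:{0<..}|lborel. m n y))"
      by (simp only: set_lebesgue_integral_def)
  qed
  have am: "a n * m n y = of_real y powr p * of_real (exp (- y\<^sup>2 / (2 * t))) * (of_real (- (x * y / t)) ^ n / fact n)"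
    if "y > 0" for n y
  proof -
    have "complex_of_real (- x / t) ^ n * of_real y ^ n = of_real (- (x * y / t)) ^ n"
      by (simp flip: power_mult_distrib)
    then show ?thesis
      unfolding a_def m_def using complex_powr_add_nat[OF that, of p n] by (simp add: mult_ac)
  qed
  have lim: "(\<lambda>N. s N y) \<longlonglongrightarrow> indicator {0<..} y *\<^sub>R F y" for y
  proof (cases "y > 0")
    case True
    have "(\<lambda>n. a n * m n y) sums F y"
      unfolding am[OF True] F_def by (intro sums_mult of_real_exp_sums)
    then show ?thesis using True by (simp add: s_def sums_def)
  qed (simp add: s_def)
  \<comment> \<open>The terms of the expansion alternate in sign and the partial sums need not stay
    below 1, so they are bounded through absolute values by \<open>exp (x * y / t)\<close>.\<close>
  have dom: "cmod (s N y) \<le> w y" for N y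
  proof (cases "y > 0")
    case True
    have "cmod (s N y) \<le> (\<Sum>n<N. cmod (a n * m n y))"
      using True unfolding s_def by (simp add: norm_sum)
    also have "\<dots> = (\<Sum>n<N. y powr Re p * exp (- y\<^sup>2 / (2 * t)) * ((x * y / t) ^ n / fact n))"
    proof (intro sum.cong refl)
      fix n
      have "cmod (of_real (- (x * y / t)) ^ n / fact n) = (x * y / t) ^ n / fact n"
        unfolding norm_divide norm_power norm_of_real using x t True by simp
      then show "cmod (a n * m n y) = y powr Re p * exp (- y\<^sup>2 / (2 * t)) * ((x * y / t) ^ n / fact n)"
        unfolding am[OF True] norm_mult using True by (simp add: norm_of_real_powr)
    qed
    also have "\<dots> \<le> y powr Re p * exp (- y\<^sup>2 / (2 * t)) * exp (x * y / t)"
      unfolding sum_distrib_left[symmetric] using x t True by (intro mult_left_mono sum_power_le_exp) auto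
    also have "\<dots> \<le> w y" by (rule bound[OF True])
    finally show ?thesis .
  qed (simp add: s_def w_def)
  have conv: "(\<lambda>N. integral\<^sup>L lborel (s N)) \<longlonglongrightarrow> (LINT y:{0<..}|lborel. F y)"
    unfolding set_lebesgue_integral_def
    by (rule integral_dominated_convergence[where w = w]) (use meas si(1) w lim dom in auto)
  show "set_integrable lborel {0<..} F"
    unfolding set_integrable_def
    by (rule integrable_dominated_convergence[where w = w and s = s]) (use meas si(1) w lim dom in auto)
  show "(\<lambda>n. of_real (- x / t) ^ n / fact n * (of_real (2 * t) powr ((p + of_nat n + 1) / 2) * Gamma ((p + of_nat n + 1) / 2) / 2))
      sums (LINT y:{0<..}|lborel. F y)"
    using conv unfolding si(2) mellin(2) sums_def a_def .
qed

text \<open>The series is split by the parity of \<open>n\<close>. In the even terms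
  \<open>fact (2 * k) = 4 ^ k * pochhammer (1 / 2) k * fact k\<close> produces the lower parameter
  1/2; in the odd ones \<open>fact (2 * k + 1)\<close> produces 3/2 in the same way. The upper
  parameters come from shifting \<open>Gamma\<close> by \<open>k\<close>.\<close>

lemma tilted_gaussian_mellin:
  fixes p :: complex
  assumes t: "t > 0" and x: "x \<ge> 0" and p: "Re p > -1"
  shows "(LINT y:{0<..}|lborel. of_real y powr p * of_real (exp (- y\<^sup>2 / (2 * t))) * of_real (exp (- (x * y / t)))) =
    of_real (2 * t) powr ((p + 1) / 2) / 2 *
      (Gamma ((p + 1) / 2) * hypergeo_1F1 ((p + 1) / 2) (of_real (1 / 2)) (of_real (x\<^sup>2 / (2 * t)))
       - of_real (x / t * sqrt (2 * t)) * Gamma (p / 2 + 1) * hypergeo_1F1 (p / 2 + 1) (of_real (3 / 2)) (of_real (x\<^sup>2 / (2 * t))))"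
proof -
  define A where "A = (p + 1) / 2"
  define A' where "A' = p / 2 + 1"
  define X where "X = complex_of_real (x\<^sup>2 / (2 * t))"
  define a where "a n = of_real (- x / t) ^ n / fact n * (of_real (2 * t) powr ((p + of_nat n + 1) / 2) * Gamma ((p + of_nat n + 1) / 2) / 2)" for n :: nat
  let ?I = "LINT y:{0<..}|lborel. of_real y powr p * of_real (exp (- y\<^sup>2 / (2 * t))) * of_real (exp (- (x * y / t)))"
  have a: "a sums ?I" unfolding a_def using tilted_gaussian_expansion(2)[OF t x p] .
  have Gpoch: "Gamma (b + of_nat k) = Gamma b * pochhammer b k" if "Re b > 0" for b :: complex and k
  proof -
    have "b \<notin> \<int>\<^sub>\<le>\<^sub>0" using that by (auto elim!: nonpos_Ints_cases)
    then show ?thesis using pochhammer_Gamma[of b k] Gamma_eq_zero_iff[of b] by simp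
  qed
  have xt: "complex_of_real (- x / t) ^ (2 * k) * of_real (2 * t) ^ k = 4 ^ k * X ^ k" for k
  proof -
    have "(- x / t)\<^sup>2 * (2 * t) = 4 * (x\<^sup>2 / (2 * t))" using t by (simp add: power2_eq_square)
    then have "((- x / t)\<^sup>2 * (2 * t)) ^ k = (4 * (x\<^sup>2 / (2 * t))) ^ k" by (simp only:)
    then have "of_real (((- x / t)\<^sup>2 * (2 * t)) ^ k) = complex_of_real ((4 * (x\<^sup>2 / (2 * t))) ^ k)" by (simp only:)
    then show ?thesis unfolding X_def
      by (simp only: power_mult_distrib power_mult of_real_mult of_real_power of_real_numeral)
  qed
  have even: "a (2 * k) = of_real (2 * t) powr A / 2 * Gamma A * (pochhammer A k / pochhammer (of_real (1 / 2)) k * X ^ k / fact k)" for k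
  proof -
    have e: "(p + of_nat (2 * k) + 1) / 2 = A + of_nat k" by (simp add: A_def field_simps)
    have G: "Gamma (A + of_nat k) = Gamma A * pochhammer A k" using p by (intro Gpoch) (simp add: A_def)
    have P: "complex_of_real (2 * t) powr (A + of_nat k) = of_real (2 * t) powr A * of_real (2 * t) ^ k"
      using t by (intro complex_powr_add_nat) simp
    have f: "fact (2 * k) = (4 ^ k * pochhammer (1 / 2) k * fact k :: complex)"
      using fact_double[of k, where 'a = complex] by (simp add: power_mult)
    have "a (2 * k) = (complex_of_real (- x / t) ^ (2 * k) * of_real (2 * t) ^ k) / fact (2 * k) * (of_real (2 * t) powr A * (Gamma A * pochhammer A k) / 2)"
      unfolding a_def e G P by (simp only: mult_ac times_divide_eq_left times_divide_eq_right divide_divide_eq_left)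
    also have "\<dots> = of_real (2 * t) powr A / 2 * Gamma A * (pochhammer A k / pochhammer (of_real (1 / 2)) k * X ^ k / fact k)"
      unfolding xt f by (simp add: mult_ac)
    finally show ?thesis .
  qed
  have odd: "a (2 * k + 1) = - (of_real (2 * t) powr A' / 2 * of_real (x / t) * Gamma A') *
      (pochhammer A' k / pochhammer (of_real (3 / 2)) k * X ^ k / fact k)" for k
  proof -
    have e: "(p + of_nat (2 * k + 1) + 1) / 2 = A' + of_nat k" by (simp add: A'_def field_simps)
    have G: "Gamma (A' + of_nat k) = Gamma A' * pochhammer A' k" using p by (intro Gpoch) (simp add: A'_def)
    have P: "complex_of_real (2 * t) powr (A' + of_nat k) = of_real (2 * t) powr A' * of_real (2 * t) ^ k"
      using t by (intro complex_powr_add_nat) simp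
    have f: "fact (2 * k + 1) = (4 ^ k * pochhammer (3 / 2) k * fact k :: complex)"
    proof -
      have "(1 / 2) * pochhammer (3 / 2) k = (pochhammer (1 / 2) k * (1 / 2 + of_nat k) :: complex)"
        using pochhammer_rec[of "1 / 2 :: complex" k] pochhammer_Suc[of "1 / 2 :: complex" k] by simp
      then have h: "pochhammer (3 / 2) k = (pochhammer (1 / 2) k * (1 + 2 * of_nat k) :: complex)"
        by (simp add: field_simps)
      have "fact (2 * k + 1) = (of_nat (2 * k + 1) * fact (2 * k) :: complex)" by simp
      also have "\<dots> = (1 + 2 * of_nat k) * (4 ^ k * pochhammer (1 / 2) k * fact k)"
        using fact_double[of k, where 'a = complex] by (simp add: power_mult)
      finally show ?thesis unfolding h by (simp only: mult_ac)
    qed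
    have "a (2 * k + 1) = (complex_of_real (- x / t) ^ (2 * k) * of_real (2 * t) ^ k) * complex_of_real (- x / t) / fact (2 * k + 1) * (of_real (2 * t) powr A' * (Gamma A' * pochhammer A' k) / 2)"
      unfolding a_def e G P power_add power_one_right by (simp only: mult_ac times_divide_eq_left times_divide_eq_right divide_divide_eq_left)
    also have "\<dots> = - (of_real (2 * t) powr A' / 2 * of_real (x / t) * Gamma A') *
      (pochhammer A' k / pochhammer (of_real (3 / 2)) k * X ^ k / fact k)"
      unfolding xt f by (simp add: mult_ac)
    finally show ?thesis .
  qed
  have "(\<lambda>k. sum a {k * 2..<k * 2 + 2}) sums ?I" using a by (rule sums_group) simp
  moreover have "sum a {k * 2..<k * 2 + 2} = a (2 * k) + a (2 * k + 1)" for k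
  proof -
    have "{k * 2..<k * 2 + 2} = {2 * k, 2 * k + 1}" by auto
    then show ?thesis by simp
  qed
  ultimately have "(\<lambda>k. a (2 * k) + a (2 * k + 1)) sums ?I" by simp
  moreover have "(\<lambda>k. a (2 * k) + a (2 * k + 1)) sums
      (of_real (2 * t) powr A / 2 * Gamma A * hypergeo_1F1 A (of_real (1 / 2)) X
        + - (of_real (2 * t) powr A' / 2 * of_real (x / t) * Gamma A') * hypergeo_1F1 A' (of_real (3 / 2)) X)"
    unfolding even odd by (intro sums_add sums_mult hypergeo_sums) simp_all
  ultimately have I: "?I = of_real (2 * t) powr A / 2 * Gamma A * hypergeo_1F1 A (of_real (1 / 2)) X
        + - (of_real (2 * t) powr A' / 2 * of_real (x / t) * Gamma A') * hypergeo_1F1 A' (of_real (3 / 2)) X"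
    by (rule sums_unique2)
  have "A' = A + 1 / 2" by (simp add: A_def A'_def field_simps)
  moreover have "complex_of_real (2 * t) powr (1 / 2) = of_real (sqrt (2 * t))"
    using t powr_of_real[of "2 * t" "1 / 2"] by (simp add: powr_half_sqrt)
  ultimately have s: "complex_of_real (2 * t) powr A' = of_real (2 * t) powr A * of_real (sqrt (2 * t))"
    by (simp only: powr_add)
  show ?thesis
    unfolding I s X_def[symmetric] A_def[symmetric] A'_def[symmetric] of_real_mult[of "x / t"]
    by (simp add: right_diff_distrib mult_ac)
qed

subsection \<open>Mellin transform of the expected number of bars\<close>

lemma integral_powr_from_0:
  fixes p :: complex
  assumes p: "Re p > 1" and u: "u \<ge> 0"
  shows "integrable lborel (\<lambda>\<epsilon>. indicator {0..u} \<epsilon> *\<^sub>R complex_of_real \<epsilon> powr (p - 1))"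
    and "(LINT \<epsilon>|lborel. indicator {0..u} \<epsilon> *\<^sub>R complex_of_real \<epsilon> powr (p - 1)) = of_real u powr p / p"
proof -
  have p0: "p \<noteq> 0" using p by auto
  \<comment> \<open>\<open>Re p > 1\<close> makes the integrand continuous up to the end point
    0.\<close>
  have cont: "continuous_on {0..u} (\<lambda>\<epsilon>. complex_of_real \<epsilon> powr (p - 1))"
    using p by (intro continuous_on_powr_complex continuous_intros) auto
  show int: "integrable lborel (\<lambda>\<epsilon>. indicator {0..u} \<epsilon> *\<^sub>R complex_of_real \<epsilon> powr (p - 1))"
    by (rule borel_integrable_compact[OF compact_Icc cont])
  have "((\<lambda>\<epsilon>. complex_of_real \<epsilon> powr (p - 1)) has_integral (of_real u powr p / p - of_real 0 powr p / p)) {0..u}"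
  proof (rule fundamental_theorem_of_calculus_interior[OF u])
    show "continuous_on {0..u} (\<lambda>\<epsilon>. complex_of_real \<epsilon> powr p / p)"
      using p p0 by (intro continuous_on_divide continuous_on_powr_complex continuous_intros) auto
    fix \<epsilon> assume "\<epsilon> \<in> {0<..<u}"
    then have e: "complex_of_real \<epsilon> \<notin> \<real>\<^sub>\<le>\<^sub>0" by auto
    have "((\<lambda>z. z powr p / p) has_field_derivative (complex_of_real \<epsilon> powr (p - 1))) (at (of_real \<epsilon>))"
      using e p0 by (auto intro!: derivative_eq_intros)
    then show "((\<lambda>\<epsilon>. complex_of_real \<epsilon> powr p / p) has_vector_derivative complex_of_real \<epsilon> powr (p - 1)) (at \<epsilon>)"
      by (rule has_vector_derivative_real_field)
  qed
  then have "integral {0..u} (\<lambda>\<epsilon>. complex_of_real \<epsilon> powr (p - 1)) = of_real u powr p / p"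
    by (simp add: integral_unique)
  then show "(LINT \<epsilon>|lborel. indicator {0..u} \<epsilon> *\<^sub>R complex_of_real \<epsilon> powr (p - 1)) = of_real u powr p / p"
    using set_borel_integral_eq_integral(2)[of "{0..u}" "\<lambda>\<epsilon>. complex_of_real \<epsilon> powr (p - 1)"] int
    unfolding set_integrable_def set_lebesgue_integral_def by simp
qed

lemma normal_density_shift:
  assumes "t > 0"
  shows "normal_density 0 (sqrt t) (x + y) =
    exp (- (x\<^sup>2 / (2 * t))) / sqrt (2 * pi * t) * (exp (- y\<^sup>2 / (2 * t)) * exp (- (x * y / t)))"
proof -
  have "- (x + y - 0)\<^sup>2 / (2 * (sqrt t)\<^sup>2) = - (x\<^sup>2 / (2 * t)) + (- y\<^sup>2 / (2 * t) + - (x * y / t))"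
    using assms by (simp add: field_simps power2_eq_square)
  then have "exp (- (x + y - 0)\<^sup>2 / (2 * (sqrt t)\<^sup>2)) =
      exp (- (x\<^sup>2 / (2 * t))) * (exp (- y\<^sup>2 / (2 * t)) * exp (- (x * y / t)))"
    by (simp only: exp_add)
  then show ?thesis using assms unfolding normal_density_def by simp
qed

lemma gauss_tail_eq_integral:
  assumes t: "t > 0"
  shows "integrable lborel (\<lambda>u. indicator {\<epsilon>..} u * normal_density 0 (sqrt t) (x + u))"
    and "gauss_tail t (x + \<epsilon>) = (LINT u|lborel. indicator {\<epsilon>..} u * normal_density 0 (sqrt t) (x + u))"
proof -
  let ?N = "density lborel (\<lambda>x. ennreal (normal_density 0 (sqrt t) x))"
  let ?f = "\<lambda>z. indicator {x + \<epsilon>..} z * normal_density 0 (sqrt t) z"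
  have i: "integrable lborel ?f"
    using integrable_normal_density[of "sqrt t" 0] t
    by (intro integrable_real_mult_indicator[of "{x + \<epsilon>..}" lborel "normal_density 0 (sqrt t)", unfolded mult.commute[of _ "indicator _ _"]]) simp_all
  have s: "?f (x + 1 * u) = indicator {\<epsilon>..} u * normal_density 0 (sqrt t) (x + u)" for u
    by (simp add: indicator_def)
  show "integrable lborel (\<lambda>u. indicator {\<epsilon>..} u * normal_density 0 (sqrt t) (x + u))"
    using lborel_integrable_real_affine[OF i, of 1 x] unfolding s by simp
  have "emeasure ?N {x + \<epsilon>..} = (\<integral>\<^sup>+z. ennreal (normal_density 0 (sqrt t) z) * indicator {x + \<epsilon>..} z \<partial>lborel)"
    by (rule emeasure_density) auto
  also have "\<dots> = (\<integral>\<^sup>+z. ennreal (?f z) \<partial>lborel)"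
    by (intro nn_integral_cong) (simp add: indicator_def)
  also have "\<dots> = ennreal (LINT z|lborel. ?f z)"
    by (rule nn_integral_eq_integral[OF i]) simp
  finally have "gauss_tail t (x + \<epsilon>) = (LINT z|lborel. ?f z)"
    by (simp add: gauss_tail_def measure_def)
  also have "\<dots> = (LINT u|lborel. ?f (x + 1 * u))"
    using lborel_integral_real_affine[of 1 ?f x] by simp
  finally show "gauss_tail t (x + \<epsilon>) = (LINT u|lborel. indicator {\<epsilon>..} u * normal_density 0 (sqrt t) (x + u))"
    unfolding s .
qed

lemma shifted_gaussian_moment_integrable:
  fixes p :: complex
  assumes t: "t > 0" and x: "x \<ge> 0" and p: "Re p > -1"
  shows "set_integrable lborel {0<..} (\<lambda>y. of_real y powr p * of_real (normal_density 0 (sqrt t) (x + y)))"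
    and "(LINT y:{0<..}|lborel. of_real y powr p * of_real (normal_density 0 (sqrt t) (x + y))) =
      of_real (exp (- (x\<^sup>2 / (2 * t))) / sqrt (2 * pi * t)) *
      (LINT y:{0<..}|lborel. of_real y powr p * of_real (exp (- y\<^sup>2 / (2 * t))) * of_real (exp (- (x * y / t))))"
proof -
  let ?c = "complex_of_real (exp (- (x\<^sup>2 / (2 * t))) / sqrt (2 * pi * t))"
  let ?F = "\<lambda>y. of_real y powr p * of_real (exp (- y\<^sup>2 / (2 * t))) * complex_of_real (exp (- (x * y / t)))"
  have eq: "of_real y powr p * of_real (normal_density 0 (sqrt t) (x + y)) = ?c * ?F y" for y
    unfolding normal_density_shift[OF t] of_real_mult by (simp only: mult_ac)
  show "set_integrable lborel {0<..} (\<lambda>y. of_real y powr p * of_real (normal_density 0 (sqrt t) (x + y)))"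
    unfolding eq by (rule set_integrable_mult_right[OF tilted_gaussian_expansion(1)[OF t x p]])
  show "(LINT y:{0<..}|lborel. of_real y powr p * of_real (normal_density 0 (sqrt t) (x + y))) = ?c * (LINT y:{0<..}|lborel. ?F y)"
    unfolding eq by (rule set_integral_mult_right)
qed

text \<open>Fubini over the region \<open>0 < \<epsilon> \<le> u\<close>: integrating the density
  over \<open>u\<close> first gives the tail, integrating \<open>\<epsilon> powr (p - 1)\<close>
  first gives \<open>u powr p / p\<close>.\<close>

lemma gauss_tail_mellin:
  fixes p :: complex
  assumes t: "t > 0" and x: "x \<ge> 0" and p: "Re p > 1"
  shows "integrable lborel (\<lambda>\<epsilon>. indicator {0<..} \<epsilon> *\<^sub>R (complex_of_real \<epsilon> powr (p - 1) * of_real (gauss_tail t (x + \<epsilon>))))"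
    and "(LINT \<epsilon>|lborel. indicator {0<..} \<epsilon> *\<^sub>R (complex_of_real \<epsilon> powr (p - 1) * of_real (gauss_tail t (x + \<epsilon>)))) =
      (LINT y:{0<..}|lborel. of_real y powr p * of_real (normal_density 0 (sqrt t) (x + y))) / p"
proof -
  define \<phi> where "\<phi> u = normal_density 0 (sqrt t) (x + u)" for u
  have \<phi>[measurable]: "\<phi> \<in> borel_measurable borel" unfolding \<phi>_def by measurable
  have \<phi>0: "\<phi> u \<ge> 0" for u by (simp add: \<phi>_def)
  define f where "f u \<epsilon> = (if 0 < \<epsilon> \<and> \<epsilon> \<le> u then complex_of_real \<epsilon> powr (p - 1) * of_real (\<phi> u) else 0)" for u \<epsilon>
  have fm: "case_prod f \<in> borel_measurable (lborel \<Otimes>\<^sub>M lborel)"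
    unfolding f_def by measurable
  \<comment> \<open>The closed interval does no harm at \<epsilon> = 0, because
    \<open>0 powr (p - 1)\<close> is 0.\<close>
  have f_eps: "f u \<epsilon> = of_real (\<phi> u) * (indicator {0..u} \<epsilon> *\<^sub>R complex_of_real \<epsilon> powr (p - 1))" for u \<epsilon>
    by (auto simp: f_def indicator_def)
  have inner: "integrable lborel (f u)" "(LINT \<epsilon>|lborel. f u \<epsilon>) = indicator {0<..} u *\<^sub>R (of_real u powr p * of_real (\<phi> u)) / p" for u
  proof -
    have "integrable lborel (f u) \<and> (LINT \<epsilon>|lborel. f u \<epsilon>) = indicator {0<..} u *\<^sub>R (of_real u powr p * of_real (\<phi> u)) / p"
    proof (cases "u > 0")
      case True
      then have "u \<ge> 0" by simp
      note i = integral_powr_from_0[OF p this]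
      have "f u = (\<lambda>\<epsilon>. of_real (\<phi> u) * (indicator {0..u} \<epsilon> *\<^sub>R complex_of_real \<epsilon> powr (p - 1)))"
        by (rule ext) (rule f_eps)
      then have "integrable lborel (f u)" "(LINT \<epsilon>|lborel. f u \<epsilon>) = of_real (\<phi> u) * (of_real u powr p / p)"
        using i(1) by (simp_all only: integrable_mult_right integral_mult_right_zero i(2))
      then show ?thesis using True by simp
    next
      case False
      then have "f u = (\<lambda>_. 0)" by (auto simp: f_def)
      then show ?thesis using False by simp
    qed
    then show "integrable lborel (f u)" "(LINT \<epsilon>|lborel. f u \<epsilon>) = indicator {0<..} u *\<^sub>R (of_real u powr p * of_real (\<phi> u)) / p"
      by blast+
  qed
  \<comment> \<open>Taking norms replaces \<open>p\<close> by \<open>Re p\<close>, so the inner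
    integral is given by the same formula; this yields the absolute integrability for
    Fubini.\<close>
  have norm_inner: "(LINT \<epsilon>|lborel. cmod (f u \<epsilon>)) = cmod (indicator {0<..} u *\<^sub>R (of_real u powr of_real (Re p) * of_real (\<phi> u))) / Re p" for u
  proof (cases "u > 0")
    case True
    have "Re (of_real (Re p)) > 1" "u \<ge> 0" using p True by auto
    note i = integral_powr_from_0[OF this]
    have n: "complex_of_real (cmod (f u \<epsilon>)) = of_real (\<phi> u) * (indicator {0..u} \<epsilon> *\<^sub>R complex_of_real \<epsilon> powr (of_real (Re p) - 1))" for \<epsilon>
    proof (cases "\<epsilon> > 0")
      case True
      have "complex_of_real \<epsilon> powr (of_real (Re p) - 1) = of_real (\<epsilon> powr (Re p - 1))"
        using powr_of_real[of \<epsilon> "Re p - 1"] True by simp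
      then show ?thesis
        using True \<phi>0[of u] by (simp add: f_eps norm_mult norm_of_real_powr indicator_def)
    next
      case False
      then show ?thesis by (simp add: f_def indicator_def)
    qed
    have "complex_of_real (LINT \<epsilon>|lborel. cmod (f u \<epsilon>)) = (LINT \<epsilon>|lborel. complex_of_real (cmod (f u \<epsilon>)))"
      by simp
    also have "\<dots> = of_real (\<phi> u) * (of_real u powr of_real (Re p) / of_real (Re p))"
      unfolding n by (simp only: integral_mult_right_zero i(2))
    also have "\<dots> = of_real (\<phi> u * (u powr Re p / Re p))"
      using powr_of_real[of u "Re p"] True by simp
    finally have "(LINT \<epsilon>|lborel. cmod (f u \<epsilon>)) = \<phi> u * (u powr Re p / Re p)" by (simp only: of_real_eq_iff)
    then show ?thesis using True \<phi>0[of u] by (simp add: norm_mult norm_of_real_powr)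
  next
    case False
    then have "f u = (\<lambda>_. 0)" by (auto simp: f_def)
    then show ?thesis using False by simp
  qed
  have "integrable lborel (\<lambda>u. cmod (indicator {0<..} u *\<^sub>R (of_real u powr of_real (Re p) * of_real (\<phi> u))) / Re p)"
    using shifted_gaussian_moment_integrable(1)[OF t x, of "of_real (Re p)"] p
    unfolding set_integrable_def \<phi>_def by (intro integrable_divide integrable_norm) auto
  then have F: "integrable (lborel \<Otimes>\<^sub>M lborel) (case_prod f)"
    using fm inner(1) by (intro lborel_pair.Fubini_integrable) (simp_all add: norm_inner)
  have outer: "(LINT u|lborel. f u \<epsilon>) = indicator {0<..} \<epsilon> *\<^sub>R (complex_of_real \<epsilon> powr (p - 1) * of_real (gauss_tail t (x + \<epsilon>)))" for \<epsilon>
  proof -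
    have "f u \<epsilon> = (indicator {0<..} \<epsilon> *\<^sub>R complex_of_real \<epsilon> powr (p - 1)) * of_real (indicator {\<epsilon>..} u * \<phi> u)" for u
      by (auto simp: f_def indicator_def)
    then have "(LINT u|lborel. f u \<epsilon>) = (indicator {0<..} \<epsilon> *\<^sub>R complex_of_real \<epsilon> powr (p - 1)) * of_real (LINT u|lborel. indicator {\<epsilon>..} u * \<phi> u)"
      by (simp only: integral_mult_right_zero integral_complex_of_real)
    then show ?thesis using gauss_tail_eq_integral(2)[OF t, of x \<epsilon>] by (simp add: \<phi>_def)
  qed
  show "integrable lborel (\<lambda>\<epsilon>. indicator {0<..} \<epsilon> *\<^sub>R (complex_of_real \<epsilon> powr (p - 1) * of_real (gauss_tail t (x + \<epsilon>))))"
    using lborel_pair.integrable_snd[OF F] unfolding outer .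
  have "(LINT \<epsilon>|lborel. (LINT u|lborel. f u \<epsilon>)) = (LINT u|lborel. (LINT \<epsilon>|lborel. f u \<epsilon>))"
    by (rule lborel_pair.Fubini_integral[OF F])
  then show "(LINT \<epsilon>|lborel. indicator {0<..} \<epsilon> *\<^sub>R (complex_of_real \<epsilon> powr (p - 1) * of_real (gauss_tail t (x + \<epsilon>)))) =
      (LINT y:{0<..}|lborel. of_real y powr p * of_real (normal_density 0 (sqrt t) (x + y))) / p"
    unfolding outer inner(2) set_lebesgue_integral_def \<phi>_def by simp
qed

lemma gauss_tail_nonneg: "gauss_tail t y \<ge> 0"
  by (simp add: gauss_tail_def)

lemma gauss_tail_measurable: "t > 0 \<Longrightarrow> gauss_tail t \<in> borel_measurable borel"
  using isCont_gauss_tail by (intro borel_measurable_continuous_onI continuous_at_imp_continuous_on) blast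

text \<open>Strict positivity serves the divergence for \<open>Re p \<le> 1\<close>: an infinite
  series times an integral equal to 0 would be 0 in \<open>ennreal\<close>.\<close>

lemma gauss_tail_pos:
  assumes t: "t > 0"
  shows "gauss_tail t y > 0"
proof (rule ccontr)
  let ?N = "density lborel (\<lambda>x. ennreal (normal_density 0 (sqrt t) x))"
  interpret N: prob_space ?N using t by (intro prob_space_normal_density) simp
  assume "\<not> gauss_tail t y > 0"
  then have "gauss_tail t y = 0" using gauss_tail_nonneg[of t y] by linarith
  then have "measure ?N {y..} = 0" by (simp only: gauss_tail_def)
  then have "emeasure ?N {y..} = 0" by (simp add: N.emeasure_eq_measure)
  then have "{y..} \<in> null_sets ?N" by (intro null_setsI) auto
  then have "AE x in lborel. x \<in> {y..} \<longrightarrow> ennreal (normal_density 0 (sqrt t) x) = 0"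
    using null_sets_density_iff[of "\<lambda>x. ennreal (normal_density 0 (sqrt t) x)" lborel "{y..}"] by simp
  moreover have "ennreal (normal_density 0 (sqrt t) x) \<noteq> 0" for x
    using normal_density_pos[of "sqrt t" 0 x] t by (simp add: ennreal_eq_0_iff)
  ultimately have "AE x in lborel. x \<notin> {y..}" by (auto elim: eventually_mono)
  then have "{y..} \<in> null_sets lborel" by (subst (asm) AE_iff_null_sets[symmetric]) auto
  then have "{y..y + 1} \<in> null_sets lborel" by (rule null_sets_subset) auto
  then have "emeasure lborel {y..y + 1} = 0" by (rule null_setsD1)
  then show False by simp
qed

text \<open>A Chebyshev bound from the second moment. Quadratic decay is enough to sum the tails
  over the odd multiples of \<epsilon>.\<close>

lemma gauss_tail_le:
  assumes t: "t > 0" and x: "x \<ge> 0"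
  shows "\<exists>C. \<forall>s>0. gauss_tail t (x + s) \<le> C / s\<^sup>2"
proof -
  define \<phi> where "\<phi> u = normal_density 0 (sqrt t) (x + u)" for u
  have "set_integrable lborel {0<..} (\<lambda>y. complex_of_real y powr 2 * of_real (\<phi> y))"
    unfolding \<phi>_def by (rule shifted_gaussian_moment_integrable(1)[OF t x]) simp
  then have "integrable lborel (\<lambda>y. cmod (indicator {0<..} y *\<^sub>R (complex_of_real y powr 2 * of_real (\<phi> y))))"
    unfolding set_integrable_def by (rule integrable_norm)
  moreover have "cmod (indicator {0<..} y *\<^sub>R (complex_of_real y powr 2 * of_real (\<phi> y))) = indicator {0<..} y * (y\<^sup>2 * \<phi> y)" for y
    by (simp add: norm_mult norm_power indicator_def \<phi>_def)
  ultimately have i: "integrable lborel (\<lambda>y. indicator {0<..} y * (y\<^sup>2 * \<phi> y))" by (simp only:)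
  have "gauss_tail t (x + s) \<le> (LINT y|lborel. indicator {0<..} y * (y\<^sup>2 * \<phi> y)) / s\<^sup>2" if s: "s > 0" for s
  proof -
    have "s\<^sup>2 * gauss_tail t (x + s) = (LINT u|lborel. s\<^sup>2 * (indicator {s..} u * \<phi> u))"
      using gauss_tail_eq_integral(2)[OF t, of x s] by (simp add: \<phi>_def)
    also have "\<dots> \<le> (LINT y|lborel. indicator {0<..} y * (y\<^sup>2 * \<phi> y))"
    proof (rule integral_mono[OF _ i])
      show "integrable lborel (\<lambda>u. s\<^sup>2 * (indicator {s..} u * \<phi> u))"
        using gauss_tail_eq_integral(1)[OF t, of s x] unfolding \<phi>_def by (intro integrable_mult_right)
      show "s\<^sup>2 * (indicator {s..} u * \<phi> u) \<le> indicator {0<..} u * (u\<^sup>2 * \<phi> u)" for u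
      proof (cases "u \<ge> s")
        case True
        then have "s\<^sup>2 \<le> u\<^sup>2" using s by (intro power_mono) auto
        then show ?thesis using True s by (simp add: \<phi>_def mult_right_mono)
      qed (simp add: indicator_def \<phi>_def)
    qed
    finally show ?thesis using s by (simp add: field_simps)
  qed
  then show ?thesis by blast
qed

section \<open>The sum of the tails and its Mellin transform\<close>

definition bar_count :: "real \<Rightarrow> real \<Rightarrow> real \<Rightarrow> real" where
  "bar_count t x \<epsilon> = (\<Sum>k. 2 * gauss_tail t (x + real (2 * k + 1) * \<epsilon>))"

lemma bar_count_sums:
  assumes t: "t > 0" and x: "x \<ge> 0" and \<epsilon>: "\<epsilon> > 0"
  shows "(\<lambda>k. 2 * gauss_tail t (x + real (2 * k + 1) * \<epsilon>)) sums bar_count t x \<epsilon>"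
proof -
  from gauss_tail_le[OF t x] obtain C where C: "\<And>s. s > 0 \<Longrightarrow> gauss_tail t (x + s) \<le> C / s\<^sup>2" by blast
  have C0: "C \<ge> 0" using C[of 1] gauss_tail_nonneg[of t "x + 1"] by simp
  have "summable (\<lambda>n. inverse (real n ^ 2))" by (rule inverse_power_summable) simp
  then have "summable (\<lambda>k. inverse (real (k + 1) ^ 2))" by (rule summable_ignore_initial_segment)
  then have S: "summable (\<lambda>k. 2 * C / \<epsilon>\<^sup>2 * inverse (real (k + 1) ^ 2))" by (rule summable_mult)
  have B: "norm (2 * gauss_tail t (x + real (2 * k + 1) * \<epsilon>)) \<le> 2 * C / \<epsilon>\<^sup>2 * inverse (real (k + 1) ^ 2)" for k
  proof -
    have "gauss_tail t (x + real (2 * k + 1) * \<epsilon>) \<le> C / (real (2 * k + 1) * \<epsilon>)\<^sup>2"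
      using \<epsilon> by (intro C) simp
    also have "\<dots> \<le> C / (real (k + 1) * \<epsilon>)\<^sup>2"
      using \<epsilon> C0
      by (intro divide_left_mono power_mono mult_right_mono mult_pos_pos zero_less_power) (simp_all add: add_pos_nonneg)
    also have "\<dots> = C / \<epsilon>\<^sup>2 * inverse (real (k + 1) ^ 2)"
      by (simp only: power_mult_distrib inverse_eq_divide times_divide_times_eq mult_1_right mult.commute)
    finally show ?thesis using gauss_tail_nonneg by simp
  qed
  have "summable (\<lambda>k. 2 * gauss_tail t (x + real (2 * k + 1) * \<epsilon>))"
    by (rule summable_comparison_test'[OF S, of 0]) (rule B)
  then show ?thesis unfolding bar_count_def by (rule summable_sums)
qed

lemma bar_count_ennreal:
  assumes "t > 0" "x \<ge> 0" "\<epsilon> > 0"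
  shows "(\<Sum>k. ennreal (2 * gauss_tail t (x + real (2 * k + 1) * \<epsilon>))) = ennreal (bar_count t x \<epsilon>)"
  using bar_count_sums[OF assms] gauss_tail_nonneg
  by (intro suminf_ennreal_eq) auto

lemma bar_count_nonneg: "t > 0 \<Longrightarrow> x \<ge> 0 \<Longrightarrow> \<epsilon> > 0 \<Longrightarrow> bar_count t x \<epsilon> \<ge> 0"
  using sums_le[OF _ sums_zero bar_count_sums] gauss_tail_nonneg by simp

text \<open>Tonelli; scaling turns the \<open>k\<close>-th term into \<open>(2 k + 1) powr (- \<sigma>)\<close> times a constant.\<close>

lemma nn_integral_bar_count:
  fixes \<sigma> :: real
  assumes t: "t > 0" and x: "x \<ge> 0"
  shows "(\<integral>\<^sup>+\<epsilon>. indicator {0<..} \<epsilon> * ennreal (\<epsilon> powr (\<sigma> - 1) * bar_count t x \<epsilon>) \<partial>lborel) =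
    (\<Sum>k. ennreal (real (2 * k + 1) powr (- \<sigma>))) *
    (\<integral>\<^sup>+\<epsilon>. indicator {0<..} \<epsilon> * ennreal (\<epsilon> powr (\<sigma> - 1) * (2 * gauss_tail t (x + \<epsilon>))) \<partial>lborel)"
proof -
  define h where "h \<epsilon> = indicator {0<..} \<epsilon> * ennreal (\<epsilon> powr (\<sigma> - 1) * (2 * gauss_tail t (x + \<epsilon>)))" for \<epsilon>
  have gm[measurable]: "gauss_tail t \<in> borel_measurable borel" using t by (rule gauss_tail_measurable)
  have hm: "h \<in> borel_measurable borel" unfolding h_def by measurable
  let ?g = "\<lambda>k \<epsilon>. indicator {0<..} \<epsilon> * (ennreal (\<epsilon> powr (\<sigma> - 1)) * ennreal (2 * gauss_tail t (x + real (2 * k + 1) * \<epsilon>)))"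
  \<comment> \<open>The weight contributes the exponent \<open>1 - \<sigma>\<close> of
    \<open>2 * k + 1\<close>; the Jacobian of the later change of variable lowers it to
    \<open>- \<sigma>\<close>.\<close>
  have g: "?g k \<epsilon> = ennreal (real (2 * k + 1) powr (1 - \<sigma>)) * h (0 + real (2 * k + 1) * \<epsilon>)" for k \<epsilon>
  proof (cases "\<epsilon> > 0")
    case True
    have "\<epsilon> powr (\<sigma> - 1) = real (2 * k + 1) powr (1 - \<sigma>) * (real (2 * k + 1) * \<epsilon>) powr (\<sigma> - 1)"
      using True by (simp add: powr_mult flip: mult.assoc powr_add)
    then show ?thesis
      using True gauss_tail_nonneg by (simp add: h_def ennreal_mult mult.assoc)
  next
    case False
    then have "\<not> real (2 * k + 1) * \<epsilon> > 0" by (simp add: zero_less_mult_iff)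
    then show ?thesis using False by (simp add: h_def)
  qed
  have "indicator {0<..} \<epsilon> * ennreal (\<epsilon> powr (\<sigma> - 1) * bar_count t x \<epsilon>) = (\<Sum>k. ?g k \<epsilon>)" for \<epsilon>
  proof (cases "\<epsilon> > 0")
    case True
    have "ennreal (\<epsilon> powr (\<sigma> - 1) * bar_count t x \<epsilon>) = ennreal (\<epsilon> powr (\<sigma> - 1)) * (\<Sum>k. ennreal (2 * gauss_tail t (x + real (2 * k + 1) * \<epsilon>)))"
      unfolding bar_count_ennreal[OF t x True] by (rule ennreal_mult) (use bar_count_nonneg[OF t x True] in auto)
    then show ?thesis using True by simp
  qed simp
  then have "(\<integral>\<^sup>+\<epsilon>. indicator {0<..} \<epsilon> * ennreal (\<epsilon> powr (\<sigma> - 1) * bar_count t x \<epsilon>) \<partial>lborel) = (\<integral>\<^sup>+\<epsilon>. (\<Sum>k. ?g k \<epsilon>) \<partial>lborel)"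
    by (simp only:)
  also have "\<dots> = (\<Sum>k. \<integral>\<^sup>+\<epsilon>. ?g k \<epsilon> \<partial>lborel)"
  proof (rule nn_integral_suminf)
    fix k :: nat
    have "(\<lambda>\<epsilon>. gauss_tail t (x + real (2 * k + 1) * \<epsilon>)) \<in> borel_measurable lborel"
      by (rule measurable_compose[OF _ gm]) measurable
    then show "?g k \<in> borel_measurable lborel" by measurable
  qed
  also have "\<dots> = (\<Sum>k. ennreal (real (2 * k + 1) powr (- \<sigma>)) * (\<integral>\<^sup>+\<epsilon>. h \<epsilon> \<partial>lborel))"
  proof (rule suminf_cong)
    fix k
    have c: "real (2 * k + 1) \<noteq> 0" by simp
    have hk: "(\<lambda>\<epsilon>. h (0 + real (2 * k + 1) * \<epsilon>)) \<in> borel_measurable lborel" using hm by measurable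
    have "(\<integral>\<^sup>+\<epsilon>. ?g k \<epsilon> \<partial>lborel) = ennreal (real (2 * k + 1) powr (1 - \<sigma>)) * (\<integral>\<^sup>+\<epsilon>. h (0 + real (2 * k + 1) * \<epsilon>) \<partial>lborel)"
      unfolding g by (rule nn_integral_cmult[OF hk])
    also have "real (2 * k + 1) powr (1 - \<sigma>) = real (2 * k + 1) powr (- \<sigma>) * real (2 * k + 1)"
      by (simp add: powr_diff powr_minus field_simps)
    also have "ennreal (real (2 * k + 1) powr (- \<sigma>) * real (2 * k + 1)) * (\<integral>\<^sup>+\<epsilon>. h (0 + real (2 * k + 1) * \<epsilon>) \<partial>lborel)
        = ennreal (real (2 * k + 1) powr (- \<sigma>)) * (ennreal \<bar>real (2 * k + 1)\<bar> * (\<integral>\<^sup>+\<epsilon>. h (0 + real (2 * k + 1) * \<epsilon>) \<partial>lborel))"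
      by (simp add: ennreal_mult mult.assoc del: of_nat_mult of_nat_add of_nat_Suc)
    also have "\<dots> = ennreal (real (2 * k + 1) powr (- \<sigma>)) * (\<integral>\<^sup>+\<epsilon>. h \<epsilon> \<partial>lborel)"
      unfolding nn_integral_real_affine[OF hm c, of 0] ..
    finally show "(\<integral>\<^sup>+\<epsilon>. ?g k \<epsilon> \<partial>lborel) = ennreal (real (2 * k + 1) powr (- \<sigma>)) * (\<integral>\<^sup>+\<epsilon>. h \<epsilon> \<partial>lborel)" .
  qed
  also have "\<dots> = (\<Sum>k. ennreal (real (2 * k + 1) powr (- \<sigma>))) * (\<integral>\<^sup>+\<epsilon>. h \<epsilon> \<partial>lborel)"
    by (rule ennreal_suminf_multc)
  finally show ?thesis unfolding h_def .
qed

lemma odd_zeta_sums: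
  assumes "Re p > 1"
  shows "(\<lambda>k. of_nat (2 * k + 1) powr (- p)) sums ((1 - 2 powr (- p)) * riemann_zeta p)"
proof -
  define f where "f n = (of_nat (Suc n) :: complex) powr (- p)" for n
  have f: "f sums riemann_zeta p"
    using riemann_zeta_sums[OF assms] by (simp add: f_def[abs_def] powr_minus_divide)
  have "(\<lambda>k. sum f {k * 2..<k * 2 + 2}) sums riemann_zeta p" using f by (rule sums_group) simp
  moreover have "sum f {k * 2..<k * 2 + 2} = f (2 * k) + f (2 * k + 1)" for k
  proof -
    have "{k * 2..<k * 2 + 2} = {2 * k, 2 * k + 1}" by auto
    then show ?thesis by simp
  qed
  ultimately have s: "(\<lambda>k. f (2 * k) + f (2 * k + 1)) sums riemann_zeta p" by simp
  \<comment> \<open>\<open>f\<close> is shifted by one, so its odd indices \<open>2 * k + 1\<close>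
    stand for the even integers \<open>2 * (k + 1)\<close>.\<close>
  have "f (2 * k + 1) = 2 powr (- p) * f k" for k
  proof -
    have "complex_of_real (2 * real (Suc k)) powr (- p) = complex_of_real 2 powr (- p) * complex_of_real (real (Suc k)) powr (- p)"
      unfolding of_real_mult by (rule powr_times_real) simp_all
    moreover have "2 * real (Suc k) = real (Suc (2 * k + 1))" by simp
    ultimately show ?thesis unfolding f_def by (simp only: of_real_of_nat_eq of_real_numeral)
  qed
  then have "(\<lambda>k. f (2 * k + 1)) sums (2 powr (- p) * riemann_zeta p)"
    using sums_mult[OF f, of "2 powr (- p)"] by simp
  from sums_diff[OF s this] have "(\<lambda>k. f (2 * k)) sums (riemann_zeta p - 2 powr (- p) * riemann_zeta p)" by simp
  then show ?thesis by (simp add: f_def left_diff_distrib)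
qed

text \<open>Kummer's transformation absorbs the factor \<open>exp (- (x\<^sup>2 / (2 * t)))\<close>
  of the shifted density and reverses the sign of the argument. The constant
  \<open>1 / sqrt pi\<close> is \<open>sqrt (2 * t) / sqrt (2 * pi * t)\<close>, the numerator being
  split off from the exponent \<open>(p + 1) / 2\<close>.\<close>

lemma shifted_gaussian_moment:
  fixes p :: complex
  assumes t: "t > 0" and x: "x > 0" and p: "Re p > 1"
  shows "2 * (LINT y:{0<..}|lborel. of_real y powr p * of_real (normal_density 0 (sqrt t) (x + y))) =
    of_real (2 * t) powr (p / 2) / of_real (sqrt pi) *
      (Gamma ((p + 1) / 2) * hypergeo_1F1 (- p / 2) (1 / 2) (of_real (- (x\<^sup>2) / (2 * t)))
       - of_real (sqrt (2 * x\<^sup>2 / t)) * Gamma (p / 2 + 1) * hypergeo_1F1 ((1 - p) / 2) (3 / 2) (of_real (- (x\<^sup>2) / (2 * t))))"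
proof -
  define X where "X = complex_of_real (x\<^sup>2 / (2 * t))"
  have X: "complex_of_real (- (x\<^sup>2) / (2 * t)) = - X" by (simp add: X_def)
  have K1: "exp (- X) * hypergeo_1F1 ((p + 1) / 2) (of_real (1 / 2)) X = hypergeo_1F1 (- p / 2) (1 / 2) (- X)"
  proof -
    have "complex_of_real (1 / 2) - (p + 1) / 2 = - p / 2" "complex_of_real (1 / 2) = 1 / 2" by (simp_all add: field_simps)
    then show ?thesis using hypergeo_kummer[of "1 / 2" X "(p + 1) / 2"] by (simp only: zero_less_divide_1_iff zero_less_numeral)
  qed
  have K2: "exp (- X) * hypergeo_1F1 (p / 2 + 1) (of_real (3 / 2)) X = hypergeo_1F1 ((1 - p) / 2) (3 / 2) (- X)"
  proof -
    have "complex_of_real (3 / 2) - (p / 2 + 1) = (1 - p) / 2" "complex_of_real (3 / 2) = 3 / 2" by (simp_all add: field_simps)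
    moreover have "(3 / 2 :: real) > 0" by simp
    ultimately show ?thesis using hypergeo_kummer[of "3 / 2" X "p / 2 + 1"] by (simp only:)
  qed
  have r: "x / t * sqrt (2 * t) = sqrt (2 * x\<^sup>2 / t)"
  proof (rule real_sqrt_unique[symmetric])
    show "(x / t * sqrt (2 * t))\<^sup>2 = 2 * x\<^sup>2 / t"
      using t by (simp add: power_mult_distrib power_divide) (simp add: power2_eq_square)
  qed (use t x in simp)
  have c: "complex_of_real (exp (- (x\<^sup>2 / (2 * t))) / sqrt (2 * pi * t)) * of_real (2 * t) powr ((p + 1) / 2) =
      exp (- X) * (of_real (2 * t) powr (p / 2) / of_real (sqrt pi))"
  proof -
    have "(p + 1) / 2 = p / 2 + of_real (1 / 2)" by (simp add: field_simps)
    then have "complex_of_real (2 * t) powr ((p + 1) / 2) = of_real (2 * t) powr (p / 2) * of_real (2 * t) powr of_real (1 / 2)"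
      by (simp only: powr_add)
    also have "complex_of_real (2 * t) powr of_real (1 / 2) = of_real (sqrt (2 * t))"
      using t powr_of_real[of "2 * t" "1 / 2"] by (simp add: powr_half_sqrt)
    finally have P: "complex_of_real (2 * t) powr ((p + 1) / 2) = of_real (2 * t) powr (p / 2) * of_real (sqrt (2 * t))" .
    have "sqrt (2 * pi * t) = sqrt pi * sqrt (2 * t)" by (simp add: real_sqrt_mult)
    then have "sqrt (2 * t) / sqrt (2 * pi * t) = 1 / sqrt pi" using t by simp
    then have Q: "complex_of_real (sqrt (2 * t)) / of_real (sqrt (2 * pi * t)) = 1 / of_real (sqrt pi)"
      by (metis of_real_1 of_real_divide)
    have E: "complex_of_real (exp (- (x\<^sup>2 / (2 * t)))) = exp (- X)"
      by (simp only: X_def of_real_minus[symmetric] exp_of_real)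
    have "complex_of_real (exp (- (x\<^sup>2 / (2 * t))) / sqrt (2 * pi * t)) * of_real (2 * t) powr ((p + 1) / 2) =
        exp (- X) * of_real (2 * t) powr (p / 2) * (complex_of_real (sqrt (2 * t)) / of_real (sqrt (2 * pi * t)))"
      unfolding P of_real_divide E by (simp only: times_divide_eq_left times_divide_eq_right mult_ac)
    then show ?thesis unfolding Q by simp
  qed
  have "2 * (LINT y:{0<..}|lborel. of_real y powr p * of_real (normal_density 0 (sqrt t) (x + y))) =
      (complex_of_real (exp (- (x\<^sup>2 / (2 * t))) / sqrt (2 * pi * t)) * of_real (2 * t) powr ((p + 1) / 2)) *
      (Gamma ((p + 1) / 2) * hypergeo_1F1 ((p + 1) / 2) (of_real (1 / 2)) X
       - of_real (sqrt (2 * x\<^sup>2 / t)) * Gamma (p / 2 + 1) * hypergeo_1F1 (p / 2 + 1) (of_real (3 / 2)) X)"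
  proof -
    have 1: "x \<ge> 0" "Re p > -1" using x p by auto
    show ?thesis
      unfolding shifted_gaussian_moment_integrable(2)[OF t 1] tilted_gaussian_mellin[OF t 1] r X_def by simp
  qed
  also have "\<dots> = of_real (2 * t) powr (p / 2) / of_real (sqrt pi) *
      (Gamma ((p + 1) / 2) * (exp (- X) * hypergeo_1F1 ((p + 1) / 2) (of_real (1 / 2)) X)
       - of_real (sqrt (2 * x\<^sup>2 / t)) * Gamma (p / 2 + 1) * (exp (- X) * hypergeo_1F1 (p / 2 + 1) (of_real (3 / 2)) X))"
    unfolding c right_diff_distrib by (simp only: mult_ac)
  finally show ?thesis unfolding K1 K2 X .
qed

text \<open>Legendre's duplication formula at \<open>(p + 1) / 2\<close> writes
  \<open>Gamma (p + 1)\<close> as \<open>2 powr p / sqrt pi\<close> times the product of the two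
  \<open>Gamma\<close> values, each of which cancels one denominator. The powers of 2 combine to
  \<open>(1 - 2 powr (- p)) * 2 powr (p / 2)\<close>.\<close>

lemma closed_form_eq:
  fixes p F1 F2 r Z :: complex
  assumes t: "t > 0" and p: "Re p > 1"
  shows "2 powr (- (3 * p / 2)) * (2 powr p - 1) * of_real t powr (p / 2) * Z * Gamma (p + 1)
      * (F1 / Gamma (p / 2 + 1) - r * F2 / Gamma ((p + 1) / 2)) =
    (1 - 2 powr (- p)) * Z * (of_real (2 * t) powr (p / 2) / of_real (sqrt pi) *
      (Gamma ((p + 1) / 2) * F1 - r * Gamma (p / 2 + 1) * F2))"
proof -
  let ?a = "Gamma ((p + 1) / 2)" and ?b = "Gamma (p / 2 + 1)"
  have np: "z \<notin> \<int>\<^sub>\<le>\<^sub>0" if "Re z > 0" for z :: complex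
    using that by (auto elim!: nonpos_Ints_cases)
  have ab: "?a \<noteq> 0" "?b \<noteq> 0"
    unfolding Gamma_eq_zero_iff using p by (auto intro!: np)
  have "?a * Gamma ((p + 1) / 2 + 1 / 2) = exp ((1 - 2 * ((p + 1) / 2)) * of_real (ln 2)) * of_real (sqrt pi) * Gamma (2 * ((p + 1) / 2))"
    by (rule Gamma_legendre_duplication; rule np) (use p in \<open>simp_all add: add_pos_pos\<close>)
  moreover have "(p + 1) / 2 + 1 / 2 = p / 2 + 1" "2 * ((p + 1) / 2) = p + 1" "1 - 2 * ((p + 1) / 2) = - p"
    by (simp_all add: field_simps)
  ultimately have "?a * ?b = exp (- p * of_real (ln 2)) * of_real (sqrt pi) * Gamma (p + 1)" by (simp only:)
  moreover have two: "2 powr z = exp (z * of_real (ln 2))" for z :: complex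
    using of_real_powr_eq_exp[of 2 z] by simp
  ultimately have ab': "?a * ?b = 2 powr (- p) * of_real (sqrt pi) * Gamma (p + 1)" by simp
  have inv: "2 powr p * 2 powr (- p) = (1 :: complex)" by (simp flip: powr_add)
  have G: "Gamma (p + 1) = 2 powr p * (?a * ?b) / of_real (sqrt pi)"
  proof -
    have "2 powr p * (?a * ?b) = (2 powr p * 2 powr (- p)) * of_real (sqrt pi) * Gamma (p + 1)"
      unfolding ab' by (simp only: mult_ac)
    then show ?thesis unfolding inv by simp
  qed
  have D: "?a * ?b * (F1 / ?b - r * F2 / ?a) = ?a * F1 - r * ?b * F2"
    using ab by (simp add: field_simps)
  have T: "complex_of_real (2 * t) powr (p / 2) = 2 powr (p / 2) * of_real t powr (p / 2)"
    unfolding of_real_mult using powr_times_real[of "of_real 2" "of_real t" "p / 2"] t by simp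
  have P: "2 powr (- (3 * p / 2)) * (2 powr p - 1) * 2 powr p = (1 - 2 powr (- p)) * 2 powr (p / 2)"
  proof -
    have "2 powr (- (3 * p / 2)) * 2 powr p * 2 powr p = (2 powr (p / 2) :: complex)"
      by (simp add: field_simps flip: powr_add)
    moreover have "2 powr (- (3 * p / 2)) * 2 powr p = (2 powr (- p) * 2 powr (p / 2) :: complex)"
      by (simp add: field_simps flip: powr_add)
    ultimately show ?thesis by (simp add: left_diff_distrib right_diff_distrib)
  qed
  have "2 powr (- (3 * p / 2)) * (2 powr p - 1) * of_real t powr (p / 2) * Z * Gamma (p + 1)
      * (F1 / ?b - r * F2 / ?a) =
    (2 powr (- (3 * p / 2)) * (2 powr p - 1) * 2 powr p) * (of_real t powr (p / 2) * Z / of_real (sqrt pi) * (?a * ?b * (F1 / ?b - r * F2 / ?a)))"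
    unfolding G by (simp only: mult_ac times_divide_eq_left times_divide_eq_right)
  also have "\<dots> = (1 - 2 powr (- p)) * Z * (of_real (2 * t) powr (p / 2) / of_real (sqrt pi) * (?a * F1 - r * ?b * F2))"
    unfolding P D T by (simp only: mult_ac times_divide_eq_left times_divide_eq_right)
  finally show ?thesis .
qed

text \<open>The integral is the product of a series and the integral of a single tail. For \<sigma>
  > 1 both are finite; otherwise the series is infinite and the other factor is not 0.\<close>

lemma bar_count_mellin_bound:
  assumes t: "t > 0" and x: "x \<ge> 0"
  shows "(\<integral>\<^sup>+\<epsilon>. indicator {0<..} \<epsilon> * ennreal (\<epsilon> powr (\<sigma> - 1) * bar_count t x \<epsilon>) \<partial>lborel) < \<infinity> \<longleftrightarrow> \<sigma> > 1"
proof -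
  let ?h = "\<lambda>\<epsilon>. indicator {0<..} \<epsilon> * ennreal (\<epsilon> powr (\<sigma> - 1) * (2 * gauss_tail t (x + \<epsilon>)))"
  let ?K = "\<integral>\<^sup>+\<epsilon>. ?h \<epsilon> \<partial>lborel"
  let ?S = "\<Sum>k. ennreal (real (2 * k + 1) powr (- \<sigma>))"
  have gm[measurable]: "gauss_tail t \<in> borel_measurable borel" using t by (rule gauss_tail_measurable)
  have K0: "?K \<noteq> 0"
  proof
    assume "?K = 0"
    then have "AE \<epsilon> in lborel. ?h \<epsilon> = 0" by (subst (asm) nn_integral_0_iff_AE) measurable
    moreover have "?h \<epsilon> \<noteq> 0" if "\<epsilon> \<in> {0<..}" for \<epsilon>
      using that gauss_tail_pos[OF t, of "x + \<epsilon>"] by (simp add: ennreal_eq_0_iff not_le)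
    ultimately have "AE \<epsilon> in lborel. \<epsilon> \<notin> {0 :: real<..}" by (auto elim: eventually_mono)
    then have "{0 :: real<..} \<in> null_sets lborel" by (subst (asm) AE_iff_null_sets[symmetric]) auto
    then have "{1..2 :: real} \<in> null_sets lborel" by (rule null_sets_subset) auto
    then have "emeasure lborel {1..2 :: real} = 0" by (rule null_setsD1)
    then show False by simp
  qed
  show ?thesis
  proof (cases "\<sigma> > 1")
    case True
    have "summable (\<lambda>n. real n powr (- \<sigma>))" using True by (simp add: summable_real_powr_iff)
    then have "summable (\<lambda>n. real (n + 1) powr (- \<sigma>))" by (rule summable_ignore_initial_segment)
    moreover have "norm (real (2 * k + 1) powr (- \<sigma>)) \<le> real (k + 1) powr (- \<sigma>)" for k
      using True by (simp add: powr_mono2')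
    ultimately have S: "summable (\<lambda>k. real (2 * k + 1) powr (- \<sigma>))"
      by (rule summable_comparison_test'[of _ 0])
    have "?S = ennreal (\<Sum>k. real (2 * k + 1) powr (- \<sigma>))"
      by (rule suminf_ennreal2[OF _ S]) simp
    then have S': "?S < \<infinity>" by simp
    have "Re (of_real \<sigma>) > 1" using True by simp
    from gauss_tail_mellin(1)[OF t x this]
    have "(\<integral>\<^sup>+\<epsilon>. norm (indicator {0<..} \<epsilon> *\<^sub>R (complex_of_real \<epsilon> powr (of_real \<sigma> - 1) * of_real (gauss_tail t (x + \<epsilon>)))) \<partial>lborel) < \<infinity>"
      by (simp add: integrable_iff_bounded)
    then have "2 * (\<integral>\<^sup>+\<epsilon>. norm (indicator {0<..} \<epsilon> *\<^sub>R (complex_of_real \<epsilon> powr (of_real \<sigma> - 1) * of_real (gauss_tail t (x + \<epsilon>)))) \<partial>lborel) < \<infinity>"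
      by (simp add: ennreal_mult_less_top)
    also have "2 * (\<integral>\<^sup>+\<epsilon>. norm (indicator {0<..} \<epsilon> *\<^sub>R (complex_of_real \<epsilon> powr (of_real \<sigma> - 1) * of_real (gauss_tail t (x + \<epsilon>)))) \<partial>lborel) =
        (\<integral>\<^sup>+\<epsilon>. 2 * ennreal (norm (indicator {0<..} \<epsilon> *\<^sub>R (complex_of_real \<epsilon> powr (of_real \<sigma> - 1) * of_real (gauss_tail t (x + \<epsilon>))))) \<partial>lborel)"
      by (rule nn_integral_cmult[symmetric]) measurable
    also have "\<dots> = ?K"
    proof (rule nn_integral_cong)
      fix \<epsilon> :: real
      show "2 * ennreal (norm (indicator {0<..} \<epsilon> *\<^sub>R (complex_of_real \<epsilon> powr (of_real \<sigma> - 1) * of_real (gauss_tail t (x + \<epsilon>))))) = ?h \<epsilon>"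
      proof (cases "\<epsilon> > 0")
        case True
        have "norm (complex_of_real \<epsilon> powr (of_real \<sigma> - 1) * of_real (gauss_tail t (x + \<epsilon>))) = \<epsilon> powr (\<sigma> - 1) * gauss_tail t (x + \<epsilon>)"
          using True gauss_tail_nonneg by (simp add: norm_mult norm_of_real_powr)
        then show ?thesis
          using True ennreal_mult[of 2 "\<epsilon> powr (\<sigma> - 1) * gauss_tail t (x + \<epsilon>)"] gauss_tail_nonneg by (simp add: mult_ac)
      qed simp
    qed
    finally have "?K < \<infinity>" .
    then show ?thesis using True S' unfolding nn_integral_bar_count[OF t x] by (simp add: ennreal_mult_less_top)
  next
    case False
    have "?S = \<infinity>"
    proof (rule ccontr)
      assume "?S \<noteq> \<infinity>"
      then have "summable (\<lambda>k. real (2 * k + 1) powr (- \<sigma>))"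
        by (intro summable_suminf_not_top) simp_all
      \<comment> \<open>For \<sigma> at most 1 the terms dominate half of the harmonic
        series.\<close>
      moreover have "norm (inverse (real (Suc k)) / 2) \<le> real (2 * k + 1) powr (- \<sigma>)" for k
      proof -
        have "inverse (real (Suc k)) / 2 = 1 / (2 * real k + 2)" by (simp add: field_simps)
        also have "\<dots> \<le> 1 / (2 * real k + 1)" by (intro divide_left_mono) auto
        also have "\<dots> = real (2 * k + 1) powr (- 1)" by (simp add: powr_minus_divide)
        also have "\<dots> \<le> real (2 * k + 1) powr (- \<sigma>)" using False by (intro powr_mono) auto
        finally show ?thesis by simp
      qed
      ultimately have "summable (\<lambda>k. inverse (real (Suc k)) / 2)"
        by (rule summable_comparison_test'[of _ 0])
      then have "summable (\<lambda>k. inverse (real (Suc k)))" by simp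
      then have "summable (\<lambda>k. inverse (real k))" by (subst (asm) summable_Suc_iff)
      then show False using not_summable_harmonic[where 'a = real] by simp
    qed
    then show ?thesis using False K0 unfolding nn_integral_bar_count[OF t x] by (simp add: ennreal_top_mult)
  qed
qed

lemma bar_count_measurable:
  assumes t: "t > 0"
  shows "bar_count t x \<in> borel_measurable borel"
proof -
  have gm: "gauss_tail t \<in> borel_measurable borel" using t by (rule gauss_tail_measurable)
  have "(\<lambda>\<epsilon>. 2 * gauss_tail t (x + real (2 * k + 1) * \<epsilon>)) \<in> borel_measurable borel" for k :: nat
    by (intro borel_measurable_times borel_measurable_const measurable_compose[OF _ gm]) measurable
  then show ?thesis unfolding bar_count_def[abs_def] by (rule borel_measurable_suminf)
qed

lemma bar_count_integrable_iff:
  assumes t: "t > 0" and x: "x \<ge> 0"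
  shows "set_integrable lborel {0<..} (\<lambda>\<epsilon>. complex_of_real \<epsilon> powr (p - 1) * of_real (bar_count t x \<epsilon>)) \<longleftrightarrow> Re p > 1"
proof -
  have bm[measurable]: "bar_count t x \<in> borel_measurable borel" using t by (rule bar_count_measurable)
  have "ennreal (norm (indicator {0<..} \<epsilon> *\<^sub>R (complex_of_real \<epsilon> powr (p - 1) * of_real (bar_count t x \<epsilon>)))) =
      indicator {0<..} \<epsilon> * ennreal (\<epsilon> powr (Re p - 1) * bar_count t x \<epsilon>)" for \<epsilon>
    using bar_count_nonneg[OF t x, of \<epsilon>] by (simp add: indicator_def norm_mult norm_of_real_powr)
  moreover have "(\<lambda>\<epsilon>. indicator {0<..} \<epsilon> *\<^sub>R (complex_of_real \<epsilon> powr (p - 1) * of_real (bar_count t x \<epsilon>))) \<in> borel_measurable lborel"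
    by measurable
  ultimately show ?thesis
    unfolding set_integrable_def integrable_iff_bounded using bar_count_mellin_bound[OF t x, of "Re p"] by simp
qed

text \<open>Termwise integration: scaling by \<open>2 * k + 1\<close> makes each term the same
  integral times \<open>of_nat (2 * k + 1) powr (- p)\<close>, and these powers sum to the odd part
  of the zeta series.\<close>

lemma bar_count_mellin:
  assumes t: "t > 0" and x: "x \<ge> 0" and p: "Re p > 1"
  shows "(LINT \<epsilon>:{0<..}|lborel. complex_of_real \<epsilon> powr (p - 1) * of_real (bar_count t x \<epsilon>)) =
    (1 - 2 powr (- p)) * riemann_zeta p *
      (2 * (LINT y:{0<..}|lborel. of_real y powr p * of_real (normal_density 0 (sqrt t) (x + y)))) / p"
proof -
  define G where "G \<epsilon> = indicator {0<..} \<epsilon> *\<^sub>R (complex_of_real \<epsilon> powr (p - 1) * of_real (gauss_tail t (x + \<epsilon>)))" for \<epsilon>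
  note G = gauss_tail_mellin[OF t x p, folded G_def]
  define L where "L = (LINT \<epsilon>|lborel. G \<epsilon>)"
  define a where "a k \<epsilon> = indicator {0<..} \<epsilon> *\<^sub>R (complex_of_real \<epsilon> powr (p - 1) * of_real (2 * gauss_tail t (x + real (2 * k + 1) * \<epsilon>)))" for k :: nat and \<epsilon>
  define c where "c k = real (2 * k + 1)" for k
  have c: "c k > 0" for k by (simp add: c_def)
  have a: "a k \<epsilon> = (2 * of_real (c k) powr (1 - p)) * G (0 + c k * \<epsilon>)" for k \<epsilon>
  proof (cases "\<epsilon> > 0")
    case True
    have "complex_of_real (c k * \<epsilon>) powr (p - 1) = of_real (c k) powr (p - 1) * of_real \<epsilon> powr (p - 1)"
      unfolding of_real_mult using c[of k] True by (intro powr_times_real) auto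
    moreover have "complex_of_real (c k) powr (1 - p) * of_real (c k) powr (p - 1) = 1"
      using c[of k] by (simp flip: powr_add)
    ultimately have "complex_of_real \<epsilon> powr (p - 1) = of_real (c k) powr (1 - p) * of_real (c k * \<epsilon>) powr (p - 1)"
      by (simp only: mult.assoc[symmetric] mult_1)
    then show ?thesis using True c[of k] unfolding a_def G_def c_def[symmetric] by (simp add: mult_ac)
  next
    case False
    then have "\<not> c k * \<epsilon> > 0" using c[of k] by (simp add: zero_less_mult_iff)
    then show ?thesis using False by (simp add: a_def G_def)
  qed
  have ai: "integrable lborel (a k)" "(LINT \<epsilon>|lborel. a k \<epsilon>) = 2 * L * of_nat (2 * k + 1) powr (- p)" for k
  proof -
    have c0: "c k \<noteq> 0" using c[of k] by simp
    have "a k = (\<lambda>\<epsilon>. (2 * of_real (c k) powr (1 - p)) * G (0 + c k * \<epsilon>))" by (rule ext) (rule a)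
    then show "integrable lborel (a k)"
      using lborel_integrable_real_affine[OF G(1) c0, of 0] by (simp only: integrable_mult_right)
    have "L = c k *\<^sub>R (LINT \<epsilon>|lborel. G (0 + c k * \<epsilon>))"
      unfolding L_def using lborel_integral_real_affine[OF c0, of G 0] c[of k] by simp
    then have "(LINT \<epsilon>|lborel. G (0 + c k * \<epsilon>)) = L / of_real (c k)"
      using c0 by (simp add: scaleR_conv_of_real)
    then have "(LINT \<epsilon>|lborel. a k \<epsilon>) = (2 * of_real (c k) powr (1 - p)) * (L / of_real (c k))"
      unfolding a by (simp only: integral_mult_right_zero)
    also have "complex_of_real (c k) powr (1 - p) = of_real (c k) * of_real (c k) powr (- p)"
      using c0 powr_add[of "complex_of_real (c k)" 1 "- p"] by simp
    finally show "(LINT \<epsilon>|lborel. a k \<epsilon>) = 2 * L * of_nat (2 * k + 1) powr (- p)"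
      using c0 by (simp add: c_def del: of_nat_mult of_nat_add of_nat_Suc)
  qed
  have sums: "(\<lambda>k. a k \<epsilon>) sums (indicator {0<..} \<epsilon> *\<^sub>R (complex_of_real \<epsilon> powr (p - 1) * of_real (bar_count t x \<epsilon>)))" for \<epsilon>
  proof (cases "\<epsilon> > 0")
    case True
    show ?thesis unfolding a_def
      by (intro sums_scaleR_right sums_mult sums_of_real bar_count_sums[OF t x True])
  qed (simp add: a_def)
  let ?w = "\<lambda>\<epsilon>. norm (indicator {0<..} \<epsilon> *\<^sub>R (complex_of_real \<epsilon> powr (p - 1) * of_real (bar_count t x \<epsilon>)))"
  have I: "integrable lborel (\<lambda>\<epsilon>. indicator {0<..} \<epsilon> *\<^sub>R (complex_of_real \<epsilon> powr (p - 1) * of_real (bar_count t x \<epsilon>)))"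
    using bar_count_integrable_iff[OF t x, of p] p unfolding set_integrable_def by simp
  \<comment> \<open>All terms share the complex factor \<open>\<epsilon> powr (p - 1)\<close> and
    are otherwise nonnegative, so the norm of the full sum dominates every partial sum.\<close>
  have dom: "norm (\<Sum>k<N. a k \<epsilon>) \<le> ?w \<epsilon>" for N \<epsilon>
  proof (cases "\<epsilon> > 0")
    case True
    define S where "S = (\<Sum>k<N. 2 * gauss_tail t (x + real (2 * k + 1) * \<epsilon>))"
    have "(\<Sum>k<N. a k \<epsilon>) = of_real \<epsilon> powr (p - 1) * of_real S"
      using True unfolding a_def S_def of_real_sum sum_distrib_left by simp
    moreover have "S \<le> bar_count t x \<epsilon>"
      unfolding S_def sums_unique[OF bar_count_sums[OF t x True]] using gauss_tail_nonneg
      by (intro sum_le_suminf sums_summable[OF bar_count_sums[OF t x True]]) auto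
    moreover have "S \<ge> 0"
      unfolding S_def using gauss_tail_nonneg by (intro sum_nonneg) simp
    ultimately show ?thesis using True by (simp add: norm_mult mult_left_mono)
  qed (simp add: a_def)
  have "(\<lambda>N. LINT \<epsilon>|lborel. (\<Sum>k<N. a k \<epsilon>)) \<longlonglongrightarrow> (LINT \<epsilon>|lborel. indicator {0<..} \<epsilon> *\<^sub>R (complex_of_real \<epsilon> powr (p - 1) * of_real (bar_count t x \<epsilon>)))"
  proof (rule integral_dominated_convergence[where w = ?w])
    show "integrable lborel ?w" using I by (rule integrable_norm)
    show "(\<lambda>\<epsilon>. \<Sum>k<N. a k \<epsilon>) \<in> borel_measurable lborel" for N
      by (intro borel_measurable_sum borel_measurable_integrable ai(1))
    show "AE \<epsilon> in lborel. (\<lambda>N. \<Sum>k<N. a k \<epsilon>) \<longlonglongrightarrow> indicator {0<..} \<epsilon> *\<^sub>R (complex_of_real \<epsilon> powr (p - 1) * of_real (bar_count t x \<epsilon>))"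
      using sums unfolding sums_def by (intro AE_I2)
    show "AE \<epsilon> in lborel. norm (\<Sum>k<N. a k \<epsilon>) \<le> ?w \<epsilon>" for N
      using dom by (intro AE_I2)
  qed (rule borel_measurable_integrable[OF I])
  moreover have "(LINT \<epsilon>|lborel. (\<Sum>k<N. a k \<epsilon>)) = (\<Sum>k<N. 2 * L * of_nat (2 * k + 1) powr (- p))" for N
    using ai by (simp only: Bochner_Integration.integral_sum)
  ultimately have "(\<lambda>k. 2 * L * of_nat (2 * k + 1) powr (- p)) sums
      (LINT \<epsilon>|lborel. indicator {0<..} \<epsilon> *\<^sub>R (complex_of_real \<epsilon> powr (p - 1) * of_real (bar_count t x \<epsilon>)))"
    unfolding sums_def by (simp only:)
  from sums_unique2[OF this sums_mult[OF odd_zeta_sums[OF p]]]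
  have "(LINT \<epsilon>:{0<..}|lborel. complex_of_real \<epsilon> powr (p - 1) * of_real (bar_count t x \<epsilon>)) =
      2 * L * ((1 - 2 powr (- p)) * riemann_zeta p)"
    unfolding set_lebesgue_integral_def .
  then show ?thesis unfolding L_def G(2) by simp
qed

section \<open>Continuation to the whole plane\<close>

lemma meromorphic_closed_form:
  assumes t: "t > 0"
  shows "(\<lambda>p. 2 powr (- (3 * p / 2)) * (2 powr p - 1) * of_real t powr (p / 2)
            * riemann_zeta p * Gamma (p + 1)
            * (hypergeo_1F1 (- p / 2) (1 / 2) z / Gamma (p / 2 + 1)
               - r * hypergeo_1F1 ((1 - p) / 2) (3 / 2) z / Gamma ((p + 1) / 2))) meromorphic_on UNIV"
proof -
  have hol: "f meromorphic_on UNIV" if "f holomorphic_on UNIV" for f :: "complex \<Rightarrow> complex"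
    using that by (intro analytic_on_imp_meromorphic_on) (simp add: analytic_on_open)
  have hyp: "(\<lambda>p. hypergeo_1F1 (g p) (of_real b) z) holomorphic_on UNIV"
    if "g holomorphic_on UNIV" "b > 0" for g b
    using holomorphic_on_compose_gen[OF that(1) holomorphic_hypergeo[OF that(2)], of z] by (simp add: o_def)
  have h1: "(\<lambda>p. hypergeo_1F1 (- p / 2) (1 / 2) z) holomorphic_on UNIV"
    using hyp[of "\<lambda>p. - p / 2" "1 / 2"] by (simp add: holomorphic_intros)
  have h2: "(\<lambda>p. hypergeo_1F1 ((1 - p) / 2) (3 / 2) z) holomorphic_on UNIV"
    using hyp[of "\<lambda>p. (1 - p) / 2" "3 / 2"] by (simp add: holomorphic_intros)
  \<comment> \<open>\<open>rGamma\<close> is entire. The identity holds at the poles too, where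
    \<open>Gamma\<close> and the inverse of 0 are both 0 by convention.\<close>
  have Gamma_rGamma: "Gamma s = inverse (rGamma s)" for s :: complex by (simp add: rGamma_inverse_Gamma)
  have "(\<lambda>p. rGamma (p + 1)) holomorphic_on UNIV" "(\<lambda>p. rGamma (p / 2 + 1)) holomorphic_on UNIV"
    "(\<lambda>p. rGamma ((p + 1) / 2)) holomorphic_on UNIV" "(\<lambda>p. 2 powr (- (3 * p / 2)) :: complex) holomorphic_on UNIV"
    "(\<lambda>p. 2 powr p :: complex) holomorphic_on UNIV" "(\<lambda>p. of_real t powr (p / 2) :: complex) holomorphic_on UNIV"
    using t by (auto intro!: holomorphic_intros)
  note mero = this[THEN hol] h1[THEN hol] h2[THEN hol] meromorphic_riemann_zeta
  show ?thesis unfolding Gamma_rGamma by (intro meromorphic_intros mero)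
qed

theorem theorem4p6:
  fixes M :: "'a measure" and B :: "real \<Rightarrow> 'a \<Rightarrow> real" and t x :: real
  assumes "t > 0" and "x > 0"
    and "standard_brownian_motion_on M B t"
  shows "local_zeta_domain M B t x = {p. Re p > 1} \<and>
    meromorphic_continuation (local_zeta M B t x) (local_zeta_domain M B t x)
      (\<lambda>p. 2 powr (- (3 * p / 2)) * (2 powr p - 1) * of_real t powr (p / 2)
            * riemann_zeta p * Gamma (p + 1)
            * (hypergeo_1F1 (- p / 2) (1 / 2) (of_real (- (x\<^sup>2) / (2 * t))) / Gamma (p / 2 + 1)
               - of_real (sqrt (2 * x\<^sup>2 / t))
                 * hypergeo_1F1 ((1 - p) / 2) (3 / 2) (of_real (- (x\<^sup>2) / (2 * t)))
                 / Gamma ((p + 1) / 2)))"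
proof -
  interpret standard_brownian_motion_on M B t by fact
  have t: "t > 0" and x: "x \<ge> 0" using assms by auto
  have count: "expected_num_bars M B t x \<epsilon> = ennreal (bar_count t x \<epsilon>)" if "\<epsilon> > 0" for \<epsilon>
    using expected_num_bars_eq[OF t that assms(2)] bar_count_ennreal[OF t x that] by simp
  have integrand: "local_zeta_integrand M B t x p \<epsilon> = complex_of_real \<epsilon> powr (p - 1) * of_real (bar_count t x \<epsilon>)"
    if "\<epsilon> \<in> {0<..}" for p \<epsilon>
    using that bar_count_nonneg[OF t x, of \<epsilon>] count[of \<epsilon>] by (simp add: local_zeta_integrand_def)
  have "set_integrable lborel {0<..} (local_zeta_integrand M B t x p) \<longleftrightarrow>
      set_integrable lborel {0<..} (\<lambda>\<epsilon>. complex_of_real \<epsilon> powr (p - 1) * of_real (bar_count t x \<epsilon>))" for p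
    by (rule set_integrable_cong[OF refl refl integrand])
  \<comment> \<open>The count is finite for every positive \<epsilon>, so integrability alone
    decides.\<close>
  then have dom: "local_zeta_domain M B t x = {p. Re p > 1}"
    unfolding local_zeta_domain_def bar_count_integrable_iff[OF t x] using count by simp
  have "local_zeta M B t x p = (1 - 2 powr (- p)) * riemann_zeta p *
      (2 * (LINT y:{0<..}|lborel. of_real y powr p * of_real (normal_density 0 (sqrt t) (x + y))))"
    if p: "Re p > 1" for p
  proof -
    have "(LINT \<epsilon>:{0<..}|lborel. local_zeta_integrand M B t x p \<epsilon>) =
        (LINT \<epsilon>:{0<..}|lborel. complex_of_real \<epsilon> powr (p - 1) * of_real (bar_count t x \<epsilon>))"
      by (rule set_lebesgue_integral_cong) (use integrand in auto)
    \<comment> \<open>The factor \<open>p\<close> in \<open>local_zeta\<close> cancels the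
      denominator left by integrating \<open>\<epsilon> powr (p - 1)\<close>.\<close>
    moreover have "p \<noteq> 0" using p by auto
    ultimately show ?thesis unfolding local_zeta_def bar_count_mellin[OF t x p] by simp
  qed
  then show ?thesis
    unfolding meromorphic_continuation_def dom shifted_gaussian_moment[OF t assms(2)]
    using meromorphic_closed_form[OF t] by (simp add: closed_form_eq[OF t] shifted_gaussian_moment[OF t assms(2)])
qed

end
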